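(* Let $(X,d)$ be a complete separable metric space, let $A\subset X$ be an analytic set, and let $k$ be a positive integer. If $\dim_H A>k$, then there exists a Lipschitz map $f:A\to\mathbb{R}^k$ with $f(A)=[0,1]^k$.
   Context: $\dim_H$ denotes Hausdorff dimension. A subset of a complete separable metric space is analytic if it is a continuous image of a Borel subset of a complete separable metric space (equivalently, a continuous image of $\omega^\omega$, or empty). *)

theory Defs
  imports "HOL-Analysis.Analysis"
begin

text \<open>Analytic subset of a Polish space: empty, or a continuous image of the Baire
  space nat => nat (product topology of discrete nat).\<close>
definition analytic :: "'a::topological_space set \<Rightarrow> bool" where
  "analytic A \<longleftrightarrow> A = {} \<or>
     (\<exists>g :: (nat \<Rightarrow> nat) \<Rightarrow> 'a. continuous_on UNIV g \<and> range g = A)"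

text \<open>Hausdorff pre-measure at scale delta (countable covers by bounded sets of
  diameter at most delta), for exponent s > 0.\<close>
definition hausdorff_pre :: "real \<Rightarrow> real \<Rightarrow> 'a::metric_space set \<Rightarrow> ennreal" where
  "hausdorff_pre s \<delta> A = (INF C \<in> {C :: nat \<Rightarrow> 'a set.
       A \<subseteq> (\<Union>i. C i) \<and> (\<forall>i. bounded (C i) \<and> diameter (C i) \<le> \<delta>)}.
     (\<Sum>i. ennreal (diameter (C i) powr s)))"

definition hausdorff_measure :: "real \<Rightarrow> 'a::metric_space set \<Rightarrow> ennreal" where
  "hausdorff_measure s A = (SUP \<delta> \<in> {0<..}. hausdorff_pre s \<delta> A)"

definition hausdorff_dim :: "'a::metric_space set \<Rightarrow> ereal" where
  "hausdorff_dim A = Inf {ereal s | s. s > 0 \<and> hausdorff_measure s A = 0}"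

end

theory Submission
  imports Defs "HOL-Library.Ramsey"
begin

text \<open>Pick \<open>s > n\<close>, where \<open>n\<close> is the dimension of the cube, such that \<open>A\<close> has no countable cover with arbitrarily small
\<open>s\<close>-dimensional cost. It is enough to find an expanding map \<open>y\<close> from the cube into \<open>A\<close>: its inverse is then Lipschitz on
the range of \<open>y\<close>, and coordinatewise McShane extension followed by truncation to \<open>[0,1]\<close> gives the required map.
Reading the digits of the \<open>n\<close> coordinates simultaneously as one expansion with gaps reduces this to finding, for
some \<open>k > n\<close>, a map \<open>x : [0,1] \<rightarrow> A\<close> with \<open>c |t - t'| \<le> dist (x t) (x t')\<^sup>k\<close>.

The map \<open>x\<close> comes from a Cantor scheme in \<open>A\<close>. A node of the scheme is a set that is not coverable at cost \<open>v\<close> in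
dimension \<open>q\<close>, and it is attached to an interval of length \<open>v\<close>. It is split into finitely many subsets at mutual
distance at least \<open>v\<^sup>1\<^sup>/\<^sup>k\<close> that are not coverable at costs summing to \<open>v\<close> in a slightly smaller dimension. No
mass is lost in the split, because a finite Frostman measure can be carved along a scale at which the masses of
balls hardly grow; only the exponent deteriorates, and the losses are summable along the scheme. Since the cost of
an increasing union is controlled by the costs of its members, each node can moreover be placed in a finite union of
cylinders of the parametrisation of \<open>A\<close> by the Baire space, so all limits along the scheme stay in \<open>A\<close>.\<close>

subsection \<open>Covers of bounded cost\<close>

text \<open>The argument works with costs of covers (Hausdorff content), not with measures on
  \<open>A\<close>: all weights live on finitely many cells, so measurability never enters. The
  intervals attached to the pieces of a node must tile the interval of the node, so the costs of the
  pieces have to add up to exactly \<open>v\<close>, although separating them discards shells. The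
  compensating reweighting is cheap only at a radius where doubling multiplies the mass of balls by
  at most \<open>(1 / M) powr (1 / h)\<close>, \<open>M\<close> being the mass of the smallest ball;
  such a radius exists among \<open>h\<close> successive doublings. A drop \<open>g\<close> of the
  exponent needs \<open>h\<close> of order \<open>1 / g\<close>, hence constants as large as an
  exponential of a multiple of \<open>1 / g\<close>, while the gain is only a power of the cost of
  order \<open>g\<close>. So a node can be split once its cost is below
  \<open>exp (- D / g^2)\<close>. As all exponents stay above a number larger than \<open>k\<close>,
  a piece costs at most a fixed power \<open>1 + c\<close> of the cost of its parent. Costs thus
  decay doubly exponentially, and the drops may decay geometrically.\<close>

text \<open>The size \<open>e i\<close> is only an upper bound for the diameter of \<open>C i\<close> and is required to be positive. This avoids the junk
value \<open>0 powr s = 0\<close>, and bounding the finite partial sums avoids the junk values of divergent series.\<close>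

definition covering :: "real \<Rightarrow> real \<Rightarrow> 'a::metric_space set \<Rightarrow> nat set \<Rightarrow> (nat \<Rightarrow> 'a set) \<Rightarrow> (nat \<Rightarrow> real) \<Rightarrow> bool" where
  "covering s \<kappa> E I C e \<longleftrightarrow> E \<subseteq> (\<Union>i\<in>I. C i) \<and>
     (\<forall>i\<in>I. 0 < e i \<and> (\<forall>x\<in>C i. \<forall>y\<in>C i. dist x y \<le> e i)) \<and>
     (\<forall>F. finite F \<and> F \<subseteq> I \<longrightarrow> (\<Sum>i\<in>F. e i powr s) \<le> \<kappa>)"

definition cov :: "real \<Rightarrow> real \<Rightarrow> 'a::metric_space set \<Rightarrow> bool" where
  "cov s \<kappa> E \<longleftrightarrow> (\<exists>I C e. covering s \<kappa> E I C e)"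

lemma coveringD:
  assumes "covering s \<kappa> E I C e"
  shows "E \<subseteq> (\<Union>i\<in>I. C i)" "\<And>i. i \<in> I \<Longrightarrow> 0 < e i"
    "\<And>i x y. i \<in> I \<Longrightarrow> x \<in> C i \<Longrightarrow> y \<in> C i \<Longrightarrow> dist x y \<le> e i"
    "\<And>F. finite F \<Longrightarrow> F \<subseteq> I \<Longrightarrow> (\<Sum>i\<in>F. e i powr s) \<le> \<kappa>"
  using assms unfolding covering_def by simp_all

lemma covI:
  fixes J :: "'b set" and C :: "'b \<Rightarrow> 'a::metric_space set"
  assumes J: "countable J" and E: "E \<subseteq> (\<Union>i\<in>J. C i)"
    and e: "\<And>i. i \<in> J \<Longrightarrow> 0 < e i"
    and d: "\<And>i x y. i \<in> J \<Longrightarrow> x \<in> C i \<Longrightarrow> y \<in> C i \<Longrightarrow> dist x y \<le> e i"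
    and c: "\<And>F. finite F \<Longrightarrow> F \<subseteq> J \<Longrightarrow> (\<Sum>i\<in>F. e i powr s) \<le> \<kappa>"
  shows "cov s \<kappa> E"
proof -
  define f where "f = from_nat_into J"
  define I where "I = to_nat_on J ` J"
  have inj: "inj_on (to_nat_on J) J" using J by (rule inj_on_to_nat_on)
  have f: "f (to_nat_on J j) = j" if "j \<in> J" for j
    unfolding f_def using J that by simp
  have fI: "f i \<in> J" if "i \<in> I" for i using that f unfolding I_def by auto
  have injf: "inj_on f I" unfolding I_def inj_on_def using f by auto
  show ?thesis
    unfolding cov_def covering_def
  proof (intro exI[of _ I] exI[of _ "C \<circ> f"] exI[of _ "e \<circ> f"] conjI ballI allI impI)
    show "E \<subseteq> (\<Union>i\<in>I. (C \<circ> f) i)"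
      using E f unfolding I_def by fastforce
  next
    fix F assume "finite F \<and> F \<subseteq> I"
    then have F: "finite F" "F \<subseteq> I" by auto
    have "(\<Sum>i\<in>F. (e \<circ> f) i powr s) = (\<Sum>i\<in>f ` F. e i powr s)"
      using inj_on_subset[OF injf F(2)] by (simp add: sum.reindex)
    also have "\<dots> \<le> \<kappa>" using F fI by (intro c) auto
    finally show "(\<Sum>i\<in>F. (e \<circ> f) i powr s) \<le> \<kappa>" .
  qed (use e d fI in auto)
qed

lemma cov_subset: "cov s \<kappa> E \<Longrightarrow> E' \<subseteq> E \<Longrightarrow> cov s \<kappa> E'"
  unfolding cov_def covering_def by (meson order_trans)

lemma cov_mono: "cov s \<kappa> E \<Longrightarrow> \<kappa> \<le> \<kappa>' \<Longrightarrow> cov s \<kappa>' E"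
  unfolding cov_def covering_def by (meson order_trans)

lemma cov_empty: "0 \<le> \<kappa> \<Longrightarrow> cov s \<kappa> {}"
  by (rule covI[of "{}" _ "\<lambda>_. {}"]) auto

lemma cov_nonneg: "cov s \<kappa> E \<Longrightarrow> 0 \<le> \<kappa>"
  unfolding cov_def covering_def by (metis empty_subsetI finite.emptyI sum.empty)

lemma cov_single:
  assumes "0 < e" "\<And>x y. x \<in> E \<Longrightarrow> y \<in> E \<Longrightarrow> dist x y \<le> e"
  shows "cov s (e powr s) E"
proof (rule covI[of "{()}" _ "\<lambda>_. E" "\<lambda>_. e"])
  fix F :: "unit set" assume "F \<subseteq> {()}"
  then have "F = {} \<or> F = {()}" by auto
  then show "(\<Sum>i\<in>F. e powr s) \<le> e powr s" by auto
qed (use assms in auto)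

lemma cov_size_le_1:
  assumes "\<And>F. finite F \<Longrightarrow> F \<subseteq> I \<Longrightarrow> (\<Sum>i\<in>F. e i powr s) \<le> \<kappa>" "\<kappa> \<le> 1" "0 < s" "i \<in> I" "0 < e i"
  shows "e i \<le> (1::real)"
proof -
  have "e i powr s \<le> 1" using assms(1)[of "{i}"] assms by auto
  then show ?thesis
    using assms(3) powr_less_mono2[of s 1 "e i"] by (metis dual_order.strict_trans1 linorder_not_le powr_one_eq_one zero_le_one order_less_irrefl)
qed

text \<open>Cost at most 1 forces all sizes to be at most 1, and only then does a larger exponent
  make every term smaller.\<close>

lemma cov_exponent_mono:
  assumes "cov s \<kappa> E" "\<kappa> \<le> 1" "0 < s" "s \<le> s'"
  shows "cov s' \<kappa> E"
proof -
  obtain I C e where "covering s \<kappa> E I C e"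
    using assms(1) unfolding cov_def by blast
  note c = coveringD[OF this]
  have le1: "e i \<le> 1" if "i \<in> I" for i
    using cov_size_le_1[of I e s \<kappa> i] c(4) assms(2,3) that c(2)[OF that] by blast
  show ?thesis
  proof (rule covI[of I _ C e])
    fix F assume F: "finite F" "F \<subseteq> I"
    have "(\<Sum>i\<in>F. e i powr s') \<le> (\<Sum>i\<in>F. e i powr s)"
      using F le1 c(2) assms(4) by (intro sum_mono powr_mono') (auto intro: less_imp_le)
    then show "(\<Sum>i\<in>F. e i powr s') \<le> \<kappa>" using c(4)[OF F] by linarith
  qed (use c in auto)
qed

lemma cov_UN:
  assumes E: "\<And>n::nat. cov s (\<kappa> n) (E n)" and k: "\<And>N. (\<Sum>n<N. \<kappa> n) \<le> K"
  shows "cov s K (\<Union>n. E n)"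
proof -
  have "\<forall>n. \<exists>I C e. covering s (\<kappa> n) (E n) I C e"
    using E unfolding cov_def by blast
  then obtain I C e where "\<And>n. covering s (\<kappa> n) (E n) (I n) (C n) (e n)"
    by metis
  note c = coveringD[OF this]
  have k0: "0 \<le> \<kappa> n" for n using cov_nonneg[OF E] .
  show ?thesis
  proof (rule covI[of "SIGMA n:UNIV. I n" _ "\<lambda>(n,i). C n i" "\<lambda>(n,i). e n i"])
    show "(\<Union>n. E n) \<subseteq> (\<Union>i\<in>SIGMA n:UNIV. I n. case i of (n, i) \<Rightarrow> C n i)"
      using c(1) by fastforce
  next
    fix F assume F: "finite F" "F \<subseteq> (SIGMA n:UNIV. I n)"
    define G where "G = fst ` F"
    define H where "H n = {i. (n,i) \<in> F}" for n
    have fG: "finite G" using F unfolding G_def by auto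
    have fH: "finite (H n)" for n
      unfolding H_def using F(1) by (rule finite_subset[rotated, OF finite_imageI[where h=snd]]) force
    have FS: "F = (SIGMA n:G. H n)" unfolding G_def H_def by force
    have "(\<Sum>i\<in>F. (case i of (n, i) \<Rightarrow> e n i) powr s) = (\<Sum>n\<in>G. \<Sum>i\<in>H n. e n i powr s)"
      unfolding FS using fG fH by (subst sum.Sigma) (auto intro!: sum.cong)
    also have "\<dots> \<le> (\<Sum>n\<in>G. \<kappa> n)"
      using fH F(2) by (intro sum_mono c(4)) (auto simp: H_def)
    also have "\<dots> \<le> (\<Sum>n<Suc (Max (insert 0 G)). \<kappa> n)"
      using fG k0 by (intro sum_mono2) (auto simp: less_Suc_eq_le)
    also have "\<dots> \<le> K" by (rule k)
    finally show "(\<Sum>i\<in>F. (case i of (n, i) \<Rightarrow> e n i) powr s) \<le> K" .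
  next
    show "countable (SIGMA n:UNIV. I n)" by simp
  next
    fix i assume "i \<in> (SIGMA n:UNIV. I n)"
    then show "0 < (case i of (n, i) \<Rightarrow> e n i)" using c(2) by (cases i) simp
  next
    fix i x y assume "i \<in> (SIGMA n:UNIV. I n)" "x \<in> (case i of (n, i) \<Rightarrow> C n i)" "y \<in> (case i of (n, i) \<Rightarrow> C n i)"
    then show "dist x y \<le> (case i of (n, i) \<Rightarrow> e n i)" using c(3) by (cases i) simp
  qed
qed

lemma cov_Un:
  assumes "cov s a E" "cov s b F"
  shows "cov s (a + b) (E \<union> F)"
proof -
  have "cov s (a+b) (\<Union>n::nat. if n = 0 then E else if n = 1 then F else {})"
  proof (rule cov_UN[where \<kappa> = "\<lambda>n. if n = 0 then a else if n = 1 then b else 0"])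
    fix N :: nat
    have "(\<Sum>n<N. if n = 0 then a else if n = 1 then b else (0::real)) \<le> (\<Sum>n<max N 2. if n = 0 then a else if n = 1 then b else 0)"
      using cov_nonneg[OF assms(1)] cov_nonneg[OF assms(2)] by (intro sum_mono2) auto
    also have "\<dots> = (\<Sum>n\<in>{0,1::nat}. if n = 0 then a else if n = 1 then b else 0)"
      by (rule sum.mono_neutral_right[of "{..<max N 2}" "{0,1::nat}"]) auto
    finally show "(\<Sum>n<N. if n = 0 then a else if n = 1 then b else (0::real)) \<le> a + b" by simp
  qed (use assms cov_empty in auto)
  moreover have "(\<Union>n::nat. if n = 0 then E else if n = 1 then F else {}) = E \<union> F"
    by (auto split: if_splits intro!: exI[of _ "Suc 0"])
  ultimately show ?thesis by simp
qed

subsection \<open>Increasing unions\<close>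

text \<open>Covers of the sets \<open>E l\<close> need not converge in a non-compact space, so no
  limit cover is available. The point is that one \<open>W\<close> serves all \<open>N\<close>; what
  it misses lies in members smaller than \<open>\<rho>\<close>, and raising the exponent by
  \<open>\<eta>\<close> multiplies their cost by at most \<open>\<rho> powr \<eta>\<close>.\<close>

lemma increasing_step:
  fixes E :: "nat \<Rightarrow> 'a::metric_space set"
  assumes cov: "\<And>l. cov s \<kappa> (E l)" and mono: "\<And>m n. m \<le> n \<Longrightarrow> E m \<subseteq> E n"
    and s: "0 < s" and k1: "\<kappa> \<le> 1" and r: "0 < \<rho>" and eta: "0 \<le> \<eta>"
  shows "\<exists>W. cov s (2 * 6 powr s * \<kappa>) W \<and> (\<forall>N. cov (s + \<eta>) (2 * \<rho> powr \<eta> * \<kappa>) (E N - W))"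
proof -
  have "\<forall>l. \<exists>I C e. covering s \<kappa> (E l) I C e"
    using cov unfolding cov_def by blast
  then obtain I C e where "\<And>l. covering s \<kappa> (E l) (I l) (C l) (e l)" by metis
  note c = coveringD[OF this]
  \<comment> \<open>Each cover has boundedly many members of size at least \<open>\<rho>\<close>. By Ramsey's theorem one may assume that the pattern of
    intersections between the large members of the \<open>l\<close>-th and the \<open>l'\<close>-th cover does not depend on \<open>l < l'\<close>. Take for \<open>W\<close>
    the union of all large members that meet a large member of the first cover: it is as cheap as that cover, and a
    point outside \<open>W\<close> cannot lie in large members of two different covers.\<close>
  define B where "B l = {i \<in> I l. \<rho> \<le> e l i}" for l
  define m where "m = nat \<lfloor>\<kappa> / \<rho> powr s\<rfloor>"
  have BI: "B l \<subseteq> I l" for l unfolding B_def by auto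
  have card_le: "card F \<le> m" if "F \<subseteq> B l" "finite F" for l F
  proof -
    have "real (card F) * \<rho> powr s = (\<Sum>i\<in>F. \<rho> powr s)" by simp
    also have "\<dots> \<le> (\<Sum>i\<in>F. e l i powr s)"
      using that r s by (intro sum_mono powr_mono2) (auto simp: B_def)
    also have "\<dots> \<le> \<kappa>" using that BI[of l] by (intro c(4)) auto
    finally have "real (card F) \<le> \<kappa> / \<rho> powr s" using r by (simp add: field_simps)
    then show ?thesis unfolding m_def by linarith
  qed
  have finB: "finite (B l)" and cardB: "card (B l) \<le> m" for l
    using finite_if_finite_subsets_card_bdd[of "B l" m] card_le[of _ l] by auto
  have "\<forall>l. \<exists>h. bij_betw h {0..<card (B l)} (B l)"
    using ex_bij_betw_nat_finite[OF finB] by blast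
  then obtain h where h: "\<And>l. bij_betw (h l) {0..<card (B l)} (B l)" by metis
  define D where "D l i = C l (h l i)" for l i
  define d where "d l i = e l (h l i)" for l i
  have hB: "h l i \<in> B l" if "i < card (B l)" for l i
    using bij_betwE[OF h[of l]] that by auto
  have dpos: "\<rho> \<le> d l i" and d1: "d l i \<le> 1" if "i < card (B l)" for l i
  proof -
    show "\<rho> \<le> d l i" using hB[OF that] by (simp add: B_def d_def)
    have I: "h l i \<in> I l" using hB[OF that] by (simp add: B_def)
    show "d l i \<le> 1" unfolding d_def
      by (rule cov_size_le_1[of "I l" "e l" s \<kappa>]) (use c(4)[of _ l] c(2)[of _ l] k1 s I in auto)
  qed
  \<comment> \<open>The colour of a cover lists the sizes of its large members in units of
    \<open>\<rho>\<close>, rounded down. There are at most \<open>m\<close> of them, with sizes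
    between \<open>\<rho>\<close> and 1, so only finitely many colours occur. Infinitely many covers
    then share one size profile, and \<open>z i\<close> is a common upper bound that is sharp up to
    a factor 2.\<close>
  define cl where "cl l i = nat \<lfloor>d l i / \<rho>\<rfloor>" for l i
  define col where "col l = map (cl l) [0..<card (B l)]" for l
  have "range col \<subseteq> {xs. set xs \<subseteq> {..nat \<lfloor>1 / \<rho>\<rfloor>} \<and> length xs \<le> m}"
  proof
    fix xs assume "xs \<in> range col"
    then obtain l where xs: "xs = col l" by auto
    have "cl l i \<le> nat \<lfloor>1 / \<rho>\<rfloor>" if "i < card (B l)" for i
      unfolding cl_def using d1[OF that] r by (intro nat_mono floor_mono divide_right_mono) auto
    then have "set xs \<subseteq> {..nat \<lfloor>1 / \<rho>\<rfloor>}" unfolding xs col_def by auto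
    moreover have "length xs \<le> m" unfolding xs col_def using cardB by simp
    ultimately show "xs \<in> {xs. set xs \<subseteq> {..nat \<lfloor>1 / \<rho>\<rfloor>} \<and> length xs \<le> m}" by simp
  qed
  then have "finite (range col)"
    using finite_lists_length_le[of "{..nat \<lfloor>1 / \<rho>\<rfloor>}" m] finite_subset by auto
  then obtain a0 where "infinite {l \<in> UNIV. col l = col a0}"
    using pigeonhole_infinite[of "UNIV::nat set" col] by auto
  define Z where "Z = {l. col l = col a0}"
  have infZ: "infinite Z" using \<open>infinite {l \<in> UNIV. col l = col a0}\<close> unfolding Z_def by simp
  define n where "n = card (B a0)"
  define z where "z i = (real (cl a0 i) + 1) * \<rho>" for i
  have cardZ: "card (B l) = n" if "l \<in> Z" for l
  proof -
    have "length (col l) = length (col a0)" using that unfolding Z_def by simp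
    then show ?thesis unfolding col_def n_def by simp
  qed
  have clZ: "cl l i = cl a0 i" if "l \<in> Z" "i < n" for l i
  proof -
    have "col l ! i = col a0 ! i" using that unfolding Z_def by simp
    then show ?thesis using that cardZ[OF that(1)] unfolding col_def n_def by simp
  qed
  have dz: "d l i \<le> z i" "z i \<le> 2 * d l i" if "l \<in> Z" "i < n" for l i
  proof -
    have i: "i < card (B l)" using that cardZ by simp
    have ge1: "1 \<le> d l i / \<rho>" using dpos[OF i] r by simp
    then have cr: "real (cl l i) = of_int \<lfloor>d l i / \<rho>\<rfloor>" unfolding cl_def by simp
    have "d l i / \<rho> \<le> real (cl l i) + 1" using cr by linarith
    then show "d l i \<le> z i" unfolding z_def clZ[OF that] using r by (simp add: field_simps)
    have "real (cl l i) + 1 \<le> 2 * (d l i / \<rho>)" using cr ge1 by linarith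
    then show "z i \<le> 2 * d l i" unfolding z_def clZ[OF that] using r by (simp add: field_simps)
  qed
  have zpos: "0 < z i" for i unfolding z_def using r by (simp add: add_nonneg_pos)
  define T where "T l l' = {p \<in> {..<n} \<times> {..<n}. D l (fst p) \<inter> D l' (snd p) \<noteq> {}}" for l l'
  define P where "P = Pow ({..<n} \<times> {..<n})"
  have finP: "finite P" unfolding P_def by simp
  have TP: "T l l' \<in> P" for l l' unfolding T_def P_def by auto
  \<comment> \<open>\<open>Ramsey2\<close> takes its colours from an initial segment of the
    naturals, hence the numbering \<open>g\<close> of the possible patterns.\<close>
  obtain g where g: "bij_betw g P {0..<card P}" using ex_bij_betw_finite_nat[OF finP] by blast
  have gT: "g (T l l') < card P" for l l' using bij_betwE[OF g] TP by fastforce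
  have "\<exists>Y t. Y \<subseteq> Z \<and> infinite Y \<and> t < card P \<and>
      (\<forall>x\<in>Y. \<forall>y\<in>Y. x \<noteq> y \<longrightarrow> g (T (Min {x,y}) (Max {x,y})) = t)"
    by (rule Ramsey2[OF infZ]) (use gT in auto)
  then obtain Y t where Y: "Y \<subseteq> Z" "infinite Y"
    and Yt: "\<forall>x\<in>Y. \<forall>y\<in>Y. x \<noteq> y \<longrightarrow> g (T (Min {x,y}) (Max {x,y})) = t"
    by auto
  have Yt': "g (T l l') = t" if "l \<in> Y" "l' \<in> Y" "l < l'" for l l'
    using Yt[rule_format, of l l'] that by (simp add: min_def max_def)
  have Teq: "T l l' = T k k'" if "l \<in> Y" "l' \<in> Y" "l < l'" "k \<in> Y" "k' \<in> Y" "k < k'" for l l' k k'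
    using inj_onD[OF bij_betw_imp_inj_on[OF g] _ TP TP, of l l' k k'] Yt'[OF that(1-3)] Yt'[OF that(4-6)] by simp
  define l0 where "l0 = (LEAST l. l \<in> Y)"
  have l0: "l0 \<in> Y" unfolding l0_def using LeastI_ex[of "\<lambda>l. l \<in> Y"] infinite_imp_nonempty[OF Y(2)] by auto
  have l0_less: "l0 < l" if "l \<in> Y" "l \<noteq> l0" for l
    using Least_le[of "\<lambda>l. l \<in> Y" l] that unfolding l0_def by linarith
  define Y' where "Y' = Y - {l0}"
  have infY': "infinite Y'" using Y(2) unfolding Y'_def by simp
  then obtain l1 where l1: "l1 \<in> Y'" using infinite_imp_nonempty by blast
  define T0 where "T0 = T l0 l1"
  have T0: "T l l' = T0" if "l \<in> Y" "l' \<in> Y" "l < l'" for l l'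
    unfolding T0_def using l1 l0 l0_less that by (intro Teq) (auto simp: Y'_def)
  define A where "A = {i' \<in> {..<n}. \<exists>i. (i, i') \<in> T0}"
  have "\<forall>i'\<in>A. \<exists>i. (i,i') \<in> T0" unfolding A_def by auto
  then obtain \<iota> where io: "\<And>i'. i' \<in> A \<Longrightarrow> (\<iota> i', i') \<in> T0" by metis
  have ion: "\<iota> i' < n" if "i' \<in> A" for i' using io[OF that] unfolding T0_def T_def by auto
  \<comment> \<open>All members collected in \<open>U i'\<close> meet the single member
    \<open>\<iota> i'\<close> of the first cover, so any two of their points are within
    \<open>2 * z i' + z (\<iota> i')\<close>.\<close>
  define U where "U i' = (\<Union>l'\<in>Y'. D l' i')" for i'
  have l0Z: "l0 \<in> Z" using l0 Y by auto
  have distD: "dist x y \<le> z i" if "l \<in> Z" "i < n" "x \<in> D l i" "y \<in> D l i" for x y l i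
  proof -
    have "h l i \<in> I l" using hB[of i l] cardZ[OF that(1)] that(2) BI by auto
    then have "dist x y \<le> d l i" using c(3)[of "h l i" l x y] that unfolding D_def d_def by simp
    then show ?thesis using dz(1)[OF that(1,2)] by linarith
  qed
  have distU: "\<exists>w\<in>D l0 (\<iota> i'). dist x w \<le> z i'" if iA: "i' \<in> A" and xU: "x \<in> U i'" for i' x
  proof -
    obtain l' where l': "l' \<in> Y'" "x \<in> D l' i'" using xU unfolding U_def by auto
    have "(\<iota> i', i') \<in> T l0 l'" using io[OF iA] T0[of l0 l'] l' l0 l0_less unfolding Y'_def by auto
    then obtain w where "w \<in> D l0 (\<iota> i')" "w \<in> D l' i'" unfolding T_def by auto
    then show ?thesis using distD[of l' i' x w] l' Y iA unfolding A_def Y'_def by auto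
  qed
  have distUU: "dist x y \<le> z i' + z (\<iota> i') + z i''"
    if hyp: "i' \<in> A" "x \<in> U i'" "i'' \<in> A" "y \<in> U i''" "\<iota> i'' = \<iota> i'" for i' i'' x y
  proof -
    obtain w where w: "w \<in> D l0 (\<iota> i')" "dist x w \<le> z i'" using distU[OF hyp(1,2)] by auto
    obtain w' where w': "w' \<in> D l0 (\<iota> i')" "dist y w' \<le> z i''" using distU[OF hyp(3,4)] hyp(5) by auto
    have "dist w w' \<le> z (\<iota> i')" using distD[OF l0Z ion[OF hyp(1)] w(1) w'(1)] .
    then show ?thesis using w(2) w'(2) dist_triangle[of x y w] dist_triangle[of w y w'] by (simp add: dist_commute)
  qed
  define W where "W = (\<Union>i'\<in>A. U i')"
  have covS: "cov s (6 powr s * \<kappa>) (\<Union>i\<in>{..<n}. S i)"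
    if "\<And>i x y. i < n \<Longrightarrow> x \<in> S i \<Longrightarrow> y \<in> S i \<Longrightarrow> dist x y \<le> 3 * z i" for S
  proof (rule covI[of "{..<n}" _ S "\<lambda>i. 3 * z i"])
    fix F assume F: "finite F" "F \<subseteq> {..<n}"
    have "(\<Sum>i\<in>F. (3 * z i) powr s) \<le> (\<Sum>i\<in>F. (6 * d l0 i) powr s)"
      using F dz(2)[OF l0Z] zpos s by (intro sum_mono powr_mono2) (force intro: less_imp_le)+
    also have "\<dots> \<le> (\<Sum>i<n. (6 * d l0 i) powr s)"
      using F by (intro sum_mono2) auto
    also have "\<dots> = 6 powr s * (\<Sum>i<n. d l0 i powr s)"
      unfolding sum_distrib_left
      by (intro sum.cong) (use dpos cardZ[OF l0Z] r in \<open>auto intro!: powr_mult\<close>)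
    also have "(\<Sum>i<n. d l0 i powr s) = (\<Sum>i\<in>B l0. e l0 i powr s)"
      using sum.reindex_bij_betw[OF h[of l0], of "\<lambda>i. e l0 i powr s"] cardZ[OF l0Z]
      unfolding d_def by (simp add: atLeast0LessThan)
    also have "6 powr s * \<dots> \<le> 6 powr s * \<kappa>"
      using c(4)[OF finB BI] by (intro mult_left_mono) auto
    finally show "(\<Sum>i\<in>F. (3 * z i) powr s) \<le> 6 powr s * \<kappa>" by simp
  qed (use that zpos in auto)
  \<comment> \<open>Each \<open>U i'\<close> is charged to the larger of \<open>z i'\<close> and
    \<open>z (\<iota> i')\<close>: in \<open>S1\<close> to \<open>i'\<close> itself, in
    \<open>S2\<close> to \<open>\<iota> i'\<close>, where all sets with the same
    \<open>\<iota>\<close> merge. Either way distances are at most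
    \<open>3 * z i \<le> 6 * d l0 i\<close> and each index is used once, whence the constant
    \<open>2 * 6 powr s\<close>.\<close>
  define S1 where "S1 i = (if i \<in> A \<and> z (\<iota> i) \<le> z i then U i else {})" for i
  define S2 where "S2 i = (\<Union>i'\<in>{i'\<in>A. \<iota> i' = i \<and> z i' \<le> z i}. U i')" for i
  have "cov s (6 powr s * \<kappa>) (\<Union>i\<in>{..<n}. S1 i)"
  proof (rule covS)
    fix i x y assume a: "i < n" "x \<in> S1 i" "y \<in> S1 i"
    then have i: "i \<in> A" "z (\<iota> i) \<le> z i" "x \<in> U i" "y \<in> U i" unfolding S1_def by (auto split: if_splits)
    show "dist x y \<le> 3 * z i" using distUU[of i x i y] i by linarith
  qed
  moreover have "cov s (6 powr s * \<kappa>) (\<Union>i\<in>{..<n}. S2 i)"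
  proof (rule covS)
    fix i x y assume a: "i < n" "x \<in> S2 i" "y \<in> S2 i"
    then obtain i' i'' where i: "i' \<in> A" "\<iota> i' = i" "z i' \<le> z i" "x \<in> U i'"
       "i'' \<in> A" "\<iota> i'' = i" "z i'' \<le> z i" "y \<in> U i''" unfolding S2_def by auto
    show "dist x y \<le> 3 * z i" using distUU[of i' x i'' y] i by auto
  qed
  ultimately have "cov s (6 powr s * \<kappa> + 6 powr s * \<kappa>) ((\<Union>i\<in>{..<n}. S1 i) \<union> (\<Union>i\<in>{..<n}. S2 i))"
    by (rule cov_Un)
  moreover have "W \<subseteq> (\<Union>i\<in>{..<n}. S1 i) \<union> (\<Union>i\<in>{..<n}. S2 i)"
  proof
    fix x assume "x \<in> W"
    then obtain i where i: "i \<in> A" "x \<in> U i" unfolding W_def by auto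
    have "i < n" using i unfolding A_def by auto
    then show "x \<in> (\<Union>i\<in>{..<n}. S1 i) \<union> (\<Union>i\<in>{..<n}. S2 i)"
      using i ion[OF i(1)] by (cases "z (\<iota> i) \<le> z i") (auto simp: S1_def S2_def)
  qed
  ultimately have "cov s (6 powr s * \<kappa> + 6 powr s * \<kappa>) W" by (rule cov_subset)
  moreover have "6 powr s * \<kappa> + 6 powr s * \<kappa> = 2 * 6 powr s * \<kappa>" by simp
  ultimately have covW: "cov s (2 * 6 powr s * \<kappa>) W" by simp
  define R where "R l = (\<Union>i\<in>I l - B l. C l i)" for l
  have covR: "cov (s + \<eta>) (\<rho> powr \<eta> * \<kappa>) (R l)" for l
  proof (rule covI[of "I l - B l" _ "C l" "e l"])
    fix F assume F: "finite F" "F \<subseteq> I l - B l"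
    have "(\<Sum>i\<in>F. e l i powr (s + \<eta>)) \<le> (\<Sum>i\<in>F. \<rho> powr \<eta> * e l i powr s)"
    proof (rule sum_mono)
      fix i assume i: "i \<in> F"
      then have "e l i < \<rho>" "0 < e l i" using F c(2)[of i l] unfolding B_def by auto
      then have "e l i powr \<eta> \<le> \<rho> powr \<eta>" using eta by (intro powr_mono2) auto
      then show "e l i powr (s + \<eta>) \<le> \<rho> powr \<eta> * e l i powr s"
        unfolding powr_add by (simp add: mult.commute mult_right_mono)
    qed
    also have "\<dots> \<le> \<rho> powr \<eta> * \<kappa>"
      unfolding sum_distrib_left[symmetric] using c(4)[of F l] F by (intro mult_left_mono) auto
    finally show "(\<Sum>i\<in>F. e l i powr (s + \<eta>)) \<le> \<rho> powr \<eta> * \<kappa>" .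
  qed (use c in \<open>auto simp: R_def\<close>)
  have "cov (s + \<eta>) (2 * \<rho> powr \<eta> * \<kappa>) (E N - W)" for N
  proof -
    obtain l where l: "l \<in> Y'" "N < l" using infY' unfolding infinite_nat_iff_unbounded by blast
    obtain l' where l': "l' \<in> Y'" "l < l'" using infY' unfolding infinite_nat_iff_unbounded by blast
    have YZ: "l \<in> Z" "l' \<in> Z" "l \<in> Y" "l' \<in> Y" using l l' Y unfolding Y'_def by auto
    have "E N - W \<subseteq> R l \<union> R l'"
    proof
      fix x assume x: "x \<in> E N - W"
      then have "x \<in> E l" "x \<in> E l'" using mono[of N l] mono[of N l'] l l' by auto
      then obtain j j' where j: "j \<in> I l" "x \<in> C l j" "j' \<in> I l'" "x \<in> C l' j'"
        using subsetD[OF c(1)[of l], of x] subsetD[OF c(1)[of l'], of x] by blast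
      show "x \<in> R l \<union> R l'"
      proof (rule ccontr)
        assume "x \<notin> R l \<union> R l'"
        then have "j \<in> B l" "j' \<in> B l'" using j unfolding R_def by auto
        then have "j \<in> h l ` {0..<n}" "j' \<in> h l' ` {0..<n}"
          using bij_betw_imp_surj_on[OF h[of l]] bij_betw_imp_surj_on[OF h[of l']]
            cardZ[OF YZ(1)] cardZ[OF YZ(2)] by simp_all
        then obtain i i' where i: "i < n" "h l i = j" "i' < n" "h l' i' = j'" by auto
        then have "x \<in> D l i \<inter> D l' i'" using j unfolding D_def by auto
        then have "(i,i') \<in> T l l'" using i unfolding T_def by auto
        then have "(i, i') \<in> T0" using T0[OF YZ(3,4) l'(2)] by simp
        then have "i' \<in> A" using i unfolding A_def by auto
        then have "x \<in> W" using \<open>x \<in> D l i \<inter> D l' i'\<close> l' unfolding W_def U_def by auto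
        then show False using x by simp
      qed
    qed
    then have "cov (s + \<eta>) (\<rho> powr \<eta> * \<kappa> + \<rho> powr \<eta> * \<kappa>) (E N - W)"
      using cov_subset[OF cov_Un[OF covR[of l] covR[of l']]] by blast
    then show ?thesis by (simp add: ac_simps)
  qed
  then show ?thesis using covW by blast
qed

lemma cov_increasing:
  fixes E :: "nat \<Rightarrow> 'a::metric_space set"
  assumes cov: "\<And>l. cov s \<kappa> (E l)" and mono: "\<And>m n. m \<le> n \<Longrightarrow> E m \<subseteq> E n"
    and s: "0 < s" "s < s'" and k: "2 * 6 powr s' * \<kappa> \<le> 1"
  shows "cov s' ((4 * 6 powr s' + 1) * \<kappa>) (\<Union>n. E n)"
proof -
  have k0: "0 \<le> \<kappa>" using cov_nonneg[OF cov] .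
  \<comment> \<open>Iterate the previous lemma with exponents increasing to \<open>s'\<close>; the remainders decay geometrically because
    \<open>2 * \<rho> t powr \<eta> t = 1 / 2\<close>.\<close>
  define \<sigma> where "\<sigma> t = s' - (s' - s) / 2 ^ t" for t :: nat
  define \<eta> where "\<eta> t = (s' - s) / 2 ^ Suc t" for t :: nat
  define \<rho> where "\<rho> t = (1/4) powr (1 / \<eta> t)" for t :: nat
  have sig0: "\<sigma> 0 = s" unfolding \<sigma>_def by simp
  have sigS: "\<sigma> (Suc t) = \<sigma> t + \<eta> t" for t unfolding \<sigma>_def \<eta>_def by (simp add: field_simps)
  have eta: "0 < \<eta> t" for t unfolding \<eta>_def using s by simp
  have sig_pos: "0 < \<sigma> t" and sig_le: "\<sigma> t \<le> s'" for t
  proof -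
    show "\<sigma> t \<le> s'" unfolding \<sigma>_def using s by simp
    show "0 < \<sigma> t" by (induction t) (use sig0 sigS s eta in \<open>auto intro: add_pos_pos\<close>)
  qed
  have rho: "2 * \<rho> t powr \<eta> t = 1/2" for t
    unfolding \<rho>_def using eta[of t] by (simp add: powr_powr)
  define Q where "Q t X \<longleftrightarrow> (\<forall>N. cov (\<sigma> t) (\<kappa> / 2 ^ t) (E N \<inter> X))" for t X
  define V where "V t X = (SOME W. cov (\<sigma> t) (2 * 6 powr \<sigma> t * (\<kappa> / 2 ^ t)) W \<and>
      (\<forall>N. cov (\<sigma> t + \<eta> t) (2 * \<rho> t powr \<eta> t * (\<kappa> / 2 ^ t)) (E N \<inter> X - W)))" for t X
  have half: "x / 2 ^ t \<le> x" if "0 \<le> x" for x :: real and t :: nat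
    using divide_left_mono[of 1 "2^t" x] that by simp
  have kt1: "\<kappa> / 2 ^ t \<le> 1" for t
  proof -
    have "\<kappa> \<le> 1"
    proof -
      have "1 * \<kappa> \<le> 2 * 6 powr s' * \<kappa>" using k0 s ge_one_powr_ge_zero[of 6 s'] by (intro mult_right_mono) auto
      then show ?thesis using k by simp
    qed
    then show ?thesis using half[OF k0, of t] by linarith
  qed
  have V: "cov (\<sigma> t) (2 * 6 powr \<sigma> t * (\<kappa> / 2 ^ t)) (V t X)" "Q (Suc t) (X - V t X)" if "Q t X" for t X
  proof -
    have "\<exists>W. cov (\<sigma> t) (2 * 6 powr \<sigma> t * (\<kappa> / 2 ^ t)) W \<and>
      (\<forall>N. cov (\<sigma> t + \<eta> t) (2 * \<rho> t powr \<eta> t * (\<kappa> / 2 ^ t)) (E N \<inter> X - W))"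
      using that mono sig_pos kt1 eta unfolding Q_def
      by (intro increasing_step) (auto simp: \<rho>_def intro: less_imp_le)
    from someI_ex[OF this, folded V_def]
    have *: "cov (\<sigma> t) (2 * 6 powr \<sigma> t * (\<kappa> / 2 ^ t)) (V t X)"
      "\<And>N. cov (\<sigma> t + \<eta> t) (2 * \<rho> t powr \<eta> t * (\<kappa> / 2 ^ t)) (E N \<inter> X - V t X)" by auto
    show "cov (\<sigma> t) (2 * 6 powr \<sigma> t * (\<kappa> / 2 ^ t)) (V t X)" by (rule *)
    have "2 * \<rho> t powr \<eta> t * (\<kappa> / 2 ^ t) = \<kappa> / 2 ^ Suc t" unfolding rho by simp
    then show "Q (Suc t) (X - V t X)"
      using *(2) unfolding Q_def sigS by (simp add: Int_Diff)
  qed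
  define X where "X = rec_nat UNIV (\<lambda>t X. X - V t X)"
  have X0: "X 0 = UNIV" and XS: "X (Suc t) = X t - V t (X t)" for t unfolding X_def by simp_all
  have QX: "Q t (X t)" for t
  proof (induction t)
    case 0 show ?case unfolding Q_def using cov X0 sig0 by simp
  next
    case (Suc t) show ?case unfolding XS using V(2)[OF Suc] .
  qed
  define W where "W t = V t (X t)" for t
  have covW: "cov s' (2 * 6 powr s' * \<kappa> * (1/2)^t) (W t)" for t
  proof -
    have le: "2 * 6 powr \<sigma> t * (\<kappa> / 2 ^ t) \<le> 2 * 6 powr s' * (\<kappa> / 2 ^ t)"
      using sig_le[of t] k0 by (intro mult_right_mono mult_left_mono powr_mono) auto
    have le1: "2 * 6 powr s' * (\<kappa> / 2 ^ t) \<le> 1"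
    proof -
      have "2 * 6 powr s' * (\<kappa> / 2 ^ t) = (2 * 6 powr s' * \<kappa>) / 2 ^ t" by simp
      also have "\<dots> \<le> 2 * 6 powr s' * \<kappa>" using k0 by (intro half) simp
      finally show ?thesis using k by linarith
    qed
    have "cov s' (2 * 6 powr s' * (\<kappa> / 2 ^ t)) (W t)"
      using cov_exponent_mono[OF cov_mono[OF V(1)[OF QX] le] le1 sig_pos sig_le] unfolding W_def .
    then show ?thesis by (simp add: power_one_over)
  qed
  have geo: "(\<Sum>n<N. a * (1/2)^n) \<le> 2 * a" if "0 \<le> a" for a :: real and N
  proof -
    have "(\<Sum>n<N. (1/2::real)^n) = 2 - 2 * (1/2)^N" by (induction N) auto
    also have "\<dots> \<le> 2" by simp
    finally show ?thesis using that unfolding sum_distrib_left[symmetric]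
      by (metis mult.commute mult_left_mono)
  qed
  \<comment> \<open>The constant of the statement is the sum of two geometric series:
    \<open>4 * 6 powr s' * \<kappa>\<close> for the sets \<open>W t\<close> and
    \<open>\<kappa>\<close> for the remainders.\<close>
  have a: "cov s' (2 * (2 * 6 powr s' * \<kappa>)) (\<Union>t. W t)"
    by (rule cov_UN[OF covW]) (rule geo, use k0 in simp)
  \<comment> \<open>The part of \<open>E N\<close> outside all \<open>W t\<close> lies in every
    \<open>X t\<close>, so it may be covered at stage \<open>Suc N\<close>, which makes the costs
    summable over \<open>N\<close>.\<close>
  have b: "cov s' (2 * (\<kappa> / 2)) (\<Union>N. E N - (\<Union>t. W t))"
  proof (rule cov_UN[of s' "\<lambda>t. \<kappa>/2 * (1/2)^t"])
    fix N
    have sub: "E N - (\<Union>t. W t) \<subseteq> E N \<inter> X t" for t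
    proof -
      have "x \<in> X t" if "\<And>t. x \<notin> W t" for x
        by (induction t) (use that X0 XS in \<open>auto simp: W_def\<close>)
      then show ?thesis by auto
    qed
    have "cov s' (\<kappa> / 2 ^ Suc N) (E N \<inter> X (Suc N))"
      using cov_exponent_mono[OF _ kt1[of "Suc N"] sig_pos[of "Suc N"] sig_le[of "Suc N"]] QX[of "Suc N"]
      unfolding Q_def by blast
    then show "cov s' (\<kappa>/2 * (1/2)^N) (E N - (\<Union>t. W t))"
      using cov_subset[OF _ sub] by (simp add: power_one_over)
  qed (rule geo, use k0 in simp)
  have "(\<Union>n. E n) \<subseteq> (\<Union>t. W t) \<union> (\<Union>N. E N - (\<Union>t. W t))" by auto
  moreover have "2 * (2 * 6 powr s' * \<kappa>) + 2 * (\<kappa> / 2) = (4 * 6 powr s' + 1) * \<kappa>" by (simp add: algebra_simps)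
  ultimately show ?thesis using cov_subset[OF cov_Un[OF a b]] by simp
qed

subsection \<open>Frostman weights on finite families of cells\<close>

text \<open>Vitali selection by decreasing size. As costs are bounded and \<open>p\<close> is
  positive, only finitely many members are at least as large as a given one. Decreasing size, with
  ties broken by the enumeration of \<open>J\<close>, is therefore well-founded, and the greedy rule
  (keep a set iff it meets no set kept earlier) is a well-founded recursion.\<close>

lemma greedy_disjoint_subfamily:
  fixes C :: "'b \<Rightarrow> 'a set" and e :: "'b \<Rightarrow> real"
  assumes J: "countable J" and e: "\<And>j. j \<in> J \<Longrightarrow> 0 < e j" and p: "0 < p"
    and cost: "\<And>F. finite F \<Longrightarrow> F \<subseteq> J \<Longrightarrow> (\<Sum>j\<in>F. e j powr p) \<le> \<kappa>"
  shows "\<exists>S\<subseteq>J. (\<forall>i\<in>S. \<forall>j\<in>S. i \<noteq> j \<longrightarrow> C i \<inter> C j = {}) \<and>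
    (\<forall>j\<in>J. C j \<noteq> {} \<longrightarrow> (\<exists>i\<in>S. C i \<inter> C j \<noteq> {} \<and> e j \<le> e i))"
proof -
  define t where "t = to_nat_on J"
  have injt: "inj_on t J" unfolding t_def using J by (rule inj_on_to_nat_on)
  define R where "R = {(i,j). i \<in> J \<and> j \<in> J \<and> (e j < e i \<or> (e i = e j \<and> t i < t j))}"
  have fin: "finite {i. (i,j) \<in> R}" for j
  proof (cases "j \<in> J")
    case True
    define m where "m = nat \<lfloor>\<kappa> / e j powr p\<rfloor>"
    have "card F \<le> m" if F: "F \<subseteq> {i. (i,j) \<in> R}" "finite F" for F
    proof -
      have sub: "F \<subseteq> J" and ge: "\<And>i. i \<in> F \<Longrightarrow> e j \<le> e i" using F unfolding R_def by auto
      have "real (card F) * e j powr p = (\<Sum>i\<in>F. e j powr p)" by simp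
      also have "\<dots> \<le> (\<Sum>i\<in>F. e i powr p)"
        using ge e[OF True] p by (intro sum_mono powr_mono2) auto
      also have "\<dots> \<le> \<kappa>" using cost F sub by blast
      finally have "real (card F) \<le> \<kappa> / e j powr p" using e[OF True] by (simp add: field_simps)
      then show ?thesis unfolding m_def by linarith
    qed
    then show ?thesis using finite_if_finite_subsets_card_bdd[of "{i. (i,j) \<in> R}" m] by blast
  next
    case False
    then have "{i. (i,j) \<in> R} = {}" unfolding R_def by auto
    then show ?thesis by simp
  qed
  have "R \<subseteq> Wellfounded.measure (\<lambda>j. card {i. (i,j) \<in> R})"
  proof
    fix ij assume "ij \<in> R"
    obtain i j where ij: "ij = (i,j)" by fastforce
    have "{k. (k,i) \<in> R} \<subset> {k. (k,j) \<in> R}"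
      using \<open>ij \<in> R\<close> unfolding ij R_def by auto
    then have "card {k. (k,i) \<in> R} < card {k. (k,j) \<in> R}" by (rule psubset_card_mono[OF fin])
    then show "ij \<in> Wellfounded.measure (\<lambda>j. card {i. (i,j) \<in> R})" unfolding ij by simp
  qed
  then have wf: "wf R" using wf_subset[OF wf_measure] by blast
  define G where "G f j \<longleftrightarrow> (\<forall>i. (i,j) \<in> R \<and> f i \<longrightarrow> C i \<inter> C j = {})" for f j
  define S where "S = wfrec R G"
  have S: "S j \<longleftrightarrow> (\<forall>i. (i,j) \<in> R \<and> S i \<longrightarrow> C i \<inter> C j = {})" for j
    unfolding S_def by (subst wfrec[OF wf]) (auto simp: G_def cut_def)
  show ?thesis
  proof (intro exI[of _ "{j\<in>J. S j}"] conjI ballI impI)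
    fix i j assume "i \<in> {j\<in>J. S j}" "j \<in> {j\<in>J. S j}" "i \<noteq> j"
    then have ij: "i \<in> J" "j \<in> J" "S i" "S j" "t i \<noteq> t j" using injt unfolding inj_on_def by auto
    then have "(i,j) \<in> R \<or> (j,i) \<in> R" unfolding R_def by auto
    then show "C i \<inter> C j = {}" using S[of i] S[of j] ij by blast
  next
    fix j assume j: "j \<in> J" "C j \<noteq> {}"
    show "\<exists>i\<in>{j\<in>J. S j}. C i \<inter> C j \<noteq> {} \<and> e j \<le> e i"
    proof (cases "S j")
      case True then show ?thesis using j by auto
    next
      case False
      then obtain i where "(i,j) \<in> R" "S i" "C i \<inter> C j \<noteq> {}" using S[of j] by blast
      then show ?thesis unfolding R_def by (intro bexI[of _ i]) auto
    qed
  qed auto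
qed

text \<open>Successively extract \<open>P\<close> disjoint Vitali subfamilies. One of them costs at most \<open>w\<close>; every point still lies in some
member left over before its extraction, so enlarging this subfamily covers everything.\<close>

lemma cov_of_multicover:
  fixes C :: "'b \<Rightarrow> 'a::metric_space set"
  assumes J: "countable J" and e: "\<And>j. j \<in> J \<Longrightarrow> 0 < e j" and p: "0 < p"
    and d: "\<And>j x y. j \<in> J \<Longrightarrow> x \<in> C j \<Longrightarrow> y \<in> C j \<Longrightarrow> dist x y \<le> e j"
    and cost: "\<And>F. finite F \<Longrightarrow> F \<subseteq> J \<Longrightarrow> (\<Sum>j\<in>F. e j powr p) \<le> real P * w"
    and X: "\<And>x. x \<in> X \<Longrightarrow> \<exists>F\<subseteq>J. finite F \<and> P \<le> card F \<and> (\<forall>j\<in>F. x \<in> C j)"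
    and P: "0 < P"
  shows "cov p (3 powr p * w) X"
proof -
  define good where "good K S \<longleftrightarrow> S \<subseteq> K \<and> (\<forall>i\<in>S. \<forall>j\<in>S. i \<noteq> j \<longrightarrow> C i \<inter> C j = {}) \<and>
    (\<forall>j\<in>K. C j \<noteq> {} \<longrightarrow> (\<exists>i\<in>S. C i \<inter> C j \<noteq> {} \<and> e j \<le> e i))" for K S
  define sel where "sel K = (SOME S. good K S)" for K
  have sel: "good K (sel K)" if "K \<subseteq> J" for K
  proof -
    have "\<exists>S. good K S" unfolding good_def
    proof (rule greedy_disjoint_subfamily)
      show "countable K" using countable_subset[OF that J] .
      show "(\<Sum>j\<in>F. e j powr p) \<le> real P * w" if "finite F" "F \<subseteq> K" for F
        using cost[of F] that \<open>K \<subseteq> J\<close> by auto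
    qed (use e p that in auto)
    then show ?thesis unfolding sel_def by (rule someI_ex)
  qed
  define K where "K = rec_nat J (\<lambda>_ K. K - sel K)"
  define S where "S t = sel (K t)" for t
  have K0: "K 0 = J" and KS: "K (Suc t) = K t - S t" for t unfolding K_def S_def by simp_all
  have KJ: "K t \<subseteq> J" for t by (induction t) (use K0 KS in auto)
  have good: "good (K t) (S t)" for t unfolding S_def using sel[OF KJ] .
  have SK: "S t \<subseteq> K t" for t using good unfolding good_def by blast
  have Keq: "K t = J - (\<Union>u<t. S u)" for t
    by (induction t) (use K0 KS in \<open>auto simp: lessThan_Suc\<close>)
  have disj: "S u \<inter> S t = {}" if "u < t" for u t using SK[of t] that unfolding Keq[of t] by auto
  have "\<exists>t<P. \<forall>F. finite F \<and> F \<subseteq> S t \<longrightarrow> (\<Sum>j\<in>F. e j powr p) \<le> w"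
  proof (rule ccontr)
    assume "\<not> ?thesis"
    then have "\<forall>t. t < P \<longrightarrow> (\<exists>F. finite F \<and> F \<subseteq> S t \<and> w < (\<Sum>j\<in>F. e j powr p))"
      by (meson not_le)
    then obtain F where F: "\<And>t. t < P \<Longrightarrow> finite (F t)" "\<And>t. t < P \<Longrightarrow> F t \<subseteq> S t"
      "\<And>t. t < P \<Longrightarrow> w < (\<Sum>j\<in>F t. e j powr p)" by metis
    have dF: "F s \<inter> F t = {}" if "s < P" "t < P" "s \<noteq> t" for s t
    proof -
      have "S s \<inter> S t = {}" using disj[of s t] disj[of t s] that(3) by (cases "s < t") auto
      then show ?thesis using F(2)[OF that(1)] F(2)[OF that(2)] by blast
    qed
    have "real P * w = (\<Sum>t<P. w)" by simp
    also have "\<dots> < (\<Sum>t<P. \<Sum>j\<in>F t. e j powr p)"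
      using P F(3) by (intro sum_strict_mono) auto
    also have "\<dots> = (\<Sum>j\<in>(\<Union>t<P. F t). e j powr p)"
      using F(1) dF by (subst sum.UNION_disjoint) auto
    also have "\<dots> \<le> real P * w"
    proof (rule cost)
      show "(\<Union>t<P. F t) \<subseteq> J" by (intro UN_least order_trans[OF F(2) order_trans[OF SK KJ]]) auto
    qed (use F(1) in auto)
    finally show False by simp
  qed
  then obtain t where t: "t < P" "\<And>F. finite F \<Longrightarrow> F \<subseteq> S t \<Longrightarrow> (\<Sum>j\<in>F. e j powr p) \<le> w" by blast
  have SJ: "S t \<subseteq> J" using SK KJ by blast
  \<comment> \<open>A leftover member meets a selected one that is at least as large, so the
    neighbourhood of width \<open>e i\<close> swallows it. Distances there are at most
    \<open>3 * e i\<close>, the source of \<open>3 powr p\<close>.\<close>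
  define N where "N i = {y. \<exists>z\<in>C i. dist y z \<le> e i}" for i
  show ?thesis
  proof (rule covI[of "S t" _ N "\<lambda>j. 3 * e j"])
    show "countable (S t)" using countable_subset[OF SJ J] .
    show "X \<subseteq> (\<Union>i\<in>S t. N i)"
    proof
      fix x assume "x \<in> X"
      from X[OF this] obtain F where F: "F \<subseteq> J" "finite F" "P \<le> card F" "\<And>j. j \<in> F \<Longrightarrow> x \<in> C j"
        by auto
      have uq: "i = j" if "i \<in> F \<inter> S u" "j \<in> F \<inter> S u" for i j u
      proof -
        have "x \<in> C i \<inter> C j" "i \<in> S u" "j \<in> S u" using F(4) that by auto
        then show "i = j" using good[of u] unfolding good_def by blast
      qed
      \<comment> \<open>Members of one subfamily are disjoint, so the \<open>t < P\<close> earlier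
        extractions use up fewer than \<open>P\<close> of the members containing
        \<open>x\<close>.\<close>
      have "card (F \<inter> S u) \<le> 1" for u
      proof -
        have "\<forall>a\<in>F \<inter> S u. \<forall>b\<in>F \<inter> S u. a = b" using uq by blast
        then show ?thesis using card_le_Suc0_iff_eq[of "F \<inter> S u"] F(2) by simp
      qed
      then have "(\<Sum>u<t. card (F \<inter> S u)) \<le> (\<Sum>u<t. 1)" by (intro sum_mono)
      then have "card (\<Union>u<t. F \<inter> S u) \<le> t"
        using card_UN_le[of "{..<t}" "\<lambda>u. F \<inter> S u"] by simp
      then have "card (\<Union>u<t. F \<inter> S u) < card F" using F t by linarith
      then have "\<not> F \<subseteq> (\<Union>u<t. F \<inter> S u)"
        using card_mono[of "\<Union>u<t. F \<inter> S u" F] F(2) by auto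
      then obtain j where j: "j \<in> F" "j \<in> K t" unfolding Keq using F(1) by auto
      then obtain i where i: "i \<in> S t" "C i \<inter> C j \<noteq> {}" "e j \<le> e i"
        using good[of t] F(4) unfolding good_def by blast
      then obtain z where z: "z \<in> C i" "z \<in> C j" by auto
      have "dist x z \<le> e j" using d[of j x z] F(1,4) j z by auto
      then have "x \<in> N i" unfolding N_def using z i by (auto intro!: bexI[of _ z])
      then show "x \<in> (\<Union>i\<in>S t. N i)" using i by auto
    qed
  next
    fix i x y assume i: "i \<in> S t" "x \<in> N i" "y \<in> N i"
    then obtain z z' where z: "z \<in> C i" "dist x z \<le> e i" "z' \<in> C i" "dist y z' \<le> e i" unfolding N_def by auto
    have "dist z z' \<le> e i" using d z i SJ by auto
    then show "dist x y \<le> 3 * e i"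
      using z dist_triangle[of x y z] dist_triangle[of z y z'] by (simp add: dist_commute)
  next
    fix F assume F: "finite F" "F \<subseteq> S t"
    have "(\<Sum>i\<in>F. (3 * e i) powr p) = 3 powr p * (\<Sum>i\<in>F. e i powr p)"
        unfolding sum_distrib_left
    proof (intro sum.cong refl)
      fix i assume "i \<in> F" then have "0 \<le> e i" using F SJ e[of i] by auto
      then show "(3 * e i) powr p = 3 powr p * e i powr p" by (simp add: powr_mult)
    qed
    also have "\<dots> \<le> 3 powr p * w" using t(2)[OF F] by (intro mult_left_mono) auto
    finally show "(\<Sum>i\<in>F. (3 * e i) powr p) \<le> 3 powr p * w" .
  qed (use e SJ in auto)
qed

text \<open>Hahn-Banach for the span of the constants and the indicators of the first
  \<open>n\<close> indices, one index at a time. The value \<open>cn\<close> is the infimum of the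
  upper constraints, and \<open>key\<close> says that no lower constraint exceeds an upper one.
  Prescribing the value \<open>\<Lambda> (\<lambda>_. 1)\<close> at the constant 1 from the start is
  what later bounds the total weight from below.\<close>

lemma hahn_banach_coordinates:
  fixes \<Lambda> :: "(nat \<Rightarrow> real) \<Rightarrow> real"
  assumes add: "\<And>f g. \<Lambda> (\<lambda>i. f i + g i) \<le> \<Lambda> f + \<Lambda> g"
    and hom: "\<And>t f. 0 \<le> t \<Longrightarrow> \<Lambda> (\<lambda>i. t * f i) = t * \<Lambda> f"
  shows "\<exists>c. \<forall>t a. t * \<Lambda> (\<lambda>_. 1) + (\<Sum>i<n. a i * c i) \<le> \<Lambda> (\<lambda>i. t + (if i < n then a i else 0))"
proof (induction n)
  case 0
  have L0: "\<Lambda> (\<lambda>i. 0) = 0" using hom[of 0 "\<lambda>_. 0"] by simp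
  have "t * \<Lambda> (\<lambda>_. 1) \<le> \<Lambda> (\<lambda>i. t)" for t
  proof (cases "0 \<le> t")
    case True then show ?thesis using hom[of t "\<lambda>_. 1"] by simp
  next
    case False
    have "0 \<le> \<Lambda> (\<lambda>i. t) + \<Lambda> (\<lambda>i. - t)" using add[of "\<lambda>_. t" "\<lambda>_. - t"] L0 by simp
    also have "\<Lambda> (\<lambda>i. - t) = - t * \<Lambda> (\<lambda>_. 1)" using hom[of "- t" "\<lambda>_. 1"] False by simp
    finally show ?thesis by simp
  qed
  then show ?case by simp
next
  case (Suc n)
  then obtain c where c: "\<And>t a. t * \<Lambda> (\<lambda>_. 1) + (\<Sum>i<n. a i * c i) \<le> \<Lambda> (\<lambda>i. t + (if i < n then a i else 0))"
    by blast
  define L where "L t a = t * \<Lambda> (\<lambda>_. 1) + (\<Sum>i<n. a i * c i)" for t a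
  define u where "u t a = (\<lambda>i. t + (if i < n then a i else 0))" for t :: real and a :: "nat \<Rightarrow> real"
  define \<delta> where "\<delta> = (\<lambda>i. if i = n then 1 else 0 :: real)"
  define G where "G = {\<Lambda> (\<lambda>i. u t a i + \<delta> i) - L t a | t a. True}"
  have key: "L t' a' - \<Lambda> (\<lambda>i. u t' a' i - \<delta> i) \<le> \<Lambda> (\<lambda>i. u t a i + \<delta> i) - L t a" for t a t' a'
  proof -
    have "L t a + L t' a' = L (t + t') (\<lambda>i. a i + a' i)"
      unfolding L_def by (simp add: algebra_simps sum.distrib)
    also have "\<dots> \<le> \<Lambda> (u (t + t') (\<lambda>i. a i + a' i))" unfolding L_def u_def by (rule c)
    also have "u (t + t') (\<lambda>i. a i + a' i) = (\<lambda>i. (u t a i + \<delta> i) + (u t' a' i - \<delta> i))"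
      unfolding u_def by auto
    also have "\<Lambda> \<dots> \<le> \<Lambda> (\<lambda>i. u t a i + \<delta> i) + \<Lambda> (\<lambda>i. u t' a' i - \<delta> i)" by (rule add)
    finally show ?thesis by simp
  qed
  define cn where "cn = Inf G"
  have bdd: "bdd_below G" unfolding G_def using key[of 0 "\<lambda>_. 0"] by (auto intro!: bdd_belowI)
  have ub: "cn \<le> \<Lambda> (\<lambda>i. u t a i + \<delta> i) - L t a" for t a
    unfolding cn_def by (rule cInf_lower[OF _ bdd]) (auto simp: G_def)
  have lb: "L t a - \<Lambda> (\<lambda>i. u t a i - \<delta> i) \<le> cn" for t a
    unfolding cn_def by (rule cInf_greatest) (use key in \<open>auto simp: G_def\<close>)
  have Lscale: "L (s * t) (\<lambda>i. s * a i) = s * L t a" for s t a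
    unfolding L_def by (simp add: algebra_simps sum_distrib_left)
  have "t * \<Lambda> (\<lambda>_. 1) + (\<Sum>i<Suc n. a i * (c(n := cn)) i) \<le> \<Lambda> (\<lambda>i. t + (if i < Suc n then a i else 0))" for t a
  proof -
    have lhs: "t * \<Lambda> (\<lambda>_. 1) + (\<Sum>i<Suc n. a i * (c(n := cn)) i) = L t a + a n * cn"
      unfolding L_def by simp
    have rhs: "(\<lambda>i. t + (if i < Suc n then a i else 0)) = (\<lambda>i. u t a i + a n * \<delta> i)"
      unfolding u_def \<delta>_def by (auto simp: less_Suc_eq)
    have "L t a + a n * cn \<le> \<Lambda> (\<lambda>i. u t a i + a n * \<delta> i)"
    proof (cases "a n" "0 :: real" rule: linorder_cases)
      case equal
      then show ?thesis using c[of t a] unfolding L_def u_def by simp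
    next
      case greater
      define s where "s = a n"
      have s: "0 < s" using greater unfolding s_def .
      have "s * cn \<le> s * (\<Lambda> (\<lambda>i. u (t / s) (\<lambda>i. a i / s) i + \<delta> i) - L (t / s) (\<lambda>i. a i / s))"
        using ub s by (intro mult_left_mono) auto
      also have "\<dots> = \<Lambda> (\<lambda>i. s * (u (t / s) (\<lambda>i. a i / s) i + \<delta> i)) - L t a"
        by (subst hom) (use s Lscale[of s "t / s" "\<lambda>i. a i / s"] in \<open>simp_all add: right_diff_distrib\<close>)
      also have "(\<lambda>i. s * (u (t / s) (\<lambda>i. a i / s) i + \<delta> i)) = (\<lambda>i. u t a i + s * \<delta> i)"
        unfolding u_def using s by (auto simp: field_simps)
      finally show ?thesis unfolding s_def by simp
    next
      case less
      define s where "s = - a n"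
      have s: "0 < s" using less unfolding s_def by simp
      have "s * (L (t / s) (\<lambda>i. a i / s) - \<Lambda> (\<lambda>i. u (t / s) (\<lambda>i. a i / s) i - \<delta> i)) \<le> s * cn"
        using lb s by (intro mult_left_mono) auto
      moreover have "s * (L (t / s) (\<lambda>i. a i / s) - \<Lambda> (\<lambda>i. u (t / s) (\<lambda>i. a i / s) i - \<delta> i))
         = L t a - \<Lambda> (\<lambda>i. s * (u (t / s) (\<lambda>i. a i / s) i - \<delta> i))"
        by (subst hom) (use s Lscale[of s "t / s" "\<lambda>i. a i / s"] in \<open>simp_all add: right_diff_distrib\<close>)
      moreover have "(\<lambda>i. s * (u (t / s) (\<lambda>i. a i / s) i - \<delta> i)) = (\<lambda>i. u t a i + a n * \<delta> i)"
        unfolding u_def using s by (auto simp: field_simps s_def)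
      ultimately show ?thesis unfolding s_def by simp
    qed
    then show ?thesis unfolding lhs rhs .
  qed
  then show ?case by blast
qed

lemma frostman_cells:
  fixes Q :: "nat \<Rightarrow> 'a::metric_space set"
  assumes p: "0 < p" and tau: "0 < \<tau>" and v: "0 < v"
    and diam: "\<And>i x y. i < N \<Longrightarrow> x \<in> Q i \<Longrightarrow> y \<in> Q i \<Longrightarrow> dist x y \<le> \<tau>"
    and big: "\<not> cov p v (\<Union>i<N. Q i)"
  shows "\<exists>\<mu>. (\<forall>i<N. 0 \<le> \<mu> i) \<and> (\<forall>I\<subseteq>{..<N}. \<forall>\<kappa>. cov p \<kappa> (\<Union>i\<in>I. Q i) \<longrightarrow> sum \<mu> I \<le> \<kappa>) \<and>
    v / 3 powr p \<le> (\<Sum>i<N. \<mu> i)"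
proof -
  let ?P = "Pow {..<N}"
  define QQ where "QQ I = (\<Union>i\<in>I. Q i)" for I
  \<comment> \<open>The functional \<open>\<Lambda> f\<close> below is the least cost of a fractional cover of \<open>f\<close>. The weights come from a linear functional
    dominated by \<open>\<Lambda>\<close>, and clearing denominators in a fractional cover of 1 gives a multicover, whence the lower bound
    for \<open>\<Lambda> 1\<close>.\<close>
  define \<Phi> where "\<Phi> I = Inf {\<kappa>. cov p \<kappa> (QQ I)}" for I
  \<comment> \<open>Real infima are meaningful only for nonempty sets bounded below; covering every
    cell at size \<open>\<tau>\<close> shows that some cost is always attained.\<close>
  have cov_all: "cov p (real N * \<tau> powr p) (QQ I)" if "I \<subseteq> {..<N}" for I
  proof (rule covI[of "{..<N}" _ Q "\<lambda>_. \<tau>"])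
    show "QQ I \<subseteq> (\<Union>i<N. Q i)" unfolding QQ_def using that by auto
    fix F assume "finite F" "F \<subseteq> {..<N}"
    then have "card F \<le> N" using card_mono[of "{..<N}" F] by simp
    then show "(\<Sum>i\<in>F. \<tau> powr p) \<le> real N * \<tau> powr p" by (simp add: mult_right_mono)
  qed (use tau diam in auto)
  have bddP: "bdd_below {\<kappa>. cov p \<kappa> (QQ I)}" for I by (rule bdd_belowI[of _ 0]) (auto dest: cov_nonneg)
  have Phi0: "0 \<le> \<Phi> I" if "I \<subseteq> {..<N}" for I
    unfolding \<Phi>_def using cov_all[OF that] by (intro cInf_greatest) (auto dest: cov_nonneg)
  have Phi_le: "\<Phi> I \<le> \<kappa>" if "cov p \<kappa> (QQ I)" for I \<kappa>
    unfolding \<Phi>_def using that bddP by (intro cInf_lower) auto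
  have Phi_cov: "cov p (\<Phi> I + \<epsilon>) (QQ I)" if I: "I \<subseteq> {..<N}" and eps: "0 < \<epsilon>" for I \<epsilon>
  proof -
    obtain \<kappa> where "cov p \<kappa> (QQ I)" "\<kappa> < \<Phi> I + \<epsilon>"
      using cInf_lessD[of "{\<kappa>. cov p \<kappa> (QQ I)}" "\<Phi> I + \<epsilon>"] cov_all[OF I] eps unfolding \<Phi>_def by auto
    then show ?thesis by (auto intro: cov_mono)
  qed
  \<comment> \<open>A fractional cover may use all unions \<open>QQ I\<close>, not only single
    cells. The indicator of \<open>I\<close> then has the cover with coefficient 1 at
    \<open>I\<close>, which gives the Frostman bound for every subfamily. Only the values of
    \<open>f\<close> below \<open>N\<close> matter.\<close>
  define adm where "adm f la \<longleftrightarrow> (\<forall>I. 0 \<le> la I) \<and> (\<forall>i<N. f i \<le> sum la {I\<in>?P. i \<in> I})" for f :: "nat \<Rightarrow> real" and la :: "nat set \<Rightarrow> real"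
  define cost where "cost la = (\<Sum>I\<in>?P. la I * \<Phi> I)" for la
  define \<Lambda> where "\<Lambda> f = Inf (cost ` {la. adm f la})" for f
  have cost0: "0 \<le> cost la" if "adm f la" for f la
    unfolding cost_def using that Phi0 unfolding adm_def by (intro sum_nonneg mult_nonneg_nonneg) auto
  have bddc: "bdd_below (cost ` {la. adm f la})" for f by (rule bdd_belowI[of _ 0]) (auto dest: cost0)
  have adm_ex: "\<exists>la. adm f la" for f
  proof
    show "adm f (\<lambda>I. if I = {..<N} then \<Sum>i<N. \<bar>f i\<bar> else 0)"
      unfolding adm_def
    proof (intro conjI allI impI)
      fix i assume i: "i < N"
      have "f i \<le> \<bar>f i\<bar>" by simp
      also have "\<dots> \<le> (\<Sum>i<N. \<bar>f i\<bar>)" using i by (intro member_le_sum) auto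
      also have "\<dots> = (\<Sum>I\<in>{I\<in>?P. i \<in> I}. if I = {..<N} then \<Sum>i<N. \<bar>f i\<bar> else 0)"
        using i by (subst sum.delta) auto
      finally show "f i \<le> (\<Sum>I\<in>{I\<in>?P. i \<in> I}. if I = {..<N} then \<Sum>i<N. \<bar>f i\<bar> else 0)" .
    qed (auto intro: sum_nonneg)
  qed
  have L_le: "\<Lambda> f \<le> cost la" if "adm f la" for f la
    unfolding \<Lambda>_def using that bddc by (intro cInf_lower) auto
  have L_ge: "b \<le> \<Lambda> f" if "\<And>la. adm f la \<Longrightarrow> b \<le> cost la" for f b
    unfolding \<Lambda>_def using that adm_ex[of f] by (intro cInf_greatest) auto
  have L_ex: "\<exists>la. adm f la \<and> cost la < b" if "\<Lambda> f < b" for f b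
    using L_ge[of f b] that by (meson not_le)
  have add: "\<Lambda> (\<lambda>i. f i + g i) \<le> \<Lambda> f + \<Lambda> g" for f g
  proof -
    have "\<Lambda> (\<lambda>i. f i + g i) - cost la \<le> \<Lambda> g" if l: "adm f la" for la
    proof (rule L_ge)
      fix la' assume l': "adm g la'"
      have "adm (\<lambda>i. f i + g i) (\<lambda>I. la I + la' I)"
        using l l' unfolding adm_def by (auto simp: sum.distrib intro: add_mono)
      from L_le[OF this] show "\<Lambda> (\<lambda>i. f i + g i) - cost la \<le> cost la'"
        unfolding cost_def by (simp add: sum.distrib distrib_right)
    qed
    then have "\<Lambda> (\<lambda>i. f i + g i) - \<Lambda> g \<le> \<Lambda> f" by (intro L_ge) (simp add: algebra_simps)
    then show ?thesis by simp
  qed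
  have hom_le: "\<Lambda> (\<lambda>i. t * f i) \<le> t * \<Lambda> f" if t: "0 < t" for t f
  proof -
    have "\<Lambda> (\<lambda>i. t * f i) / t \<le> \<Lambda> f"
    proof (rule L_ge)
      fix la assume l: "adm f la"
      have "adm (\<lambda>i. t * f i) (\<lambda>I. t * la I)"
        using l t unfolding adm_def by (auto simp: sum_distrib_left[symmetric])
      from L_le[OF this] show "\<Lambda> (\<lambda>i. t * f i) / t \<le> cost la"
        unfolding cost_def using t by (simp add: field_simps sum_distrib_left)
    qed
    then show ?thesis using t by (simp add: field_simps)
  qed
  have nonpos: "\<Lambda> f \<le> 0" if "\<And>i. i < N \<Longrightarrow> f i \<le> 0" for f
    using L_le[of f "\<lambda>_. 0"] that unfolding adm_def cost_def by simp
  have L0: "\<Lambda> (\<lambda>_. 0) = 0" using nonpos[of "\<lambda>_. 0"] L_ge[of "\<lambda>_. 0" 0] cost0 by force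
  have hom: "\<Lambda> (\<lambda>i. t * f i) = t * \<Lambda> f" if t: "0 \<le> t" for t f
  proof (cases "t = 0")
    case False
    then have t: "0 < t" using t by simp
    have "\<Lambda> f \<le> (1 / t) * \<Lambda> (\<lambda>i. t * f i)" using hom_le[of "1 / t" "\<lambda>i. t * f i"] t by simp
    then have "t * \<Lambda> f \<le> \<Lambda> (\<lambda>i. t * f i)" using t by (simp add: field_simps)
    then show ?thesis using hom_le[OF t, of f] by simp
  qed (use L0 in simp)
  obtain c where c: "\<And>t a. t * \<Lambda> (\<lambda>_. 1) + (\<Sum>i<N. a i * c i) \<le> \<Lambda> (\<lambda>i. t + (if i < N then a i else 0))"
    using hahn_banach_coordinates[of \<Lambda> N] add hom by auto
  have "0 \<le> c i" if "i < N" for i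
  proof -
    have "(\<Sum>j<N. (if j = i then - 1 else 0) * c j) \<le> \<Lambda> (\<lambda>j. if j < N then (if j = i then - 1 else 0) else 0)"
      using c[of 0 "\<lambda>j. if j = i then - 1 else 0"] by simp
    also have "\<dots> \<le> 0" by (rule nonpos) auto
    also have "(\<Sum>j<N. (if j = i then - 1 else 0) * c j) = - c i" using that by (simp add: if_distrib[of "\<lambda>x. x * _"] sum.delta cong: if_cong)
    finally show ?thesis by simp
  qed
  moreover have "sum c I \<le> \<kappa>" if I: "I \<subseteq> {..<N}" "cov p \<kappa> (\<Union>i\<in>I. Q i)" for I \<kappa>
  proof -
    have "sum c I = (\<Sum>j<N. (if j \<in> I then 1 else 0) * c j)"
      using I(1) by (simp add: if_distrib[of "\<lambda>x. x * _"] sum.If_cases Int_absorb1 cong: if_cong)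
    also have "\<dots> \<le> \<Lambda> (\<lambda>j. if j < N then (if j \<in> I then 1 else 0) else 0)"
      using c[of 0 "\<lambda>j. if j \<in> I then 1 else 0"] by simp
    also have "\<dots> \<le> cost (\<lambda>J. if J = I then 1 else 0)"
    proof (rule L_le, unfold adm_def, intro conjI allI impI)
      fix i assume i: "i < N"
      show "(if i < N then (if i \<in> I then 1 else 0) else 0) \<le> (\<Sum>J\<in>{J\<in>?P. i \<in> J}. if J = I then 1 else (0::real))"
        using I(1) i by (subst sum.delta) auto
    qed auto
    also have "\<dots> = \<Phi> I" unfolding cost_def using I(1) by (simp add: if_distrib[of "\<lambda>x. x * _"] sum.delta cong: if_cong)
    also have "\<dots> \<le> \<kappa>" using I(2) Phi_le unfolding QQ_def by blast
    finally show ?thesis .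
  qed
  moreover have "\<Lambda> (\<lambda>_. 1) \<le> (\<Sum>i<N. c i)"
  proof -
    \<comment> \<open>The function on the right vanishes at all indices below \<open>N\<close>, and
      \<open>adm\<close> ignores the others.\<close>
    have "\<Lambda> (\<lambda>_. 1) - (\<Sum>i<N. c i) \<le> \<Lambda> (\<lambda>i. 1 + (if i < N then - 1 else 0))"
      using c[of 1 "\<lambda>_. -1"] by (simp add: sum_negf)
    also have "\<dots> \<le> 0" by (rule nonpos) auto
    finally show ?thesis by simp
  qed
  moreover have "v / 3 powr p \<le> \<Lambda> (\<lambda>_. 1)"
  proof (rule ccontr)
    define w where "w = v / 3 powr p"
    assume "\<not> ?thesis"
    then have "\<Lambda> (\<lambda>_. 1) < w" unfolding w_def by simp
    then obtain la where l: "adm (\<lambda>_. 1) la" "cost la < w" using L_ex by blast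
    have l0: "0 \<le> la I" for I using l unfolding adm_def by blast
    \<comment> \<open>\<open>K\<close> bounds the total error of rounding \<open>P * la I\<close> up
      to an integer and of replacing the infimum \<open>\<Phi> I\<close> by
      \<open>\<Phi> I + 1 / P\<close>; the term \<open>2 ^ N\<close> counts the subfamilies.
      \<open>P\<close> is taken so large that the slack \<open>w - cost la\<close> pays for this
      error.\<close>
    define K where "K = sum la ?P + sum \<Phi> ?P + 2 ^ N"
    obtain P :: nat where P: "K / (w - cost la) < real P" using reals_Archimedean2 by blast
    have K0: "0 < K" unfolding K_def using l0 Phi0 by (intro add_nonneg_pos add_nonneg_nonneg sum_nonneg) auto
    have P0: "0 < P" using P K0 l(2) by (metis diff_gt_0_iff_gt divide_pos_pos less_trans of_nat_0_less_iff)
    have PK: "K \<le> real P * (w - cost la)" using P l(2) by (simp add: field_simps)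
    define m where "m I = nat \<lceil>real P * la I\<rceil>" for I
    have mm: "real (m I) \<le> real P * la I + 1" "real P * la I \<le> real (m I)" for I
      unfolding m_def using l0[of I] by (simp_all add: of_nat_nat)
    define \<epsilon> where "\<epsilon> = 1 / real P"
    have eps: "0 < \<epsilon>" unfolding \<epsilon>_def using P0 by simp
    have tot: "(\<Sum>I\<in>?P. real (m I) * (\<Phi> I + \<epsilon>)) \<le> real P * w"
    proof -
      have "(\<Sum>I\<in>?P. real (m I) * (\<Phi> I + \<epsilon>)) \<le> (\<Sum>I\<in>?P. (real P * la I + 1) * (\<Phi> I + \<epsilon>))"
        using mm(1) Phi0 eps by (intro sum_mono mult_right_mono add_nonneg_nonneg) auto
      also have "\<dots> = (\<Sum>I\<in>?P. real P * (la I * \<Phi> I) + la I + \<Phi> I + \<epsilon>)"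
        unfolding \<epsilon>_def using P0 by (intro sum.cong refl) (simp add: field_simps)
      also have "\<dots> = real P * cost la + sum la ?P + sum \<Phi> ?P + 2 ^ N * \<epsilon>"
        unfolding cost_def sum_distrib_left by (simp add: sum.distrib card_Pow)
      also have "\<dots> \<le> real P * cost la + K"
        unfolding K_def \<epsilon>_def using P0 by (simp add: divide_le_eq)
      also have "\<dots> \<le> real P * w" using PK by (simp add: algebra_simps)
      finally show ?thesis .
    qed
    have "\<forall>I. \<exists>Ix C e. I \<subseteq> {..<N} \<longrightarrow> covering p (\<Phi> I + \<epsilon>) (QQ I) Ix C e"
      using Phi_cov[OF _ eps] unfolding cov_def by blast
    then obtain Ix C e where "\<And>I. I \<subseteq> {..<N} \<Longrightarrow> covering p (\<Phi> I + \<epsilon>) (QQ I) (Ix I) (C I) (e I)"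
      by metis
    note cv = coveringD[OF this]
    define J where "J = (SIGMA I:?P. {..<m I} \<times> Ix I)"
    have "cov p (3 powr p * w) (\<Union>i<N. Q i)"
    proof (rule cov_of_multicover[of J "\<lambda>(I,c,j). e I j" p "\<lambda>(I,c,j). C I j" P])
      show "countable J" unfolding J_def by (intro countable_SIGMA countable_finite[of ?P]) auto
      show "0 < p" "0 < P" by fact+
    next
      fix j assume "j \<in> J" then show "0 < (case j of (I, c, j) \<Rightarrow> e I j)" using cv(2) unfolding J_def by auto
    next
      fix j x y assume "j \<in> J" "x \<in> (case j of (I, c, j) \<Rightarrow> C I j)" "y \<in> (case j of (I, c, j) \<Rightarrow> C I j)"
      then show "dist x y \<le> (case j of (I, c, j) \<Rightarrow> e I j)" using cv(3) unfolding J_def by auto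
    next
      fix F assume F: "finite F" "F \<subseteq> J"
      define G where "G I c = {j. (I,c,j) \<in> F}" for I c
      have fG: "finite (G I c)" for I c
        unfolding G_def using F(1) by (rule finite_subset[rotated, OF finite_imageI[where h="snd \<circ> snd"]]) force
      have FS: "F = (SIGMA I:?P. SIGMA c:{..<m I}. G I c)" using F(2) unfolding J_def G_def by auto
      have "(\<Sum>j\<in>F. (case j of (I, c, j) \<Rightarrow> e I j) powr p) = (\<Sum>I\<in>?P. \<Sum>c<m I. \<Sum>j\<in>G I c. e I j powr p)"
        using fG by (subst FS) (simp add: sum.Sigma split_def)
      also have "\<dots> \<le> (\<Sum>I\<in>?P. \<Sum>c<m I. (\<Phi> I + \<epsilon>))"
        using F(2) fG by (intro sum_mono cv(4)) (auto simp: G_def J_def)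
      also have "\<dots> = (\<Sum>I\<in>?P. real (m I) * (\<Phi> I + \<epsilon>))" by simp
      finally show "(\<Sum>j\<in>F. (case j of (I, c, j) \<Rightarrow> e I j) powr p) \<le> real P * w" using tot by linarith
    next
      fix x assume "x \<in> (\<Union>i<N. Q i)"
      then obtain i where i: "i < N" "x \<in> Q i" by auto
      let ?A = "{I\<in>?P. i \<in> I}"
      have "\<forall>I\<in>?A. \<exists>j\<in>Ix I. x \<in> C I j"
        using cv(1) i(2) unfolding QQ_def by blast
      then obtain j where j: "\<And>I. I \<in> ?A \<Longrightarrow> j I \<in> Ix I" "\<And>I. I \<in> ?A \<Longrightarrow> x \<in> C I (j I)" by metis
      define F where "F = (\<lambda>(I,c). (I,c,j I)) ` (SIGMA I:?A. {..<m I})"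
      have "card F = (\<Sum>I\<in>?A. m I)"
        unfolding F_def by (subst card_image) (auto simp: inj_on_def)
      moreover have "real P \<le> real (\<Sum>I\<in>?A. m I)"
      proof -
        have "real P * 1 \<le> real P * sum la ?A"
          using l(1) i unfolding adm_def by (intro mult_left_mono) auto
        also have "\<dots> \<le> real (\<Sum>I\<in>?A. m I)"
          unfolding sum_distrib_left of_nat_sum using mm(2) by (intro sum_mono) auto
        finally show ?thesis by simp
      qed
      ultimately have "P \<le> card F" by linarith
      moreover have "F \<subseteq> J" "finite F" "\<forall>q\<in>F. x \<in> (case q of (I, c, j) \<Rightarrow> C I j)"
        unfolding F_def J_def using j by auto
      ultimately show "\<exists>F\<subseteq>J. finite F \<and> P \<le> card F \<and> (\<forall>j\<in>F. x \<in> (case j of (I, c, j) \<Rightarrow> C I j))" by blast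
    qed
    then show False using big unfolding w_def by simp
  qed
  ultimately show ?thesis
    by (intro exI[of _ c]) (auto intro: order_trans)
qed

subsection \<open>Carving out separated pieces\<close>

text \<open>A member \<open>P\<close> of the family consists of a removed block \<open>fst P\<close> (the part of a ball of radius \<open>b\<close> not removed before) and
its core \<open>snd P\<close> (the part of the concentric ball of radius \<open>a\<close>). The weights \<open>f\<close> of the cores compensate for the loss
of the shells. A suitable centre exists since both sides of the required inequality have the same \<open>\<mu>\<close>-average over
all centres.\<close>

lemma carve:
  fixes y :: "nat \<Rightarrow> 'a::metric_space" and \<mu> G :: "nat \<Rightarrow> real"
  assumes fin: "finite B" and mu: "\<And>i. i \<in> B \<Longrightarrow> 0 \<le> \<mu> i" and ab: "0 \<le> a" "a < b"
  defines "M \<equiv> \<lambda>i r. sum \<mu> {j\<in>B. dist (y i) (y j) \<le> r}"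
  defines "f \<equiv> \<lambda>i. G i * M i b / M i a"
  assumes T: "T \<subseteq> B" and G: "\<And>i. i \<in> T \<Longrightarrow> 0 \<le> G i"
  shows "\<exists>\<P>. finite \<P> \<and>
    (\<forall>P\<in>\<P>. snd P \<subseteq> fst P \<and> fst P \<subseteq> T \<and>
      (\<exists>x. (\<forall>i\<in>fst P. dist x (y i) \<le> b) \<and> (\<forall>i\<in>snd P. dist x (y i) \<le> a)) \<and>
      0 < (\<Sum>i\<in>fst P. G i * \<mu> i) \<and> (\<Sum>i\<in>fst P. G i * \<mu> i) \<le> (\<Sum>i\<in>snd P. f i * \<mu> i)) \<and>
    (\<forall>P\<in>\<P>. \<forall>P'\<in>\<P>. P \<noteq> P' \<longrightarrow> (\<forall>i\<in>snd P. \<forall>j\<in>snd P'. b - a \<le> dist (y i) (y j))) \<and>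
    (\<Sum>P\<in>\<P>. \<Sum>i\<in>fst P. G i * \<mu> i) = (\<Sum>i\<in>T. G i * \<mu> i)"
    (is "\<exists>\<P>. ?Q T \<P>")
  using T G
proof (induction "card T" arbitrary: T rule: less_induct)
  case less
  have finT: "finite T" using less.prems(1) fin finite_subset by auto
  have M0: "0 \<le> M i r" for i r unfolding M_def using mu by (intro sum_nonneg) auto
  have Mself: "\<mu> i \<le> M i r" if "i \<in> B" "0 \<le> r" for i r
    unfolding M_def using that fin mu by (intro member_le_sum) auto
  have Gm: "0 \<le> G i * \<mu> i" if "i \<in> T" for i using that less.prems mu by (intro mult_nonneg_nonneg) auto
  show ?case
  proof (cases "(\<Sum>i\<in>T. G i * \<mu> i) = 0")
    case True
    then show ?thesis by (intro exI[of _ "{}"]) simp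
  next
    case False
    define al where "al x = (\<Sum>i\<in>{i\<in>T. dist (y x) (y i) \<le> a}. f i * \<mu> i)" for x
    define be where "be x = (\<Sum>i\<in>{i\<in>T. dist (y x) (y i) \<le> b}. G i * \<mu> i)" for x
    have swap: "(\<Sum>x\<in>B. \<mu> x * (\<Sum>i\<in>{i\<in>T. dist (y x) (y i) \<le> r}. h i)) = (\<Sum>i\<in>T. h i * M i r)" for r and h :: "nat \<Rightarrow> real"
    proof -
      have "(\<Sum>x\<in>B. \<mu> x * (\<Sum>i\<in>{i\<in>T. dist (y x) (y i) \<le> r}. h i)) =
          (\<Sum>x\<in>B. \<Sum>i\<in>T. if dist (y x) (y i) \<le> r then \<mu> x * h i else 0)"
        unfolding sum_distrib_left using finT by (simp add: sum.inter_filter)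
      also have "\<dots> = (\<Sum>i\<in>T. \<Sum>x\<in>B. if dist (y x) (y i) \<le> r then \<mu> x * h i else 0)"
        by (rule sum.swap)
      also have "\<dots> = (\<Sum>i\<in>T. h i * M i r)"
        unfolding M_def sum_distrib_left using fin
        by (simp add: sum.inter_filter dist_commute mult.commute cong: if_cong)
      finally show ?thesis .
    qed
    have "(\<Sum>x\<in>B. \<mu> x * al x) = (\<Sum>i\<in>T. f i * \<mu> i * M i a)" unfolding al_def by (rule swap)
    also have "\<dots> = (\<Sum>i\<in>T. G i * \<mu> i * M i b)"
    proof (intro sum.cong refl)
      fix i assume i: "i \<in> T"
      \<comment> \<open>If \<open>\<mu> i\<close> is positive, so is \<open>M i a\<close>, and the
        division in \<open>f\<close> is genuine; otherwise both sides are 0.\<close>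
      show "f i * \<mu> i * M i a = G i * \<mu> i * M i b"
      proof (cases "\<mu> i = 0")
        case False
        then have "0 < M i a" using Mself[of i a] mu[of i] less.prems(1) i ab by fastforce
        then show ?thesis unfolding f_def by simp
      qed simp
    qed
    also have "\<dots> = (\<Sum>x\<in>B. \<mu> x * be x)" unfolding be_def by (rule swap[symmetric])
    finally have eq: "(\<Sum>x\<in>B. \<mu> x * al x) = (\<Sum>x\<in>B. \<mu> x * be x)" .
    have be0: "0 \<le> be x" for x unfolding be_def using Gm by (intro sum_nonneg) auto
    have f0: "0 \<le> f i * \<mu> i" if "i \<in> T" for i
      unfolding f_def using that less.prems mu M0 by (intro mult_nonneg_nonneg divide_nonneg_nonneg) auto
    \<comment> \<open>Consequently a centre failing the claim below always satisfies
      \<open>al x \<le> be x\<close>, strictly at \<open>i0\<close>, where \<open>be\<close> and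
      \<open>\<mu>\<close> are positive. If all centres failed, the two averages could not
      agree.\<close>
    have al0: "al x = 0" if "be x = 0" for x
    proof -
      have "\<forall>i\<in>{i\<in>T. dist (y x) (y i) \<le> b}. G i * \<mu> i = 0"
        using that finT Gm unfolding be_def by (subst (asm) sum_nonneg_eq_0_iff) auto
      then have "G i = 0 \<or> \<mu> i = 0" if "i \<in> T" "dist (y x) (y i) \<le> a" for i using that ab by auto
      then show ?thesis unfolding al_def f_def by (intro sum.neutral) auto
    qed
    obtain i0 where i0: "i0 \<in> T" "G i0 * \<mu> i0 \<noteq> 0" using False by (meson sum.neutral)
    have i0B: "i0 \<in> B" using i0 less.prems by auto
    have "0 < G i0 * \<mu> i0" using i0(2) Gm[OF i0(1)] by linarith
    also have "\<dots> \<le> be i0" unfolding be_def using i0 finT Gm ab by (intro member_le_sum) auto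
    finally have bei0: "0 < be i0" .
    have mui0: "0 < \<mu> i0" using i0 mu[OF i0B] by (metis less_eq_real_def mult_zero_right)
    have "\<exists>x\<in>B. 0 < be x \<and> be x \<le> al x"
    proof (rule ccontr)
      assume neg: "\<not> ?thesis"
      have le: "\<mu> x * al x \<le> \<mu> x * be x" if "x \<in> B" for x
        using neg that be0[of x] al0[of x] mu[OF that] by (intro mult_left_mono) (force simp: not_le)+
      have "(\<Sum>x\<in>B. \<mu> x * al x) < (\<Sum>x\<in>B. \<mu> x * be x)"
      proof (rule sum_strict_mono_ex1[OF fin])
        show "\<forall>x\<in>B. \<mu> x * al x \<le> \<mu> x * be x" using le by blast
        show "\<exists>x\<in>B. \<mu> x * al x < \<mu> x * be x"
          using neg i0B bei0 mui0 by (intro bexI[of _ i0]) (auto simp: not_le)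
      qed
      then show False using eq by simp
    qed
    then obtain x where x: "0 < be x" "be x \<le> al x" by blast
    \<comment> \<open>The whole ball of radius \<open>b\<close> is removed, so everything that
      remains is more than \<open>b\<close> away from the centre, while the core is within
      \<open>a\<close> of it.\<close>
    define R where "R = {i\<in>T. dist (y x) (y i) \<le> b}"
    define C where "C = {i\<in>T. dist (y x) (y i) \<le> a}"
    have CR: "C \<subseteq> R" "R \<subseteq> T" unfolding C_def R_def using ab by auto
    have "R \<noteq> {}" using x(1) unfolding be_def R_def by force
    then have "card (T - R) < card T" using finT CR by (intro psubset_card_mono) auto
    then have "\<exists>\<P>. ?Q (T - R) \<P>"
      by (rule less.hyps) (use less.prems in auto)
    then obtain \<P> where P: "?Q (T - R) \<P>" by (elim exE)
    note P1 = conjunct1[OF P] and P2 = bspec[OF conjunct1[OF conjunct2[OF P]]]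
      and P3 = conjunct1[OF conjunct2[OF conjunct2[OF P]]] and P4 = conjunct2[OF conjunct2[OF conjunct2[OF P]]]
    have new: "(R, C) \<notin> \<P>"
    proof
      assume "(R, C) \<in> \<P>"
      then have "R \<subseteq> T - R" using P2[of "(R, C)"] by simp
      then show False using \<open>R \<noteq> {}\<close> by auto
    qed
    have sep: "b - a \<le> dist (y i) (y j)" if "i \<in> C" "j \<in> T - R" for i j
    proof -
      have "dist (y x) (y i) \<le> a" "b < dist (y x) (y j)" using that unfolding C_def R_def by auto
      then show ?thesis using dist_triangle[of "y x" "y j" "y i"] by linarith
    qed
    have sub: "snd P' \<subseteq> T - R" if "P' \<in> \<P>" for P' using P2[OF that] by blast
    show ?thesis
    proof (intro exI[of _ "insert (R,C) \<P>"] conjI)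
      show "finite (insert (R, C) \<P>)" using P1 by simp
      have old: "snd P \<subseteq> fst P \<and> fst P \<subseteq> T \<and>
          (\<exists>x. (\<forall>i\<in>fst P. dist x (y i) \<le> b) \<and> (\<forall>i\<in>snd P. dist x (y i) \<le> a)) \<and>
          0 < (\<Sum>i\<in>fst P. G i * \<mu> i) \<and> (\<Sum>i\<in>fst P. G i * \<mu> i) \<le> (\<Sum>i\<in>snd P. f i * \<mu> i)" if "P \<in> \<P>" for P
        using P2[OF that] by blast
      have nw: "\<exists>z. (\<forall>i\<in>R. dist z (y i) \<le> b) \<and> (\<forall>i\<in>C. dist z (y i) \<le> a)"
        unfolding R_def C_def by (intro exI[of _ "y x"]) auto
      show "\<forall>P\<in>insert (R, C) \<P>. snd P \<subseteq> fst P \<and> fst P \<subseteq> T \<and>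
          (\<exists>x. (\<forall>i\<in>fst P. dist x (y i) \<le> b) \<and> (\<forall>i\<in>snd P. dist x (y i) \<le> a)) \<and>
          0 < (\<Sum>i\<in>fst P. G i * \<mu> i) \<and> (\<Sum>i\<in>fst P. G i * \<mu> i) \<le> (\<Sum>i\<in>snd P. f i * \<mu> i)"
        using old nw CR x unfolding al_def be_def R_def[symmetric] C_def[symmetric] by simp
      show "\<forall>P\<in>insert (R, C) \<P>. \<forall>P'\<in>insert (R, C) \<P>. P \<noteq> P' \<longrightarrow> (\<forall>i\<in>snd P. \<forall>j\<in>snd P'. b - a \<le> dist (y i) (y j))"
      proof (intro ballI impI)
        fix P1 P2 i j assume h: "P1 \<in> insert (R, C) \<P>" "P2 \<in> insert (R, C) \<P>" "P1 \<noteq> P2" "i \<in> snd P1" "j \<in> snd P2"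
        consider "P1 = (R,C)" "P2 \<in> \<P>" | "P2 = (R,C)" "P1 \<in> \<P>" | "P1 \<in> \<P>" "P2 \<in> \<P>" using h by blast
        then show "b - a \<le> dist (y i) (y j)"
        proof cases
          case 1 then show ?thesis using sep[of i j] sub[of P2] h by auto
        next
          case 2 then show ?thesis using sep[of j i] sub[of P1] h by (auto simp: dist_commute)
        next
          case 3 then show ?thesis using P3 h by blast
        qed
      qed
      have "(\<Sum>P\<in>insert (R, C) \<P>. \<Sum>i\<in>fst P. G i * \<mu> i) = (\<Sum>i\<in>R. G i * \<mu> i) + (\<Sum>i\<in>T - R. G i * \<mu> i)"
        using P1 P4 new by simp
      also have "\<dots> = (\<Sum>i\<in>T. G i * \<mu> i)" using sum.subset_diff[OF CR(2) finT, of "\<lambda>i. G i * \<mu> i"] by simp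
      finally show "(\<Sum>P\<in>insert (R, C) \<P>. \<Sum>i\<in>fst P. G i * \<mu> i) = (\<Sum>i\<in>T. G i * \<mu> i)" .
    qed
  qed
qed

text \<open>Contrapositive of \<open>cov_increasing\<close> along the unions of the first
  \<open>N\<close> sets. The loss is expressed by the upper bound \<open>Q\<close> of the exponents,
  so that it is the same at every level of the scheme; \<open>v \<le> 1\<close> supplies the
  smallness hypothesis of \<open>cov_increasing\<close>.\<close>

lemma cov_finite_pieces:
  fixes X :: "'a::metric_space set"
  assumes big: "\<not> cov q v X" and v: "0 < v" "v \<le> 1" and p: "0 < p" "p < q" "q \<le> Q"
    and X: "X \<subseteq> (\<Union>j. P j)"
  shows "\<exists>N::nat. \<not> cov p (v / (4 * 6 powr Q + 1)) (X \<inter> (\<Union>j<N. P j))"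
proof (rule ccontr)
  define \<kappa> where "\<kappa> = v / (4 * 6 powr Q + 1)"
  assume "\<not> ?thesis"
  then have c: "cov p \<kappa> (X \<inter> (\<Union>j<N. P j))" for N unfolding \<kappa>_def by blast
  have k0: "0 < \<kappa>" unfolding \<kappa>_def using v by (intro divide_pos_pos add_pos_pos) auto
  have qQ: "6 powr q \<le> 6 powr Q" using p by (intro powr_mono) auto
  have le: "(4 * 6 powr q + 1) * \<kappa> \<le> v"
  proof -
    have "(4 * 6 powr q + 1) * \<kappa> \<le> (4 * 6 powr Q + 1) * \<kappa>" using qQ k0 by (intro mult_right_mono) auto
    also have "\<dots> = v" unfolding \<kappa>_def by (simp add: add_pos_pos less_imp_neq[symmetric])
    finally show ?thesis .
  qed
  have "2 * 6 powr q * \<kappa> \<le> (4 * 6 powr q + 1) * \<kappa>" using k0 by (intro mult_right_mono) auto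
  then have k1: "2 * 6 powr q * \<kappa> \<le> 1" using le v by linarith
  have "cov q ((4 * 6 powr q + 1) * \<kappa>) (\<Union>N. X \<inter> (\<Union>j<N. P j))"
    by (rule cov_increasing[OF c _ p(1,2) k1]) force
  moreover have "X \<subseteq> (\<Union>N. X \<inter> (\<Union>j<N. P j))"
  proof
    fix x assume x: "x \<in> X"
    then obtain j where "x \<in> P j" using X by auto
    then have "x \<in> X \<inter> (\<Union>j<Suc j. P j)" using x by auto
    then show "x \<in> (\<Union>N. X \<inter> (\<Union>j<N. P j))" by blast
  qed
  ultimately show False using big cov_mono[OF _ le] cov_subset by blast
qed

lemma sum_UN_le:
  fixes f :: "'b \<Rightarrow> real"
  assumes "finite A" "\<And>j. j \<in> A \<Longrightarrow> finite (I j)" "\<And>j i. j \<in> A \<Longrightarrow> i \<in> I j \<Longrightarrow> 0 \<le> f i"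
  shows "sum f (\<Union>j\<in>A. I j) \<le> (\<Sum>j\<in>A. sum f (I j))"
  using assms
proof (induction A rule: finite_induct)
  case (insert a A)
  have "sum f (\<Union>j\<in>insert a A. I j) \<le> sum f (I a) + sum f (\<Union>j\<in>A. I j)"
  proof -
    have "sum f (I a \<union> (\<Union>j\<in>A. I j)) = sum f (I a) + sum f (\<Union>j\<in>A. I j) - sum f (I a \<inter> (\<Union>j\<in>A. I j))"
      using insert by (intro sum_Un) auto
    moreover have "0 \<le> sum f (I a \<inter> (\<Union>j\<in>A. I j))" using insert.prems by (intro sum_nonneg) auto
    ultimately show ?thesis by simp
  qed
  moreover have "sum f (\<Union>j\<in>A. I j) \<le> (\<Sum>j\<in>A. sum f (I j))"
    by (rule insert.IH) (use insert.prems in auto)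
  moreover have "(\<Sum>j\<in>insert a A. sum f (I j)) = sum f (I a) + (\<Sum>j\<in>A. sum f (I j))"
    using insert.hyps by simp
  ultimately show ?case by linarith
qed simp

text \<open>The reweighted measure \<open>f \<mu>\<close> is still a Frostman measure, for the smaller exponent \<open>q'\<close>: on sets of size at least \<open>\<tau>\<close>
the bound by \<open>M\<close> applies, and smaller sets only see the crude bound \<open>Gb\<close>, which a small \<open>\<tau>\<close> absorbs.\<close>

lemma core_not_cov:
  fixes Q :: "nat \<Rightarrow> 'a::metric_space set" and \<mu> f M :: "nat \<Rightarrow> real"
  assumes C: "finite C" and mu: "\<And>i. i \<in> C \<Longrightarrow> 0 \<le> \<mu> i"
    and muQ: "\<And>I \<kappa>. I \<subseteq> C \<Longrightarrow> cov p \<kappa> (\<Union>i\<in>I. Q i) \<Longrightarrow> sum \<mu> I \<le> \<kappa>"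
    and tau: "0 < \<tau>" "8 * \<tau> \<le> r"
    and diam: "\<And>i x y. i \<in> C \<Longrightarrow> x \<in> Q i \<Longrightarrow> y \<in> Q i \<Longrightarrow> dist x y \<le> \<tau>"
    and M: "\<And>I i. I \<subseteq> C \<Longrightarrow> i \<in> I \<Longrightarrow> (\<And>j x y. j \<in> I \<Longrightarrow> x \<in> Q i \<Longrightarrow> y \<in> Q j \<Longrightarrow> dist x y \<le> r) \<Longrightarrow> sum \<mu> I \<le> M i"
    and f: "\<And>i. i \<in> C \<Longrightarrow> 0 \<le> f i" "\<And>i. i \<in> C \<Longrightarrow> 0 < \<mu> i \<Longrightarrow> f i \<le> Ga * (1 / M i) powr (1 / h)"
      "\<And>i. i \<in> C \<Longrightarrow> f i \<le> Gb"
    and h: "1 < h" and p: "0 < q'" "q' < p" "g / 2 \<le> p * (1 - 1 / h) - q'" "0 < g" "p \<le> QQ"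
    and r: "0 < r" "r \<le> 1" and Ga: "0 < Ga" "2 * Ga * 3 powr QQ * r powr (g / 2) \<le> 1"
    and Gb: "0 \<le> Gb" "Gb * \<tau> powr (p - q') \<le> 1/4"
    and w: "0 < w" "w < (r / 4) powr q'" "w \<le> (\<Sum>i\<in>C. f i * \<mu> i)"
  shows "\<not> cov q' w (\<Union>i\<in>C. Q i)"
proof
  assume "cov q' w (\<Union>i\<in>C. Q i)"
  then obtain I D e where "covering q' w (\<Union>i\<in>C. Q i) I D e" unfolding cov_def by blast
  note c = coveringD[OF this]
  \<comment> \<open>Such a cheap cover has only members smaller than \<open>r / 4\<close>, so the
    cells meeting a member of size at least \<open>\<tau>\<close> are within \<open>r\<close> of
    each other and the hypothesis on \<open>M\<close> applies to them.\<close>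
  have e_small: "e j < r / 4" if "j \<in> I" for j
  proof (rule ccontr)
    assume "\<not> ?thesis"
    then have "(r / 4) powr q' \<le> e j powr q'" using r p by (intro powr_mono2) auto
    also have "\<dots> \<le> w" using c(4)[of "{j}"] that by simp
    finally show False using w by simp
  qed
  define Bg where "Bg = {j\<in>I. \<tau> \<le> e j}"
  have finB: "finite Bg"
  proof -
    define m where "m = nat \<lfloor>w / \<tau> powr q'\<rfloor>"
    have "card F \<le> m" if F: "F \<subseteq> Bg" "finite F" for F
    proof -
      have "real (card F) * \<tau> powr q' = (\<Sum>j\<in>F. \<tau> powr q')" by simp
      also have "\<dots> \<le> (\<Sum>j\<in>F. e j powr q')"
        using F tau p by (intro sum_mono powr_mono2) (auto simp: Bg_def)
      also have "\<dots> \<le> w" using F by (intro c(4)) (auto simp: Bg_def)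
      finally have "real (card F) \<le> w / \<tau> powr q'" using tau by (simp add: field_simps)
      then show ?thesis unfolding m_def by linarith
    qed
    then show ?thesis using finite_if_finite_subsets_card_bdd[of Bg m] by blast
  qed
  define J where "J j = {i\<in>C. Q i \<inter> D j \<noteq> {}}" for j
  have JC: "J j \<subseteq> C" for j unfolding J_def by auto
  have finJ: "finite (J j)" for j using finite_subset[OF JC C] .
  have fmu: "0 \<le> f i * \<mu> i" if "i \<in> C" for i using f(1) mu that by (intro mult_nonneg_nonneg) auto
  have big: "(\<Sum>i\<in>J j. f i * \<mu> i) \<le> 1/2 * e j powr q'" if j: "j \<in> Bg" for j
  proof -
    have jI: "j \<in> I" and ej: "\<tau> \<le> e j" "0 < e j" "e j < r/4" using j e_small tau unfolding Bg_def by auto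
    have dd: "dist x y \<le> e j + 2 * \<tau>" if h: "i \<in> J j" "i' \<in> J j" "x \<in> Q i" "y \<in> Q i'" for i i' x y
    proof -
      obtain z z' where z: "z \<in> Q i" "z \<in> D j" "z' \<in> Q i'" "z' \<in> D j" using h unfolding J_def by auto
      have "dist x z \<le> \<tau>" "dist z' y \<le> \<tau>" using diam[of i x z] diam[of i' z' y] h z JC by auto
      moreover have "dist z z' \<le> e j" using c(3)[OF jI z(2,4)] .
      ultimately show ?thesis using dist_triangle[of x y z] dist_triangle[of z y z'] by linarith
    qed
    define m where "m = sum \<mu> (J j)"
    have m0: "0 \<le> m" unfolding m_def using mu JC by (intro sum_nonneg) auto
    show ?thesis
    proof (cases "m = 0")
      case True
      have nn: "\<And>i. i \<in> J j \<Longrightarrow> 0 \<le> \<mu> i" using mu JC by blast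
      have "\<forall>i\<in>J j. \<mu> i = 0"
        using sum_nonneg_eq_0_iff[of "J j" \<mu>, OF finJ nn] True unfolding m_def by simp
      then have "(\<Sum>i\<in>J j. f i * \<mu> i) = 0" by (intro sum.neutral) auto
      then show ?thesis by simp
    next
      case False
      then have m: "0 < m" using m0 by simp
      have "cov p ((e j + 2 * \<tau>) powr p) (\<Union>i\<in>J j. Q i)"
        using dd ej tau by (intro cov_single) auto
      then have "m \<le> (e j + 2 * \<tau>) powr p" unfolding m_def using muQ[OF JC] by blast
      also have "\<dots> \<le> (3 * e j) powr p" using ej tau p by (intro powr_mono2) auto
      finally have mle: "m \<le> (3 * e j) powr p" .
      have trm: "f i * \<mu> i \<le> Ga * (1 / m) powr (1 / h) * \<mu> i" if i: "i \<in> J j" for i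
      proof (cases "\<mu> i = 0")
        case False
        then have mi: "0 < \<mu> i" using mu[of i] i JC by force
        have "m \<le> M i" unfolding m_def
        proof (rule M[OF JC i])
          fix i' x y assume "i' \<in> J j" "x \<in> Q i" "y \<in> Q i'"
          then have "dist x y \<le> e j + 2 * \<tau>" using dd i by blast
          then show "dist x y \<le> r" using ej tau r by linarith
        qed
        then have "(1 / M i) powr (1 / h) \<le> (1 / m) powr (1 / h)"
          using m h by (intro powr_mono2 divide_left_mono mult_pos_pos) auto
        then have "f i \<le> Ga * (1 / m) powr (1 / h)"
          using f(2)[of i] i JC mi Ga by (meson less_imp_le mult_left_mono order_trans subsetD)
        then show ?thesis using mi by (intro mult_right_mono) auto
      qed simp
      \<comment> \<open>The reweighting costs a factor \<open>(1 / m) powr (1 / h)\<close> and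
        leaves \<open>m powr (1 - 1 / h)\<close>. By the Frostman bound on \<open>m\<close> this is
        at most a power of \<open>3 * e j\<close> of exponent at least \<open>q' + g / 2\<close>,
        and the surplus \<open>g / 2\<close> absorbs the constants.\<close>
      have "(\<Sum>i\<in>J j. f i * \<mu> i) \<le> (\<Sum>i\<in>J j. Ga * (1 / m) powr (1 / h) * \<mu> i)" by (intro sum_mono trm)
      also have "\<dots> = Ga * ((1 / m) powr (1 / h) * m)" unfolding m_def sum_distrib_left by (simp add: mult.assoc)
      also have "(1 / m) powr (1 / h) * m = m powr (1 - 1 / h)"
        using m by (simp add: powr_diff powr_divide)
      also have "\<dots> \<le> ((3 * e j) powr p) powr (1 - 1 / h)" using mle m h by (intro powr_mono2) auto
      also have "\<dots> = 3 powr (p * (1 - 1 / h)) * e j powr (p * (1 - 1 / h))"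
        using ej by (simp add: powr_powr powr_mult)
      also have "\<dots> \<le> 3 powr QQ * (e j powr q' * r powr (g / 2))"
      proof (intro mult_mono)
        have "p * (1 - 1 / h) \<le> p * 1" using p h by (intro mult_left_mono) auto
        then have "p * (1 - 1 / h) \<le> QQ" using p(5) by linarith
        then show "3 powr (p * (1 - 1 / h)) \<le> (3::real) powr QQ" by (rule powr_mono) simp
        have "e j powr (p * (1 - 1 / h)) = e j powr q' * e j powr (p * (1 - 1 / h) - q')"
          by (simp add: powr_add[symmetric])
        also have "\<dots> \<le> e j powr q' * e j powr (g / 2)"
          using ej r p by (intro mult_left_mono powr_mono') auto
        also have "\<dots> \<le> e j powr q' * r powr (g / 2)"
          using ej p by (intro mult_left_mono powr_mono2) auto
        finally show "e j powr (p * (1 - 1 / h)) \<le> e j powr q' * r powr (g / 2)" .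
      qed auto
      finally have "(\<Sum>i\<in>J j. f i * \<mu> i) \<le> Ga * (3 powr QQ * (e j powr q' * r powr (g / 2)))"
        using Ga by (simp add: mult_left_mono)
      also have "\<dots> = 1/2 * e j powr q' * (2 * Ga * 3 powr QQ * r powr (g / 2))" by simp
      also have "\<dots> \<le> 1/2 * e j powr q' * 1" using Ga(2) by (intro mult_left_mono) auto
      finally show ?thesis by simp
    qed
  qed
  define S where "S = C - (\<Union>j\<in>Bg. J j)"
  have SC: "S \<subseteq> C" unfolding S_def by auto
  \<comment> \<open>In the exponent \<open>p\<close> of \<open>\<mu>\<close>, members below
    \<open>\<tau>\<close> cost less by the factor \<open>\<tau> powr (p - q')\<close>, which absorbs
    \<open>Gb\<close>. Large and small members together account for at most
    \<open>w / 2 + w / 4\<close>, less than the weight of the core.\<close>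
  have covS: "cov p (\<tau> powr (p - q') * w) (\<Union>i\<in>S. Q i)"
  proof (rule covI[of "I - Bg" _ D e])
    show "(\<Union>i\<in>S. Q i) \<subseteq> (\<Union>j\<in>I - Bg. D j)"
    proof
      fix x assume "x \<in> (\<Union>i\<in>S. Q i)"
      then obtain i where i: "i \<in> S" "x \<in> Q i" by auto
      then obtain j where j: "j \<in> I" "x \<in> D j" using c(1) SC by blast
      have "j \<notin> Bg" using i j unfolding S_def J_def by auto
      then show "x \<in> (\<Union>j\<in>I - Bg. D j)" using j by auto
    qed
    fix F assume F: "finite F" "F \<subseteq> I - Bg"
    have "(\<Sum>j\<in>F. e j powr p) \<le> (\<Sum>j\<in>F. \<tau> powr (p - q') * e j powr q')"
    proof (rule sum_mono)
      fix j assume "j \<in> F"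
      then have ej: "0 < e j" "e j < \<tau>" using F c(2)[of j] unfolding Bg_def by auto
      have "e j powr p = e j powr (p - q') * e j powr q'" by (simp add: powr_add[symmetric])
      also have "\<dots> \<le> \<tau> powr (p - q') * e j powr q'" using ej p by (intro mult_right_mono powr_mono2) auto
      finally show "e j powr p \<le> \<tau> powr (p - q') * e j powr q'" .
    qed
    also have "\<dots> \<le> \<tau> powr (p - q') * w"
      unfolding sum_distrib_left[symmetric] using F by (intro mult_left_mono c(4)) auto
    finally show "(\<Sum>j\<in>F. e j powr p) \<le> \<tau> powr (p - q') * w" .
  qed (use c in auto)
  have "(\<Sum>i\<in>S. f i * \<mu> i) \<le> (\<Sum>i\<in>S. Gb * \<mu> i)"
    using f(3) mu SC by (intro sum_mono mult_right_mono) auto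
  also have "\<dots> = Gb * sum \<mu> S" by (simp add: sum_distrib_left)
  also have "\<dots> \<le> Gb * (\<tau> powr (p - q') * w)" using muQ[OF SC covS] Gb by (intro mult_left_mono) auto
  also have "\<dots> = (Gb * \<tau> powr (p - q')) * w" by simp
  also have "\<dots> \<le> 1/4 * w" using Gb w by (intro mult_right_mono) auto
  finally have small: "(\<Sum>i\<in>S. f i * \<mu> i) \<le> 1/4 * w" .
  have "(\<Sum>i\<in>(\<Union>j\<in>Bg. J j). f i * \<mu> i) \<le> (\<Sum>j\<in>Bg. \<Sum>i\<in>J j. f i * \<mu> i)"
    using finB finJ fmu JC by (intro sum_UN_le) auto
  also have "\<dots> \<le> (\<Sum>j\<in>Bg. 1/2 * e j powr q')" by (intro sum_mono big)
  also have "\<dots> \<le> 1/2 * w" unfolding sum_distrib_left[symmetric]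
    using finB by (intro mult_left_mono c(4)) (auto simp: Bg_def)
  finally have bigs: "(\<Sum>i\<in>(\<Union>j\<in>Bg. J j). f i * \<mu> i) \<le> 1/2 * w" .
  have "(\<Sum>i\<in>C. f i * \<mu> i) = (\<Sum>i\<in>S. f i * \<mu> i) + (\<Sum>i\<in>(\<Union>j\<in>Bg. J j). f i * \<mu> i)"
    unfolding S_def using JC C by (intro sum.subset_diff) auto
  then show False using small bigs w by linarith
qed

text \<open>Pigeonhole on the telescoping product of the ratios of consecutive values.\<close>

lemma exists_slow_growth_level:
  fixes M :: "nat \<Rightarrow> real"
  assumes h: "0 < h" and M0: "0 < M 0" and Mh: "M h \<le> 1"
  shows "\<exists>l<h. M (Suc l) \<le> (1 / M 0) powr (1 / real h) * M l"
proof (rule ccontr)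
  define z where "z = (1 / M 0) powr (1 / real h)"
  assume "\<not> ?thesis"
  then have neg: "z * M l < M (Suc l)" if "l < h" for l using that unfolding z_def by (meson not_le)
  have z0: "0 < z" unfolding z_def using M0 by simp
  have "M 0 * z ^ l \<le> M l" if "l \<le> h" for l
    using that
  proof (induction l)
    case (Suc l)
    then have "z * (M 0 * z ^ l) \<le> z * M l" using z0 by (intro mult_left_mono) auto
    also have "\<dots> < M (Suc l)" using neg Suc by auto
    finally show ?case by (simp add: ac_simps)
  qed simp
  then have "M 0 * z ^ (h - 1) \<le> M (h - 1)" by simp
  then have "z * (M 0 * z ^ (h - 1)) \<le> z * M (h - 1)" using z0 by (intro mult_left_mono) auto
  also have "\<dots> < M h" using neg[of "h - 1"] h by simp
  also have "z * (M 0 * z ^ (h - 1)) = M 0 * z ^ h" using power_minus_mult[OF h, of z] by (simp add: ac_simps)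
  finally have "M 0 * z ^ h < 1" using Mh by linarith
  moreover have "z ^ h = 1 / M 0"
    unfolding z_def using M0 h by (simp add: powr_realpow[symmetric] powr_powr)
  ultimately show False using M0 by simp
qed

text \<open>The indices in \<open>\<J>\<close> are the pairs (removed block, core) of the previous carving.\<close>

lemma stage:
  fixes X :: "'a::{metric_space, second_countable_topology} set" and P :: "nat \<Rightarrow> 'a set" and h :: nat
  assumes big: "\<not> cov q v X" and XP: "X \<subseteq> (\<Union>j. P j)" and v: "0 < v" "v \<le> 1"
    and k: "0 < k" "k \<le> q'" and q: "q' < q" "q \<le> QQ" and h: "4 * QQ \<le> (q - q') * real h"
    and r: "r = 2 * v powr (1 / k)" "r \<le> 1"
    and G0: "G0 = 2 * real h * ((4 * 6 powr QQ + 1)^2 * 3 powr QQ)"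
    and small: "2 * G0 * (12 * 2 ^ h) powr QQ * r powr ((q - q') / 2) < 1"
  shows "\<exists>(\<J>::(nat set \<times> nat set) set) Y w. finite \<J> \<and>
    (\<forall>m\<in>\<J>. Y m \<subseteq> X \<and> 0 < w m \<and> w m \<le> v powr (q' / k) \<and> \<not> cov q' (w m) (Y m) \<and>
       (\<exists>b. Y m \<subseteq> (\<Union>j<b. P j)) \<and> (\<forall>x\<in>Y m. \<forall>y\<in>Y m. dist x y \<le> v powr (1 / QQ))) \<and>
    (\<forall>m\<in>\<J>. \<forall>n\<in>\<J>. m \<noteq> n \<longrightarrow> (\<forall>x\<in>Y m. \<forall>y\<in>Y n. v powr (1 / k) \<le> dist x y)) \<and>
    (\<Sum>m\<in>\<J>. w m) = v"
proof -

  \<comment> \<open>Exponents and constants for one splitting\<close>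
  define g where "g = q - q'"
  \<comment> \<open>The drop \<open>g\<close> is spent as follows: \<open>g / 8\<close> on each of
    the two cuttings into finitely many cells, at most \<open>g / 4\<close> on the loss
    \<open>p / h\<close> of the reweighting, and the remaining \<open>g / 2\<close> is the power of
    \<open>r\<close> that beats all constants.\<close>
  define p0 where "p0 = q - g / 8"
  define p where "p = q - g / 4"
  define K where "K = 4 * 6 powr QQ + 1"
  define K3 where "K3 = K^2 * 3 powr QQ"
  have q'0: "0 < q'" using k by simp
  have g: "0 < g" "g < q" unfolding g_def using q q'0 by auto
  have QQ0: "0 < QQ" using q q'0 by simp
  have ps: "0 < p" "p < p0" "p0 < q" "q' < p" "p \<le> QQ" "p - q' = 3 * g / 4" "0 < p0" "p0 \<le> QQ"
    unfolding p_def p0_def g_def using q q'0 by (simp_all add: field_simps)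
  have h4: "4 < real h"
  proof (rule ccontr)
    assume "\<not> ?thesis"
    then have "g * real h \<le> g * 4" using g by (intro mult_left_mono) auto
    then show False using h g q unfolding g_def[symmetric] by linarith
  qed
  then have h0: "0 < h" by simp
  have K1: "1 \<le> K" unfolding K_def by simp
  have K0: "0 < K" using K1 by simp
  have K3: "0 < K3" unfolding K3_def using K0 by simp
  have K31: "1 \<le> K3"
  proof -
    have "1 * 1 \<le> K3" unfolding K3_def using K1 QQ0 by (intro mult_mono) (auto simp: one_le_power ge_one_powr_ge_zero)
    then show ?thesis by simp
  qed
  \<comment> \<open>\<open>K3\<close> collects the two cuttings (\<open>K\<close> each) and the
    Frostman constant; the factor 2 pays for the light cells and \<open>h\<close> for restricting to
    one radius.\<close>
  have G0K: "G0 = 2 * real h * K3" unfolding G0 K3_def K_def ..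
  have G00: "0 < G0" unfolding G0K using K3 h0 by simp
  have G01: "1 \<le> G0"
  proof -
    have "1 * 1 \<le> G0" unfolding G0K using K31 h4 by (intro mult_mono) auto
    then show ?thesis by simp
  qed
  have r0: "0 < r" unfolding r using v by simp
  define pw where "pw = (12 * 2 ^ h :: real) powr QQ"
  have two_h: "(1::real) \<le> 2 ^ h" by simp
  have small': "2 * G0 * pw * r powr (g / 2) < 1" using small unfolding pw_def g_def .
  have cond2: "2 * G0 * 3 powr QQ * r powr (g / 2) \<le> 1"
  proof -
    have "3 \<le> (12 * 2 ^ h :: real)" using two_h by linarith
    then have "3 powr QQ \<le> pw" unfolding pw_def using QQ0 by (intro powr_mono2) auto
    then have "2 * G0 * 3 powr QQ * r powr (g / 2) \<le> 2 * G0 * pw * r powr (g / 2)"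
      using G00 by (intro mult_right_mono mult_left_mono) auto
    then show ?thesis using small' by linarith
  qed
  \<comment> \<open>\<open>G0\<close> times the Frostman bound for a block of size
    \<open>3 * (r * 2 ^ h)\<close> will bound the weight of each piece. Being below
    \<open>(r / 4) powr q'\<close>, it is also below \<open>v powr (q' / k)\<close>.\<close>
  have cond1: "G0 * (3 * (r * 2 ^ h)) powr p < (r / 4) powr q'"
  proof -
    have a: "(3 * (r * 2 ^ h)) powr p = (3 * 2 ^ h) powr p * (r powr q' * r powr (p - q'))"
      using r0 by (simp add: powr_mult powr_add[symmetric] ac_simps)
    have b: "(3 * 2 ^ h) powr p * 4 powr q' \<le> pw"
    proof -
      have t: "1 \<le> (3 * 2 ^ h :: real)" using two_h by linarith
      have "(3 * 2 ^ h :: real) powr p * 4 powr q' \<le> (3 * 2 ^ h) powr QQ * 4 powr QQ"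
        using t ps q by (intro mult_mono powr_mono) auto
      also have "\<dots> = pw" unfolding pw_def by (subst powr_mult[symmetric]) auto
      finally show ?thesis .
    qed
    have c: "r powr (p - q') \<le> r powr (g / 2)" using r r0 g ps by (intro powr_mono') auto
    have "G0 * (3 * (r * 2 ^ h)) powr p * 4 powr q' = G0 * ((3 * 2 ^ h) powr p * 4 powr q') * r powr (p - q') * r powr q'"
      unfolding a by simp
    also have "\<dots> \<le> G0 * pw * r powr (g / 2) * r powr q'"
      using b c G00 by (intro mult_right_mono mult_mono mult_left_mono) (auto simp: pw_def)
    also have "\<dots> < 1 * r powr q'"
    proof (rule mult_strict_right_mono)
      have "0 \<le> G0 * pw * r powr (g / 2)" unfolding pw_def using G00 by simp
      then show "G0 * pw * r powr (g / 2) < 1" using small' by linarith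
    qed (use r0 in simp)
    finally have "G0 * (3 * (r * 2 ^ h)) powr p * 4 powr q' < r powr q'" by simp
    then show ?thesis using r0 by (simp add: powr_divide field_simps)
  qed
  have r4v: "(r / 4) powr q' \<le> v powr (q' / k)"
  proof -
    have "(r / 4) powr q' \<le> (v powr (1 / k)) powr q'" unfolding r using q'0 by (intro powr_mono2) auto
    then show ?thesis by (simp add: powr_powr)
  qed
  have vk: "v powr (q' / k) \<le> v"
  proof -
    have "v powr (q' / k) \<le> v powr 1" using v k by (intro powr_mono') auto
    then show ?thesis using v by simp
  qed
  have b3: "(3 * (r * 2 ^ h)) powr p \<le> v"
  proof -
    have "1 * (3 * (r * 2 ^ h)) powr p \<le> G0 * (3 * (r * 2 ^ h)) powr p" using G01 by (intro mult_right_mono) auto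
    then show ?thesis using cond1 r4v vk by linarith
  qed
  have rho_v: "3 * (r * 2 ^ h) \<le> v powr (1 / QQ)"
  proof -
    have "3 * (r * 2 ^ h) = ((3 * (r * 2 ^ h)) powr p) powr (1 / p)" using r0 ps by (simp add: powr_powr)
    also have "\<dots> \<le> v powr (1 / p)" using b3 ps by (intro powr_mono2) auto
    also have "\<dots> \<le> v powr (1 / QQ)" using v ps by (intro powr_mono' divide_left_mono) auto
    finally show ?thesis .
  qed

  \<comment> \<open>Discretisation into cells at two scales\<close>
  obtain d :: "nat \<Rightarrow> 'a" where d: "\<And>U. open U \<Longrightarrow> U \<noteq> {} \<Longrightarrow> \<exists>i. d i \<in> U"
  proof -
    obtain D :: "'a set" where D: "countable D" "\<And>U. open U \<Longrightarrow> U \<noteq> {} \<Longrightarrow> \<exists>x\<in>D. x \<in> U"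
      using countable_dense_exists by blast
    have "D \<noteq> {}" using D(2)[of UNIV] by auto
    then have "\<exists>i. from_nat_into D i \<in> U" if "open U" "U \<noteq> {}" for U
      using D(2)[OF that] from_nat_into_surj[OF D(1)] by metis
    then show ?thesis using that by blast
  qed
  have dball: "\<exists>i. x \<in> ball (d i) \<epsilon>" if "0 < \<epsilon>" for x \<epsilon>
    using d[of "ball x \<epsilon>"] that by (auto simp: dist_commute)
  \<comment> \<open>An \<open>r\<close>-cell has diameter at most \<open>r / 2\<close> and lies in a
    single \<open>P j\<close>. Keeping finitely many of them is what later places each piece in
    finitely many \<open>P j\<close>.\<close>
  define PA where "PA n = P (fst (prod_decode n)) \<inter> ball (d (snd (prod_decode n))) (r / 4)" for n
  have "X \<subseteq> (\<Union>n. PA n)"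
  proof
    fix x assume "x \<in> X"
    then obtain j i where "x \<in> P j" "x \<in> ball (d i) (r / 4)" using XP dball[of "r / 4" x] r0 by auto
    then have "x \<in> PA (prod_encode (j, i))" unfolding PA_def by simp
    then show "x \<in> (\<Union>n. PA n)" by blast
  qed
  then obtain N1 where N1: "\<not> cov p0 (v / K) (X \<inter> (\<Union>n<N1. PA n))"
    using cov_finite_pieces[OF big v ps(7) ps(3) q(2)] unfolding K_def by blast
  define X1 where "X1 = X \<inter> (\<Union>n<N1. PA n)"
  have N10: "0 < N1"
    using N1 cov_empty[of "v / K" p0] v K0 by (intro gr0I) auto
  \<comment> \<open>\<open>Y1\<close> will bound the growth factors \<open>z i\<close>. It depends
    on the uncontrolled number \<open>N1\<close> of \<open>r\<close>-cells, so \<open>\<tau>\<close>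
    is chosen only after \<open>N1\<close>, small enough to absorb it.\<close>
  define Y1 where "Y1 = 2 * real N1 * K3 / v"
  define G1 where "G1 = G0 * Y1"
  have Y11: "1 \<le> Y1"
  proof -
    have "v * 1 \<le> 2 * real N1 * K3" using v N10 K31 by (intro mult_mono) auto
    then show ?thesis unfolding Y1_def using v by (simp add: field_simps)
  qed
  have G10: "0 < G1" unfolding G1_def using G00 Y11 by simp
  define \<tau> where "\<tau> = min (r / 8) ((1 / (4 * G1)) powr (1 / (p - q')))"
  have tau: "0 < \<tau>" "8 * \<tau> \<le> r" unfolding \<tau>_def using r0 G10 by auto
  have cond3: "G1 * \<tau> powr (p - q') \<le> 1/4"
  proof -
    have "\<tau> powr (p - q') \<le> ((1 / (4 * G1)) powr (1 / (p - q'))) powr (p - q')"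
      using tau ps unfolding \<tau>_def by (intro powr_mono2) auto
    also have "\<dots> = 1 / (4 * G1)" using ps G10 by (simp add: powr_powr)
    finally have "G1 * \<tau> powr (p - q') \<le> G1 * (1 / (4 * G1))" using G10 by (intro mult_left_mono) auto
    then show ?thesis using G10 by simp
  qed
  define PB where "PB n = ball (d n) (\<tau> / 2)" for n
  have "X1 \<subseteq> (\<Union>n. PB n)" using dball[of "\<tau> / 2"] tau unfolding PB_def by auto
  moreover have "0 < v / K" "v / K \<le> 1" using v K1 by (auto simp: divide_le_eq)
  ultimately obtain N2 where N2: "\<not> cov p (v / K / K) (X1 \<inter> (\<Union>n<N2. PB n))"
    using cov_finite_pieces[OF N1[folded X1_def] _ _ ps(1) ps(2) ps(8), of PB] unfolding K_def by blast
  define X2 where "X2 = X1 \<inter> (\<Union>n<N2. PB n)"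
  define c1 where "c1 x = (LEAST n. x \<in> PA n)" for x
  define c2 where "c2 x = (LEAST n. x \<in> PB n)" for x
  have c1: "x \<in> PA (c1 x)" "c1 x < N1" if "x \<in> X2" for x
  proof -
    obtain n where n: "n < N1" "x \<in> PA n" using \<open>x \<in> X2\<close> unfolding X2_def X1_def by auto
    show "x \<in> PA (c1 x)" unfolding c1_def using n(2) by (rule LeastI)
    show "c1 x < N1" using Least_le[of "\<lambda>n. x \<in> PA n" n] n unfolding c1_def by auto
  qed
  have c2: "x \<in> PB (c2 x)" "c2 x < N2" if "x \<in> X2" for x
  proof -
    obtain n where n: "n < N2" "x \<in> PB n" using \<open>x \<in> X2\<close> unfolding X2_def by auto
    show "x \<in> PB (c2 x)" unfolding c2_def using n(2) by (rule LeastI)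
    show "c2 x < N2" using Least_le[of "\<lambda>n. x \<in> PB n" n] n unfolding c2_def by auto
  qed
  define N where "N = N1 * N2"
  \<comment> \<open>Mixed-radix coding: \<open>mod N1\<close> recovers the \<open>r\<close>-cell and
    \<open>div N1\<close> the \<open>\<tau>\<close>-cell of a point.\<close>
  define lab where "lab x = c1 x + N1 * c2 x" for x
  have labN: "lab x < N" if "x \<in> X2" for x
  proof -
    have "lab x < N1 + N1 * c2 x" unfolding lab_def using c1[OF that] by simp
    also have "\<dots> = N1 * Suc (c2 x)" by simp
    also have "\<dots> \<le> N1 * N2" using c2[OF that] by (intro mult_le_mono2) auto
    finally show ?thesis unfolding N_def .
  qed
  have lab1: "lab x mod N1 = c1 x" and lab2: "lab x div N1 = c2 x" if "x \<in> X2" for x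
    unfolding lab_def using c1[OF that] by auto
  define Q where "Q i = {x \<in> X2. lab x = i}" for i
  have QX: "(\<Union>i<N. Q i) = X2" unfolding Q_def using labN by auto
  have Qdiam: "dist x y \<le> \<tau>" if "x \<in> Q i" "y \<in> Q i" for i x y
  proof -
    have x: "x \<in> X2" "y \<in> X2" "lab x = i" "lab y = i" using that unfolding Q_def by auto
    then have "c2 x = c2 y" using lab2[of x] lab2[of y] by simp
    then have "x \<in> PB (c2 x)" "y \<in> PB (c2 x)" using c2(1)[of x] c2(1)[of y] x by auto
    then show ?thesis unfolding PB_def using dist_triangle_half_l[of x "d (c2 x)" \<tau> y]
      by (simp add: dist_commute)
  qed
  have Qcell: "dist x y \<le> r / 2" if "x \<in> Q i" "y \<in> Q j" "i mod N1 = j mod N1" for i j x y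
  proof -
    have x: "x \<in> X2" "y \<in> X2" "lab x = i" "lab y = j" using that unfolding Q_def by auto
    then have "c1 x = c1 y" using lab1[of x] lab1[of y] that(3) by simp
    then have "x \<in> PA (c1 x)" "y \<in> PA (c1 x)" using c1(1)[of x] c1(1)[of y] x by auto
    then show ?thesis unfolding PA_def using dist_triangle_half_l[of x "d (snd (prod_decode (c1 x)))" "r / 2" y]
      by (simp add: dist_commute)
  qed
  have bigQ: "\<not> cov p (v / K / K) (\<Union>i<N. Q i)" unfolding QX X2_def by (rule N2)
  obtain \<mu> where mu0: "\<And>i. i < N \<Longrightarrow> 0 \<le> \<mu> i"
    and muQ: "\<And>I \<kappa>. I \<subseteq> {..<N} \<Longrightarrow> cov p \<kappa> (\<Union>i\<in>I. Q i) \<Longrightarrow> sum \<mu> I \<le> \<kappa>"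
    and muV: "v / K / K / 3 powr p \<le> (\<Sum>i<N. \<mu> i)"
    using frostman_cells[OF ps(1) tau(1), of "v / K / K" N Q] v K0 Qdiam bigQ
    by (metis divide_pos_pos)
  define V where "V = (\<Sum>i<N. \<mu> i)"
  have VK: "v / K3 \<le> V"
  proof -
    have "v / K3 \<le> v / (K^2 * 3 powr p)"
      unfolding K3_def using v K0 ps by (intro divide_left_mono mult_left_mono powr_mono) auto
    also have "\<dots> = v / K / K / 3 powr p" by (simp add: power2_eq_square)
    finally show ?thesis using muV unfolding V_def by linarith
  qed
  have V0: "0 < V" using VK v K3 by (meson divide_pos_pos less_le_trans)
  define B where "B = {i. i < N \<and> Q i \<noteq> {}}"
  have BN: "B \<subseteq> {..<N}" unfolding B_def by auto
  have finB: "finite B" using finite_subset[OF BN] by simp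
  have muB: "0 \<le> \<mu> i" if "i \<in> B" for i using mu0 that BN by auto
  have mu_empty: "\<mu> i = 0" if "i < N" "i \<notin> B" for i
  proof -
    have "Q i = {}" using that unfolding B_def by auto
    then have "sum \<mu> {i} \<le> 0" using that cov_empty[of 0 p] by (intro muQ) auto
    then show ?thesis using mu0[OF that(1)] by simp
  qed
  define y where "y i = (SOME x. x \<in> Q i)" for i
  have y: "y i \<in> Q i" if "i \<in> B" for i
    unfolding y_def using that some_in_eq[of "Q i"] unfolding B_def by auto
  have mass: "sum \<mu> I \<le> D powr p" if "I \<subseteq> B" "0 < D" "\<And>i j x z. i \<in> I \<Longrightarrow> j \<in> I \<Longrightarrow> x \<in> Q i \<Longrightarrow> z \<in> Q j \<Longrightarrow> dist x z \<le> D" for I D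
    using that BN by (intro muQ cov_single) auto
  have near: "dist x z \<le> dist (y i) (y j) + 2 * \<tau>" if "i \<in> B" "j \<in> B" "x \<in> Q i" "z \<in> Q j" for i j x z
    using Qdiam[OF that(3) y[OF that(1)]] Qdiam[OF y[OF that(2)] that(4)]
      dist_triangle[of x z "y i"] dist_triangle[of "y i" z "y j"] by linarith
  define M where "M i \<rho> = sum \<mu> {j\<in>B. dist (y i) (y j) \<le> \<rho>}" for i \<rho>
  \<comment> \<open>Discarding the light \<open>r\<close>-cells costs at most half of the mass and gives a lower bound for \<open>M i r\<close> that does not
    depend on \<open>\<tau>\<close>.\<close>
  define T where "T = {i\<in>B. 0 < \<mu> i \<and> V / (2 * real N1) \<le> sum \<mu> {j\<in>{..<N}. j mod N1 = i mod N1}}"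
  have TB: "T \<subseteq> B" unfolding T_def by auto
  have finT: "finite T" using finite_subset[OF TB finB] .
  have massT: "V / 2 \<le> sum \<mu> T"
  proof -
    define L where "L = {c\<in>{..<N1}. sum \<mu> {j\<in>{..<N}. j mod N1 = c} < V / (2 * real N1)}"
    have "sum \<mu> ({..<N} - T) \<le> sum \<mu> (\<Union>c\<in>L. {j\<in>{..<N}. j mod N1 = c})"
    proof (rule order_trans[OF eq_refl])
      show "sum \<mu> ({..<N} - T) = sum \<mu> {j\<in>{..<N} - T. 0 < \<mu> j}"
        using mu0 by (intro sum.mono_neutral_right) (auto simp: less_le)
      show "sum \<mu> {j\<in>{..<N} - T. 0 < \<mu> j} \<le> sum \<mu> (\<Union>c\<in>L. {j\<in>{..<N}. j mod N1 = c})"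
      proof (rule sum_mono2)
        show "{j\<in>{..<N} - T. 0 < \<mu> j} \<subseteq> (\<Union>c\<in>L. {j\<in>{..<N}. j mod N1 = c})"
        proof
          fix j assume j: "j \<in> {j\<in>{..<N} - T. 0 < \<mu> j}"
          then have "j \<in> B" using mu_empty[of j] by force
          then have "j mod N1 \<in> L" using j N10 unfolding T_def L_def by auto
          then show "j \<in> (\<Union>c\<in>L. {j\<in>{..<N}. j mod N1 = c})" using j by auto
        qed
      qed (use mu0 in \<open>auto simp: L_def\<close>)
    qed
    also have "\<dots> \<le> (\<Sum>c\<in>L. sum \<mu> {j\<in>{..<N}. j mod N1 = c})"
      using mu0 by (intro sum_UN_le) (auto simp: L_def)
    also have "\<dots> \<le> (\<Sum>c\<in>L. V / (2 * real N1))" by (intro sum_mono) (auto simp: L_def)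
    also have "\<dots> = real (card L) * (V / (2 * real N1))" by simp
    also have "\<dots> \<le> real N1 * (V / (2 * real N1))"
    proof (rule mult_right_mono)
      have "card L \<le> card {..<N1}" unfolding L_def by (intro card_mono) auto
      then show "real (card L) \<le> real N1" by simp
    qed (use V0 in auto)
    also have "\<dots> = V / 2" using N10 by simp
    finally have "sum \<mu> ({..<N} - T) \<le> V / 2" .
    moreover have "V = sum \<mu> ({..<N} - T) + sum \<mu> T"
      unfolding V_def using TB BN by (intro sum.subset_diff) auto
    ultimately show ?thesis by simp
  qed
  have MT: "V / (2 * real N1) \<le> M i r" if "i \<in> T" for i
  proof -
    have "V / (2 * real N1) \<le> sum \<mu> {j\<in>{..<N}. j mod N1 = i mod N1}" using that unfolding T_def by auto
    also have "\<dots> = sum \<mu> {j\<in>B. j mod N1 = i mod N1}"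
      using mu_empty BN by (intro sum.mono_neutral_right) auto
    also have "\<dots> \<le> M i r" unfolding M_def
    proof (rule sum_mono2)
      show "{j\<in>B. j mod N1 = i mod N1} \<subseteq> {j\<in>B. dist (y i) (y j) \<le> r}"
        using Qcell[OF y y] that TB r0 by fastforce
    qed (use finB muB in auto)
    finally show ?thesis .
  qed

  \<comment> \<open>A radius of slow growth and the carving\<close>
  define \<rho> where "\<rho> l = r * 2 ^ l" for l :: nat
  have rho: "\<rho> 0 = r" "\<And>l. \<rho> (Suc l) = 2 * \<rho> l" "\<And>l. r \<le> \<rho> l" "\<And>l. l \<le> h \<Longrightarrow> \<rho> l \<le> r * 2 ^ h"
    unfolding \<rho>_def using r0 by auto
  have Mh: "M i (\<rho> h) \<le> 1" if "i \<in> B" for i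
  proof -
    have "M i (\<rho> h) \<le> (3 * (r * 2 ^ h)) powr p" unfolding M_def
    proof (rule mass)
      fix j j' x z assume j: "j \<in> {j\<in>B. dist (y i) (y j) \<le> \<rho> h}" "j' \<in> {j\<in>B. dist (y i) (y j) \<le> \<rho> h}" "x \<in> Q j" "z \<in> Q j'"
      have "dist (y j) (y j') \<le> \<rho> h + \<rho> h"
        using j dist_triangle[of "y j" "y j'" "y i"] by (auto simp: dist_commute)
      moreover have "dist x z \<le> dist (y j) (y j') + 2 * \<tau>" using near j by auto
      moreover have "2 * \<tau> \<le> \<rho> h" using tau rho(3)[of h] r0 by linarith
      ultimately show "dist x z \<le> 3 * (r * 2 ^ h)" unfolding \<rho>_def by linarith
    qed (use r0 in auto)
    also have "\<dots> \<le> 1" using b3 v by linarith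
    finally show ?thesis .
  qed
  have Mpos: "0 < M i r" if "i \<in> T" for i
    using MT[OF that] V0 N10 by (meson divide_pos_pos less_le_trans mult_pos_pos of_nat_0_less_iff zero_less_numeral)
  define z where "z i = (1 / M i r) powr (1 / real h)" for i
  have "\<forall>i\<in>T. \<exists>l<h. M i (\<rho> (Suc l)) \<le> z i * M i (\<rho> l)"
  proof
    fix i assume i: "i \<in> T"
    show "\<exists>l<h. M i (\<rho> (Suc l)) \<le> z i * M i (\<rho> l)"
      using exists_slow_growth_level[of h "\<lambda>l. M i (\<rho> l)"] h0 Mpos[OF i] Mh[of i] TB i
      unfolding z_def rho(1) by auto
  qed
  then have Tcov: "T = (\<Union>l\<in>{..<h}. {i\<in>T. M i (\<rho> (Suc l)) \<le> z i * M i (\<rho> l)})" by auto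
  \<comment> \<open>The level found above depends on \<open>i\<close>, whereas \<open>carve\<close>
    uses the same two radii everywhere; some level serves at least the fraction \<open>1 / h\<close>
    of the mass.\<close>
  have "\<exists>l<h. sum \<mu> T / real h \<le> sum \<mu> {i\<in>T. M i (\<rho> (Suc l)) \<le> z i * M i (\<rho> l)}"
  proof (rule ccontr)
    assume "\<not> ?thesis"
    then have lt: "sum \<mu> {i\<in>T. M i (\<rho> (Suc l)) \<le> z i * M i (\<rho> l)} < sum \<mu> T / real h" if "l < h" for l
      using that by (meson not_le)
    have "sum \<mu> T \<le> (\<Sum>l<h. sum \<mu> {i\<in>T. M i (\<rho> (Suc l)) \<le> z i * M i (\<rho> l)})"
      using muB TB finT by (subst Tcov, intro sum_UN_le) auto
    also have "\<dots> < (\<Sum>l<h. sum \<mu> T / real h)" using h0 lt by (intro sum_strict_mono) auto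
    also have "\<dots> = sum \<mu> T" using h0 by simp
    finally show False by simp
  qed
  then obtain l where l: "l < h" "sum \<mu> T / real h \<le> sum \<mu> {i\<in>T. M i (\<rho> (Suc l)) \<le> z i * M i (\<rho> l)}" by blast
  define Tl where "Tl = {i\<in>T. M i (\<rho> (Suc l)) \<le> z i * M i (\<rho> l)}"
  have TlT: "Tl \<subseteq> T" unfolding Tl_def by auto
  have TlB: "Tl \<subseteq> B" using TlT TB by auto
  have massTl: "V / (2 * real h) \<le> sum \<mu> Tl"
  proof -
    have "V / (2 * real h) = V / 2 / real h" by simp
    also have "\<dots> \<le> sum \<mu> T / real h" using massT by (intro divide_right_mono) auto
    finally show ?thesis using l(2) unfolding Tl_def by linarith
  qed
  have massTl0: "0 < sum \<mu> Tl" using massTl V0 h0 by (meson divide_pos_pos less_le_trans mult_pos_pos of_nat_0_less_iff zero_less_numeral)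
  \<comment> \<open>Normalisation that makes the weights of the pieces add up to exactly
    \<open>v\<close>.\<close>
  define c0 where "c0 = v / sum \<mu> Tl"
  have c00: "0 < c0" unfolding c0_def using v massTl0 by simp
  have c0G: "c0 \<le> G0"
  proof -
    have "v \<le> K3 * V" using VK K3 by (simp add: field_simps)
    also have "\<dots> \<le> K3 * (2 * real h * sum \<mu> Tl)" using massTl h0 K3 by (intro mult_left_mono) (auto simp: field_simps)
    finally show ?thesis unfolding c0_def G0K using massTl0 by (simp add: field_simps)
  qed
  define f where "f i = c0 * M i (\<rho> (Suc l)) / M i (\<rho> l)" for i
  have "\<exists>\<P>. finite \<P> \<and>
    (\<forall>P\<in>\<P>. snd P \<subseteq> fst P \<and> fst P \<subseteq> Tl \<and>
      (\<exists>x. (\<forall>i\<in>fst P. dist x (y i) \<le> \<rho> (Suc l)) \<and> (\<forall>i\<in>snd P. dist x (y i) \<le> \<rho> l)) \<and>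
      0 < (\<Sum>i\<in>fst P. c0 * \<mu> i) \<and> (\<Sum>i\<in>fst P. c0 * \<mu> i) \<le> (\<Sum>i\<in>snd P. f i * \<mu> i)) \<and>
    (\<forall>P\<in>\<P>. \<forall>P'\<in>\<P>. P \<noteq> P' \<longrightarrow> (\<forall>i\<in>snd P. \<forall>j\<in>snd P'. \<rho> (Suc l) - \<rho> l \<le> dist (y i) (y j))) \<and>
    (\<Sum>P\<in>\<P>. \<Sum>i\<in>fst P. c0 * \<mu> i) = (\<Sum>i\<in>Tl. c0 * \<mu> i)"
    (is "\<exists>\<P>. ?F \<P> \<and> ?A \<P> \<and> ?S \<P> \<and> ?T \<P>")
    unfolding f_def M_def
    using carve[of B \<mu> "\<rho> l" "\<rho> (Suc l)" Tl "\<lambda>_. c0" y] finB muB TlB c00 rho(2)[of l] rho(3)[of l] r0 by auto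
  then obtain \<P> where P: "?F \<P> \<and> ?A \<P> \<and> ?S \<P> \<and> ?T \<P>" by (elim exE)
  note finP = conjunct1[OF P] and PP = conjunct1[OF conjunct2[OF P]]
    and Psep = conjunct1[OF conjunct2[OF conjunct2[OF P]]] and Psum = conjunct2[OF conjunct2[OF conjunct2[OF P]]]
  define w where "w P = (\<Sum>i\<in>fst P. c0 * \<mu> i)" for P :: "nat set \<times> nat set"
  define Y where "Y P = (\<Union>i\<in>snd P. Q i)" for P :: "nat set \<times> nat set"
  have sumw: "(\<Sum>P\<in>\<P>. w P) = v"
  proof -
    have "(\<Sum>i\<in>Tl. c0 * \<mu> i) = c0 * sum \<mu> Tl" by (simp add: sum_distrib_left)
    also have "\<dots> = v" unfolding c0_def using massTl0 by simp
    finally show ?thesis using Psum unfolding w_def by simp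
  qed
  have rl: "\<rho> (Suc l) \<le> r * 2 ^ h" using rho(4)[of "Suc l"] l(1) by simp
  have fz: "f i \<le> c0 * z i" if "i \<in> Tl" for i
  proof -
    have iT: "i \<in> T" using that TlT by auto
    have "M i r \<le> M i (\<rho> l)" unfolding M_def using rho(3)[of l] finB muB by (intro sum_mono2) auto
    then have "0 < M i (\<rho> l)" using Mpos[OF iT] by linarith
    then have "M i (\<rho> (Suc l)) / M i (\<rho> l) \<le> z i" using that unfolding Tl_def by (simp add: field_simps)
    then have "c0 * (M i (\<rho> (Suc l)) / M i (\<rho> l)) \<le> c0 * z i" using c00 by (intro mult_left_mono) auto
    then show ?thesis unfolding f_def by simp
  qed
  have zY: "z i \<le> Y1" if "i \<in> T" for i
  proof -
    have "1 / M i r \<le> 1 / (V / (2 * real N1))"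
      using MT[OF that] V0 N10 by (intro divide_left_mono mult_pos_pos) (auto intro: Mpos that)
    also have "\<dots> = 2 * real N1 * (1 / V)" by simp
    also have "\<dots> \<le> 2 * real N1 * (K3 / v)"
      using VK v K3 V0 by (intro mult_left_mono) (auto simp: field_simps)
    also have "\<dots> = Y1" unfolding Y1_def by simp
    finally have "1 / M i r \<le> Y1" .
    then have "z i \<le> Y1 powr (1 / real h)" unfolding z_def using Mpos[OF that] by (intro powr_mono2) auto
    also have "\<dots> \<le> Y1 powr 1" using Y11 h4 by (intro powr_mono) auto
    finally show ?thesis using Y11 by simp
  qed
  have f0: "0 \<le> f i" for i unfolding f_def M_def using c00 muB by (intro divide_nonneg_nonneg mult_nonneg_nonneg sum_nonneg) auto
  have pq: "g / 2 \<le> p * (1 - 1 / real h) - q'"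
  proof -
    have "p / real h \<le> g / 4"
    proof -
      have "p * 4 \<le> g * real h" using ps h unfolding g_def[symmetric] by linarith
      then show ?thesis using h0 by (simp add: field_simps)
    qed
    then show ?thesis using ps by (simp add: right_diff_distrib)
  qed

  \<comment> \<open>Verification of the pieces\<close>
  have main: "Y m \<subseteq> X \<and> 0 < w m \<and> w m \<le> v powr (q' / k) \<and> \<not> cov q' (w m) (Y m) \<and>
       (\<exists>b. Y m \<subseteq> (\<Union>j<b. P j)) \<and> (\<forall>x\<in>Y m. \<forall>y\<in>Y m. dist x y \<le> v powr (1 / QQ))" if m: "m \<in> \<P>" for m
  proof -
    define R where "R = fst m"
    define C where "C = snd m"
    have mm: "C \<subseteq> R" "R \<subseteq> Tl" "0 < w m" "w m \<le> (\<Sum>i\<in>C. f i * \<mu> i)"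
      using PP m unfolding C_def R_def w_def by auto
    obtain x0 where x0: "\<And>i. i \<in> R \<Longrightarrow> dist x0 (y i) \<le> \<rho> (Suc l)" "\<And>i. i \<in> C \<Longrightarrow> dist x0 (y i) \<le> \<rho> l"
      using PP m unfolding C_def R_def by blast
    have CB: "C \<subseteq> B" "R \<subseteq> B" using mm TlB by auto
    have finC: "finite C" using finite_subset[OF CB(1) finB] .
    have YX2: "Y m \<subseteq> X2" unfolding Y_def Q_def by auto
    have Rdist: "dist x z \<le> 3 * (r * 2 ^ h)" if "i \<in> R" "j \<in> R" "x \<in> Q i" "z \<in> Q j" for i j x z
    proof -
      have "dist (y i) (y j) \<le> 2 * \<rho> (Suc l)"
        using x0(1)[OF that(1)] x0(1)[OF that(2)] dist_triangle[of "y i" "y j" x0] by (simp add: dist_commute)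
      moreover have "dist x z \<le> dist (y i) (y j) + 2 * \<tau>" using near[of i j x z] that CB by auto
      moreover have "2 * \<tau> \<le> \<rho> (Suc l)" using tau rho(3)[of "Suc l"] r0 by linarith
      ultimately show ?thesis using rl by linarith
    qed
    have "w m = c0 * sum \<mu> R" unfolding w_def R_def by (simp add: sum_distrib_left)
    also have "\<dots> \<le> G0 * (3 * (r * 2 ^ h)) powr p"
      using c0G c00 muB CB r0 by (intro mult_mono mass Rdist sum_nonneg) auto
    finally have wlt: "w m < (r / 4) powr q'" using cond1 by linarith
    have "\<not> cov q' (w m) (\<Union>i\<in>C. Q i)"
    proof (rule core_not_cov[where \<mu>=\<mu> and p=p and \<tau>=\<tau> and r=r and f=f and M="\<lambda>i. M i r" and Ga=G0 and h="real h"
          and Gb=G1 and g=g and QQ=QQ])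
      show "0 \<le> \<mu> i" if "i \<in> C" for i using muB CB that by auto
      show "sum \<mu> I \<le> \<kappa>" if "I \<subseteq> C" "cov p \<kappa> (\<Union>i\<in>I. Q i)" for I \<kappa>
        using muQ[of I \<kappa>] that CB BN by auto
      show "sum \<mu> I \<le> M i r" if I: "I \<subseteq> C" "i \<in> I" and IQ: "\<And>j x y. j \<in> I \<Longrightarrow> x \<in> Q i \<Longrightarrow> y \<in> Q j \<Longrightarrow> dist x y \<le> r" for I i
        unfolding M_def
      proof (rule sum_mono2)
        show "I \<subseteq> {j \<in> B. dist (y i) (y j) \<le> r}"
        proof
          fix j assume "j \<in> I"
          moreover have "i \<in> B" "j \<in> B" using I CB \<open>j \<in> I\<close> by auto
          ultimately show "j \<in> {j \<in> B. dist (y i) (y j) \<le> r}" using IQ[OF _ y y, of j] by auto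
        qed
      qed (use finB muB in auto)
      show "f i \<le> G0 * (1 / M i r) powr (1 / real h)" if "i \<in> C" for i
      proof -
        have "c0 * z i \<le> G0 * z i" using c0G unfolding z_def by (intro mult_right_mono) auto
        then show ?thesis using fz[of i] that mm unfolding z_def by auto
      qed
      show "f i \<le> G1" if "i \<in> C" for i
      proof -
        have i: "i \<in> Tl" "i \<in> T" using that mm TlT by auto
        have "c0 * z i \<le> G0 * Y1" using c0G c00 G00 zY[OF i(2)] unfolding z_def by (intro mult_mono) auto
        then show ?thesis using fz[OF i(1)] unfolding G1_def by linarith
      qed
    qed (use finC tau Qdiam f0 h4 q'0 ps pq g r0 r(2) G00 cond2 G10 cond3 mm wlt in auto)
    moreover have "Y m = (\<Union>i\<in>C. Q i)" unfolding Y_def C_def ..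
    moreover have "\<exists>b. Y m \<subseteq> (\<Union>j<b. P j)"
    proof (intro exI[of _ "Suc (Max ((\<lambda>n. fst (prod_decode n)) ` {..<N1}))"] subsetI)
      fix x assume "x \<in> Y m"
      then have "x \<in> X2" using YX2 by auto
      then have x: "x \<in> PA (c1 x)" "c1 x < N1" using c1 by auto
      then have "fst (prod_decode (c1 x)) \<le> Max ((\<lambda>n. fst (prod_decode n)) ` {..<N1})" by (intro Max_ge) auto
      then show "x \<in> (\<Union>j<Suc (Max ((\<lambda>n. fst (prod_decode n)) ` {..<N1})). P j)"
        using x(1) unfolding PA_def by (auto simp: less_Suc_eq_le)
    qed
    moreover have "\<forall>x\<in>Y m. \<forall>y\<in>Y m. dist x y \<le> v powr (1 / QQ)"
    proof (intro ballI)
      fix x z assume "x \<in> Y m" "z \<in> Y m"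
      then obtain i j where "i \<in> C" "x \<in> Q i" "j \<in> C" "z \<in> Q j" unfolding Y_def C_def by auto
      then have "dist x z \<le> 3 * (r * 2 ^ h)" using Rdist[of i j x z] mm(1) by auto
      then show "dist x z \<le> v powr (1 / QQ)" using rho_v by linarith
    qed
    ultimately show ?thesis using YX2 mm(3) wlt r4v unfolding X2_def X1_def by auto
  qed
  \<comment> \<open>Representatives in different cores are at least \<open>r\<close> apart, and
    passing to other points of their cells loses at most \<open>2 * \<tau> \<le> r / 4\<close>. The
    factor 2 in \<open>r = 2 * v powr (1 / k)\<close> leaves room for this.\<close>
  have sep: "v powr (1 / k) \<le> dist x z" if mn: "m \<in> \<P>" "n \<in> \<P>" "m \<noteq> n" "x \<in> Y m" "z \<in> Y n" for m n x z
  proof -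
    obtain i j where ij: "i \<in> snd m" "x \<in> Q i" "j \<in> snd n" "z \<in> Q j" using mn unfolding Y_def by auto
    have "\<rho> (Suc l) - \<rho> l \<le> dist (y i) (y j)" using Psep mn ij by blast
    then have "r \<le> dist (y i) (y j)" using rho(2)[of l] rho(3)[of l] by linarith
    moreover have "i \<in> B" "j \<in> B" using PP mn(1,2) ij TlB by blast+
    moreover have "dist (y i) (y j) \<le> dist x z + 2 * \<tau>"
      using Qdiam[OF ij(2) y[OF \<open>i \<in> B\<close>]] Qdiam[OF ij(4) y[OF \<open>j \<in> B\<close>]]
        dist_triangle[of "y i" "y j" x] dist_triangle[of x "y j" z] by (simp add: dist_commute)
    ultimately have "r / 2 \<le> dist x z" using tau by linarith
    then show ?thesis unfolding r by simp
  qed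
  show ?thesis
    by (intro exI[of _ \<P>] exI[of _ Y] exI[of _ w] conjI finP sumw) (use main sep in blast)+
qed

subsection \<open>The Cantor scheme\<close>

text \<open>In logarithms, \<open>h\<close> is of order \<open>1 / g\<close>, so the constants
  contribute at most a multiple of \<open>1 / g\<close>, while the last factor contributes at most
  \<open>(g / 2) * ln 2 - D / (2 * g * k)\<close>. The rate \<open>exp (- D / g^2)\<close> is the
  one at which the two effects have the same order, and a large \<open>D\<close> decides.\<close>

lemma stage_parameters:
  fixes s k :: real
  assumes s: "0 < s" and k: "0 < k"
  shows "\<exists>D>0. \<forall>g v. 0 < g \<longrightarrow> g \<le> 1 \<longrightarrow> 0 < v \<longrightarrow> v \<le> exp (- D / g\<^sup>2) \<longrightarrow>
    2 * v powr (1 / k) \<le> 1 \<and>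
    2 * (2 * real (nat \<lceil>4 * s / g\<rceil>) * ((4 * 6 powr s + 1)\<^sup>2 * 3 powr s)) * (12 * 2 ^ nat \<lceil>4 * s / g\<rceil>) powr s
      * (2 * v powr (1 / k)) powr (g / 2) < 1"
proof -
  define K3 where "K3 = (4 * 6 powr s + 1 :: real)\<^sup>2 * 3 powr s"
  have K3: "1 \<le> K3"
  proof -
    have "1 * 1 \<le> K3" unfolding K3_def using s by (intro mult_mono) (auto simp: one_le_power ge_one_powr_ge_zero)
    then show ?thesis by simp
  qed
  define c1 where "c1 = ln 2 + ln (2 * K3) + s * ln 12"
  define c2 where "c2 = 1 + s * ln (2::real)"
  have c: "0 \<le> c1" "0 \<le> c2" unfolding c1_def c2_def using K3 s by auto
  \<comment> \<open>The summand 2 pays for the term \<open>(g / 2) * ln 2\<close>, still leaves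
    \<open>ln L \<le> - 1 / g\<close>, and yields \<open>4 * k \<le> D\<close>, which gives
    \<open>r \<le> 1\<close>.\<close>
  define D where "D = 2 * k * (c1 + c2 * (4 * s + 1) + 2)"
  have D4: "4 * k \<le> D"
  proof -
    have "2 * k * 2 \<le> D" unfolding D_def using c s k by (intro mult_left_mono) auto
    then show ?thesis by simp
  qed
  have D0: "0 < D" using D4 k by linarith
  show ?thesis
  proof (intro exI[of _ D] conjI allI impI)
    show "0 < D" by fact
  next
    fix g v :: real assume g: "0 < g" "g \<le> 1" and v: "0 < v" "v \<le> exp (- D / g\<^sup>2)"
    have lnv: "ln v \<le> - D / g\<^sup>2" using v by (metis exp_gt_zero ln_exp ln_le_cancel_iff)
    have g2: "0 < g\<^sup>2" "g\<^sup>2 \<le> 1" using g by (auto simp: power_le_one)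
    define r where "r = 2 * v powr (1 / k)"
    have r0: "0 < r" unfolding r_def using v by simp
    have lnr: "ln r = ln 2 + ln v / k" unfolding r_def using v by (simp add: ln_mult ln_powr)
    have lnr_le: "ln r \<le> ln 2 - D / (g\<^sup>2 * k)"
    proof -
      have "ln v / k \<le> (- D / g\<^sup>2) / k" using lnv k by (intro divide_right_mono) auto
      then show ?thesis unfolding lnr by simp
    qed
    have ln2: "0 < ln (2::real)" "ln (2::real) \<le> 1" using ln_less_self[of 2] ln_le_minus_one[of 2] by auto
    show "2 * v powr (1 / k) \<le> 1"
    proof -
      have "4 * (g\<^sup>2 * k) \<le> 4 * k" using g2 k by (simp add: mult_le_cancel_right1)
      also have "\<dots> \<le> D" by (rule D4)
      finally have "4 \<le> D / (g\<^sup>2 * k)" using g2 k by (simp add: pos_le_divide_eq)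
      then have "ln r \<le> ln 1" using lnr_le ln2 by simp
      then have "r \<le> 1" using r0 by (simp only: ln_le_cancel_iff)
      then show ?thesis unfolding r_def .
    qed
    define h where "h = nat \<lceil>4 * s / g\<rceil>"
    have h0: "0 < h" unfolding h_def using s g by simp
    have hle: "real h \<le> (4 * s + 1) / g"
    proof -
      have "0 \<le> 4 * s / g" using s g by simp
      then have "0 \<le> \<lceil>4 * s / g\<rceil>" by linarith
      then have "real h = of_int \<lceil>4 * s / g\<rceil>" unfolding h_def by simp
      then have "real h \<le> 4 * s / g + 1" by linarith
      also have "\<dots> \<le> 4 * s / g + 1 / g" using g by simp
      finally show ?thesis by (simp add: add_divide_distrib)
    qed
    define L where "L = 2 * (2 * real h * K3) * (12 * 2 ^ h) powr s * r powr (g / 2)"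
    have L0: "0 < L" unfolding L_def using h0 K3 r0 by simp
    have "ln L = ln 2 + ln (2 * K3) + ln (real h) + s * (ln 12 + real h * ln 2) + (g / 2) * ln r"
    proof -
      have "L = 2 * (2 * K3) * real h * (12 * 2 ^ h) powr s * r powr (g / 2)" unfolding L_def by simp
      moreover have "ln (2 * (2 * K3) * real h * (12 * 2 ^ h) powr s * r powr (g / 2)) =
          ln (2 * (2 * K3) * real h * (12 * 2 ^ h) powr s) + ln (r powr (g / 2))"
        using h0 K3 r0 by (intro ln_mult_pos) auto
      moreover have "ln (2 * (2 * K3) * real h * (12 * 2 ^ h) powr s) = ln (2 * (2 * K3) * real h) + ln ((12 * 2 ^ h) powr s)"
        using h0 K3 by (intro ln_mult_pos) auto
      moreover have "ln (2 * (2 * K3) * real h) = ln (2 * (2 * K3)) + ln (real h)"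
        using h0 K3 by (intro ln_mult_pos) auto
      moreover have "ln (2 * (2 * K3)) = ln 2 + ln (2 * K3)" using K3 by (intro ln_mult_pos) auto
      moreover have "ln ((12 * 2 ^ h :: real) powr s) = s * ln (12 * 2 ^ h)" by simp
      moreover have "ln (12 * 2 ^ h :: real) = ln 12 + ln (2 ^ h)" by (rule ln_mult_pos) auto
      moreover have "ln (2 ^ h :: real) = real h * ln 2" by (simp add: ln_realpow)
      moreover have "ln (r powr (g / 2)) = g / 2 * ln r" by simp
      ultimately show ?thesis by simp
    qed
    also have "\<dots> \<le> c1 + c2 * real h + (g / 2) * (ln 2 - D / (g\<^sup>2 * k))"
    proof -
      have e1: "ln (real h) \<le> real h" using h0 by (intro less_imp_le[OF ln_less_self]) simp
      have e2: "(g / 2) * ln r \<le> (g / 2) * (ln 2 - D / (g\<^sup>2 * k))" using lnr_le g by (intro mult_left_mono) auto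
      have e3: "ln 2 + ln (2 * K3) + ln (real h) + s * (ln 12 + real h * ln 2) = c1 + (ln (real h) + s * ln 2 * real h)"
        unfolding c1_def by (simp add: algebra_simps)
      have e4: "c2 * real h = real h + s * ln 2 * real h" unfolding c2_def by (simp add: algebra_simps)
      show ?thesis unfolding e3 e4 by (intro add_mono order_refl e1 e2)
    qed
    also have "\<dots> \<le> c1 / g + c2 * ((4 * s + 1) / g) + 1 / g - D / (2 * g * k)"
    proof -
      have "c1 * g \<le> c1 * 1" using c g by (intro mult_left_mono) auto
      then have "c1 \<le> c1 / g" using g by (simp add: field_simps)
      moreover have "c2 * real h \<le> c2 * ((4 * s + 1) / g)" using hle c by (intro mult_left_mono) auto
      moreover have "(g / 2) * (ln 2 - D / (g\<^sup>2 * k)) = (g / 2) * ln 2 - D / (2 * g * k)"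
        using g k by (simp add: field_simps power2_eq_square)
      moreover have "(g / 2) * ln 2 \<le> 1 / g"
      proof -
        have "(g / 2) * ln 2 \<le> 1 * 1" using g ln2 by (intro mult_mono) auto
        also have "\<dots> \<le> 1 / g" using g by simp
        finally show ?thesis .
      qed
      ultimately show ?thesis by linarith
    qed
    also have "\<dots> = (c1 + c2 * (4 * s + 1) + 1 - D / (2 * k)) / g" using g k by (simp add: field_simps)
    also have "\<dots> = - 1 / g" unfolding D_def using k by simp
    also have "\<dots> < 0" using g by simp
    finally have "ln L < 0" .
    then have "L < 1" using L0 by simp
    then show "2 * (2 * real (nat \<lceil>4 * s / g\<rceil>) * ((4 * 6 powr s + 1)\<^sup>2 * 3 powr s)) * (12 * 2 ^ nat \<lceil>4 * s / g\<rceil>) powr s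
      * (2 * v powr (1 / k)) powr (g / 2) < 1" unfolding L_def h_def r_def K3_def .
  qed
qed

text \<open>The intervals are laid end to end. They are closed and share endpoints; an arbitrary
  choice there is harmless, since the scheme only uses that a parameter lies in the interval of its
  piece.\<close>

lemma interval_decomposition:
  fixes w :: "'b \<Rightarrow> real"
  assumes "finite J" "J \<noteq> {}" "\<And>m. m \<in> J \<Longrightarrow> 0 \<le> w m"
  shows "\<exists>l. \<forall>u\<in>{0..sum w J}. \<exists>m\<in>J. 0 \<le> l m \<and> l m \<le> u \<and> u \<le> l m + w m"
  using assms
proof (induction J rule: finite_ne_induct)
  case (singleton m)
  show ?case by (intro exI[of _ "\<lambda>_. 0"]) auto
next
  case (insert m J)
  then obtain l where l: "\<forall>u\<in>{0..sum w J}. \<exists>m\<in>J. 0 \<le> l m \<and> l m \<le> u \<and> u \<le> l m + w m" by auto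
  have s0: "0 \<le> sum w J" using insert.prems by (intro sum_nonneg) auto
  have "\<exists>m'\<in>insert m J. 0 \<le> (l(m := sum w J)) m' \<and> (l(m := sum w J)) m' \<le> u \<and> u \<le> (l(m := sum w J)) m' + w m'"
    if u: "u \<in> {0..sum w (insert m J)}" for u
  proof (cases "u \<le> sum w J")
    case True
    then have "u \<in> {0..sum w J}" using u by auto
    then obtain m' where "m' \<in> J" "0 \<le> l m' \<and> l m' \<le> u \<and> u \<le> l m' + w m'" using l by blast
    then show ?thesis using insert.hyps by (intro bexI[of _ m']) auto
  next
    case False
    then show ?thesis using u insert.hyps s0 by (intro bexI[of _ m]) auto
  qed
  then show ?case by blast
qed

text \<open>The codes \<open>\<alpha> m\<close> need not converge, and each coordinate is bounded
  only from some index on. So they are truncated into the compact product of the sets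
  \<open>{..b i}\<close>; a subsequence of the truncations converges, and in each fixed coordinate
  the truncation eventually changes nothing.\<close>

lemma limit_in_range:
  fixes g :: "(nat \<Rightarrow> nat) \<Rightarrow> 'a::t2_space"
  assumes g: "continuous_on UNIV g" and b: "\<And>m i. i < m \<Longrightarrow> \<alpha> m i \<le> b i"
    and lim: "(\<lambda>m. g (\<alpha> m)) \<longlonglongrightarrow> x"
  shows "x \<in> range g"
proof -
  define K where "K = PiE UNIV (\<lambda>i. {..b i})"
  have "compactin (product_topology (\<lambda>i. euclidean) UNIV) K"
    unfolding K_def compactin_PiE by (auto intro: finite_imp_compact)
  then have "compact K" by (simp add: euclidean_product_topology)
  then have sc: "seq_compact K" by (rule compact_imp_seq_compact)
  define \<beta> where "\<beta> m i = min (\<alpha> m i) (b i)" for m i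
  have "\<beta> m \<in> K" for m unfolding \<beta>_def K_def by auto
  then obtain l \<phi> where l: "strict_mono (\<phi> :: nat \<Rightarrow> nat)" "(\<beta> \<circ> \<phi>) \<longlonglongrightarrow> l"
    using seq_compactE[OF sc, of \<beta>] by metis
  have co: "(\<lambda>m. \<beta> (\<phi> m) i) \<longlonglongrightarrow> l i" for i
  proof -
    have "continuous_on UNIV (\<lambda>f::nat\<Rightarrow>nat. f i)" by (rule continuous_on_product_coordinates)
    from continuous_on_tendsto_compose[OF this l(2)] show ?thesis by simp
  qed
  have co': "(\<lambda>m. \<alpha> (\<phi> m) i) \<longlonglongrightarrow> l i" for i
  proof (rule Lim_transform_eventually[OF co])
    have "\<beta> (\<phi> m) i = \<alpha> (\<phi> m) i" if "Suc i \<le> m" for m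
      using b[of i "\<phi> m"] seq_suble[OF l(1), of m] that unfolding \<beta>_def by simp
    then show "\<forall>\<^sub>F m in sequentially. \<beta> (\<phi> m) i = \<alpha> (\<phi> m) i"
      unfolding eventually_sequentially by blast
  qed
  have "limitin (product_topology (\<lambda>i. euclidean) UNIV) (\<lambda>m. \<alpha> (\<phi> m)) l sequentially"
    unfolding limitin_componentwise using co' by auto
  then have "(\<lambda>m. \<alpha> (\<phi> m)) \<longlonglongrightarrow> l" by (simp add: euclidean_product_topology)
  from continuous_on_tendsto_compose[OF g this] have "(\<lambda>m. g (\<alpha> (\<phi> m))) \<longlonglongrightarrow> g l" by simp
  moreover have "(\<lambda>m. g (\<alpha> (\<phi> m))) \<longlonglongrightarrow> x" using LIMSEQ_subseq_LIMSEQ[OF lim l(1)] by (simp add: o_def)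
  ultimately have "x = g l" by (rule LIMSEQ_unique[symmetric])
  then show ?thesis by simp
qed

text \<open>The pieces of a node of cost \<open>v\<close> are indexed by the parameters \<open>u\<close> in \<open>[0,v]\<close>; the interval of length \<open>w u\<close> starting
at \<open>l u\<close> is the one attached to the piece containing \<open>u\<close>.\<close>

lemma branching:
  fixes X :: "'a::{metric_space, second_countable_topology} set" and c :: "'a \<Rightarrow> nat"
  assumes big: "\<not> cov q v X" and v: "0 < v" and k: "0 < k" "k \<le> q'" and q: "q' < q" "q \<le> s" "g = q - q'"
    and r: "2 * v powr (1 / k) \<le> 1"
    and small: "2 * (2 * real (nat \<lceil>4 * s / g\<rceil>) * ((4 * 6 powr s + 1)\<^sup>2 * 3 powr s)) *
      (12 * 2 ^ nat \<lceil>4 * s / g\<rceil>) powr s * (2 * v powr (1 / k)) powr (g / 2) < 1"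
  shows "\<exists>Y w l. (\<forall>u\<in>{0..v}. Y u \<subseteq> X \<and> 0 < w u \<and> w u \<le> v powr (q' / k) \<and> \<not> cov q' (w u) (Y u) \<and>
      (\<exists>b. \<forall>x\<in>Y u. c x \<le> b) \<and> (\<forall>x\<in>Y u. \<forall>y\<in>Y u. dist x y \<le> v powr (1 / s)) \<and>
      l u \<le> u \<and> u \<le> l u + w u) \<and>
    (\<forall>u\<in>{0..v}. \<forall>u'\<in>{0..v}. (Y u, w u, l u) = (Y u', w u', l u') \<or>
      (\<forall>x\<in>Y u. \<forall>y\<in>Y u'. v powr (1 / k) \<le> dist x y))"
proof -
  have g0: "0 < g" using q by simp
  have v1: "v \<le> 1"
  proof (rule ccontr)
    assume "\<not> v \<le> 1"
    then have "1 powr (1 / k) \<le> v powr (1 / k)" using k by (intro powr_mono2) auto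
    then show False using r by simp
  qed
  have h: "4 * s \<le> (q - q') * real (nat \<lceil>4 * s / g\<rceil>)"
  proof -
    have "4 * s / g \<le> real (nat \<lceil>4 * s / g\<rceil>)" by (rule real_nat_ceiling_ge)
    then show ?thesis using g0 unfolding q(3)[symmetric] by (simp add: field_simps)
  qed
  have X: "X \<subseteq> (\<Union>j. {x. c x = j})" by auto
  have small': "2 * (2 * real (nat \<lceil>4 * s / g\<rceil>) * ((4 * 6 powr s + 1)\<^sup>2 * 3 powr s)) *
      (12 * 2 ^ nat \<lceil>4 * s / g\<rceil>) powr s * (2 * v powr (1 / k)) powr ((q - q') / 2) < 1"
    using small by (simp only: q(3)[symmetric])
  obtain \<J> :: "(nat set \<times> nat set) set" and Y w where st: "finite \<J> \<and>
    (\<forall>m\<in>\<J>. Y m \<subseteq> X \<and> 0 < w m \<and> w m \<le> v powr (q' / k) \<and> \<not> cov q' (w m) (Y m) \<and>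
       (\<exists>b. Y m \<subseteq> (\<Union>j<b. {x. c x = j})) \<and> (\<forall>x\<in>Y m. \<forall>y\<in>Y m. dist x y \<le> v powr (1 / s))) \<and>
    (\<forall>m\<in>\<J>. \<forall>n\<in>\<J>. m \<noteq> n \<longrightarrow> (\<forall>x\<in>Y m. \<forall>y\<in>Y n. v powr (1 / k) \<le> dist x y)) \<and>
    (\<Sum>m\<in>\<J>. w m) = v"
    using stage[OF big X v v1 k q(1,2) h refl r refl small'] by (elim exE)
  note st1 = conjunct1[OF st] and st2 = bspec[OF conjunct1[OF conjunct2[OF st]]]
    and st3 = conjunct1[OF conjunct2[OF conjunct2[OF st]]] and st4 = conjunct2[OF conjunct2[OF conjunct2[OF st]]]
  have ne: "\<J> \<noteq> {}" using st4 v by auto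
  obtain l where l: "\<forall>u\<in>{0..sum w \<J>}. \<exists>m\<in>\<J>. 0 \<le> l m \<and> l m \<le> u \<and> u \<le> l m + w m"
    using interval_decomposition[OF st1 ne, of w] st2 by (meson less_imp_le)
  then have "\<forall>u\<in>{0..v}. \<exists>m. m \<in> \<J> \<and> l m \<le> u \<and> u \<le> l m + w m" unfolding st4 by blast
  then obtain m where m: "\<And>u. u \<in> {0..v} \<Longrightarrow> m u \<in> \<J>" "\<And>u. u \<in> {0..v} \<Longrightarrow> l (m u) \<le> u"
    "\<And>u. u \<in> {0..v} \<Longrightarrow> u \<le> l (m u) + w (m u)" by metis
  have bnd: "\<exists>b. \<forall>x\<in>Y j. c x \<le> b" if jJ: "j \<in> \<J>" for j
  proof -
    obtain b where "Y j \<subseteq> (\<Union>i<b. {x. c x = i})" using st2[OF jJ] by blast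
    then have "\<forall>x\<in>Y j. c x \<le> b" by auto
    then show ?thesis ..
  qed
  show ?thesis
  proof (rule exI[of _ "\<lambda>u. Y (m u)"], rule exI[of _ "\<lambda>u. w (m u)"], rule exI[of _ "\<lambda>u. l (m u)"],
      intro conjI ballI)
    fix u assume u: "u \<in> {0..v}"
    show "Y (m u) \<subseteq> X" "0 < w (m u)" "w (m u) \<le> v powr (q' / k)" "\<not> cov q' (w (m u)) (Y (m u))"
      using st2[OF m(1)[OF u]] by blast+
    show "\<exists>b. \<forall>x\<in>Y (m u). c x \<le> b" using bnd[OF m(1)[OF u]] .
  next
    fix u assume u: "u \<in> {0..v}"
    show "l (m u) \<le> u" "u \<le> l (m u) + w (m u)" using m u by auto
  next
    fix u x y assume u: "u \<in> {0..v}" and "x \<in> Y (m u)" "y \<in> Y (m u)"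
    then show "dist x y \<le> v powr (1 / s)" using st2[OF m(1)[OF u]] by blast
  next
    fix u u' assume u: "u \<in> {0..v}" and u': "u' \<in> {0..v}"
    show "(Y (m u), w (m u), l (m u)) = (Y (m u'), w (m u'), l (m u')) \<or>
      (\<forall>x\<in>Y (m u). \<forall>y\<in>Y (m u'). v powr (1 / k) \<le> dist x y)"
      using st3 m(1)[OF u] m(1)[OF u'] by (cases "m u = m u'") auto
  qed
qed

lemma expanding_map_from_interval:
  fixes A :: "'a::polish_space set" and f :: "(nat \<Rightarrow> nat) \<Rightarrow> 'a"
  assumes f: "continuous_on UNIV f" "range f = A" and k: "0 < k" "k < s"
    and big: "\<not> cov s \<kappa> A" and kap: "0 < \<kappa>"
  shows "\<exists>c>0. \<exists>x::real \<Rightarrow> 'a. (\<forall>t\<in>{0..1}. x t \<in> A) \<and>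
    (\<forall>t\<in>{0..1}. \<forall>t'\<in>{0..1}. c * \<bar>t - t'\<bar> \<le> dist (x t) (x t') powr k)"
proof -
  \<comment> \<open>At level \<open>n\<close> the exponent is \<open>q n\<close>, the drop to the next one is \<open>g n\<close>, and the cost is at most
    \<open>exp (- D / (g n)\<^sup>2)\<close>. A split raises costs to the power \<open>1 + c\<close>, so choosing \<open>\<theta>\<close> with \<open>\<theta>\<^sup>2 = 1 / (1 + c)\<close> as the ratio of
    the drops preserves this bound while the drops stay summable.\<close>
  define q\<^sub>0 where "q\<^sub>0 = (k + s) / 2"
  define c where "c = q\<^sub>0 / k - 1"
  define \<theta> where "\<theta> = 1 / sqrt (1 + c)"
  \<comment> \<open>\<open>\<sigma>\<close> is the sum of all powers of \<open>\<theta>\<close>, so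
    \<open>\<sigma> * g n\<close> is the total of the drops from level \<open>n\<close> on. Thus
    \<open>q n\<close> decreases towards \<open>q\<^sub>0 > k\<close>, and the choice of
    \<open>g\<^sub>0\<close> ensures \<open>q 0 \<le> s\<close>.\<close>
  define \<sigma> where "\<sigma> = 1 / (1 - \<theta>)"
  define g\<^sub>0 where "g\<^sub>0 = min 1 ((s - q\<^sub>0) / \<sigma>)"
  define g where "g n = g\<^sub>0 * \<theta> ^ n" for n :: nat
  define q where "q n = q\<^sub>0 + \<sigma> * g n" for n
  have s0: "0 < s" using k by simp
  have q0: "k < q\<^sub>0" "q\<^sub>0 < s" unfolding q\<^sub>0_def using k by auto
  have c0: "0 < c" unfolding c_def using q0 k by simp
  have th: "0 < \<theta>" "\<theta> < 1" "\<theta>\<^sup>2 = 1 / (1 + c)" unfolding \<theta>_def using c0 by (auto simp: power_divide)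
  have sg: "0 < \<sigma>" "\<sigma> * (1 - \<theta>) = 1" unfolding \<sigma>_def using th by auto
  have g00: "0 < g\<^sub>0" "g\<^sub>0 \<le> 1" "\<sigma> * g\<^sub>0 \<le> s - q\<^sub>0"
    unfolding g\<^sub>0_def using sg q0 by (auto simp: min_def field_simps)
  have g: "0 < g n" "g n \<le> g\<^sub>0" for n
    unfolding g_def using g00 th by (auto simp: mult_le_cancel_left1 power_le_one)
  have qdiff: "g n = q n - q (Suc n)" for n
  proof -
    have "q n - q (Suc n) = \<sigma> * (1 - \<theta>) * (g\<^sub>0 * \<theta> ^ n)" unfolding q_def g_def by (simp add: algebra_simps)
    then show ?thesis using sg unfolding g_def by simp
  qed
  have qs: "q n \<le> s" "k \<le> q n" "q\<^sub>0 \<le> q n" "0 < q n" for n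
  proof -
    have "\<sigma> * g n \<le> \<sigma> * g\<^sub>0" using g sg by (intro mult_left_mono) auto
    then show "q n \<le> s" unfolding q_def using g00 by simp
    show "q\<^sub>0 \<le> q n" unfolding q_def using g[of n] sg by simp
    then show "k \<le> q n" "0 < q n" using q0 k by auto
  qed
  obtain D where D: "0 < D" and par: "\<And>g v. 0 < g \<Longrightarrow> g \<le> 1 \<Longrightarrow> 0 < v \<Longrightarrow> v \<le> exp (- D / g\<^sup>2) \<Longrightarrow>
    2 * v powr (1 / k) \<le> 1 \<and>
    2 * (2 * real (nat \<lceil>4 * s / g\<rceil>) * ((4 * 6 powr s + 1)\<^sup>2 * 3 powr s)) * (12 * 2 ^ nat \<lceil>4 * s / g\<rceil>) powr s
      * (2 * v powr (1 / k)) powr (g / 2) < 1"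
    using stage_parameters[OF s0 k(1)] by blast
  define V where "V n = exp (- D / (g n)\<^sup>2)" for n
  define a where "a = D / g\<^sub>0\<^sup>2"
  have a0: "0 < a" unfolding a_def using D g00 by simp
  have Va: "V n = exp (- (a * (1 + c) ^ n))" for n
  proof -
    have "(\<theta> ^ n)\<^sup>2 = 1 / (1 + c) ^ n" using th(3) by (metis power_mult mult.commute power_one_over)
    then have "(g n)\<^sup>2 = g\<^sub>0\<^sup>2 / (1 + c) ^ n" unfolding g_def by (simp add: power_mult_distrib)
    then show ?thesis unfolding V_def a_def by simp
  qed
  have VS: "V (Suc n) = V n powr (1 + c)" for n
    unfolding Va powr_def by simp
  define r where "r = exp (- (a * c))"
  have r: "0 < r" "r < 1" unfolding r_def using a0 c0 by auto
  have Vr: "V n \<le> r ^ n" for n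
  proof -
    have "1 + real n * c \<le> (1 + c) ^ n" using c0 Bernoulli_inequality[of c n] by simp
    then have "real n * c \<le> (1 + c) ^ n" by simp
    then have "a * (real n * c) \<le> a * (1 + c) ^ n" using a0 by (intro mult_left_mono) auto
    then have "V n \<le> exp (real n * (- (a * c)))" unfolding Va by (simp add: ac_simps)
    also have "\<dots> = r ^ n" unfolding r_def by (rule exp_of_nat_mult)
    finally show ?thesis .
  qed
  \<comment> \<open>One code per point is fixed in advance. A bound on its \<open>n\<close>-th
    coordinate obtained when splitting at level \<open>n\<close> is then inherited by all later
    nodes, as these are subsets.\<close>
  have "\<forall>x. \<exists>\<alpha>. x \<in> A \<longrightarrow> f \<alpha> = x" using f(2) by (metis imageE)
  then obtain sx where sx: "\<And>x. x \<in> A \<Longrightarrow> f (sx x) = x" by metis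
  define Node where "Node n X v \<longleftrightarrow> X \<subseteq> A \<and> 0 < v \<and> v \<le> V n \<and> \<not> cov (q n) v X" for n X v
  define Br where "Br n X v Y w l \<longleftrightarrow>
    (\<forall>u\<in>{0..v}. Node (Suc n) (Y u) (w u) \<and> Y u \<subseteq> X \<and>
      (\<exists>b. \<forall>x\<in>Y u. sx x n \<le> b) \<and> (\<forall>x\<in>Y u. \<forall>y\<in>Y u. dist x y \<le> v powr (1 / s)) \<and>
      l u \<le> u \<and> u \<le> l u + w u) \<and>
    (\<forall>u\<in>{0..v}. \<forall>u'\<in>{0..v}. (Y u, w u, l u) = (Y u', w u', l u') \<or>
      (\<forall>x\<in>Y u. \<forall>y\<in>Y u'. v powr (1 / k) \<le> dist x y))"
    for n X v and Y :: "real \<Rightarrow> 'a set" and w l :: "real \<Rightarrow> real"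
  have ex: "\<exists>Y w l. Br n X v Y w l" if nd: "Node n X v" for n X v
  proof -
    have n: "X \<subseteq> A" "0 < v" "v \<le> V n" "\<not> cov (q n) v X" using nd unfolding Node_def by auto
    have g1: "g n \<le> 1" using g(2)[of n] g00 by linarith
    have V1: "V n \<le> 1" unfolding V_def using D g(1)[of n] by simp
    note pr = par[OF g(1) g1 n(2) n(3)[unfolded V_def]]
    have qlt: "q (Suc n) < q n" using qdiff[of n] g(1)[of n] by linarith
    obtain Y w l where b: "(\<forall>u\<in>{0..v}. Y u \<subseteq> X \<and> 0 < w u \<and> w u \<le> v powr (q (Suc n) / k) \<and> \<not> cov (q (Suc n)) (w u) (Y u) \<and>
      (\<exists>b. \<forall>x\<in>Y u. sx x n \<le> b) \<and> (\<forall>x\<in>Y u. \<forall>y\<in>Y u. dist x y \<le> v powr (1 / s)) \<and>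
      l u \<le> u \<and> u \<le> l u + w u) \<and>
      (\<forall>u\<in>{0..v}. \<forall>u'\<in>{0..v}. (Y u, w u, l u) = (Y u', w u', l u') \<or>
      (\<forall>x\<in>Y u. \<forall>y\<in>Y u'. v powr (1 / k) \<le> dist x y))"
      using branching[OF n(4) n(2) k(1) qs(2) qlt qs(1) qdiff[of n] conjunct1[OF pr] conjunct2[OF pr], of "\<lambda>x. sx x n"]
      by (elim exE)
    have wV: "w u \<le> V (Suc n)" if "u \<in> {0..v}" for u
    proof -
      have "w u \<le> v powr (q (Suc n) / k)" using bspec[OF conjunct1[OF b] that] by blast
      also have "\<dots> \<le> v powr (1 + c)"
        unfolding c_def using n V1 k qs(3)[of "Suc n"] by (intro powr_mono') (auto simp: divide_right_mono)
      also have "\<dots> \<le> V n powr (1 + c)" using n c0 by (intro powr_mono2) auto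
      finally show ?thesis unfolding VS .
    qed
    have "Br n X v Y w l"
      unfolding Br_def
    proof (intro conjI ballI conjunct2[OF b])
      fix u assume u: "u \<in> {0..v}"
      note bu = bspec[OF conjunct1[OF b] u]
      show "Node (Suc n) (Y u) (w u)" unfolding Node_def using bu wV[OF u] n(1) by blast
      show "Y u \<subseteq> X" "\<exists>b. \<forall>x\<in>Y u. sx x n \<le> b" "l u \<le> u" "u \<le> l u + w u" using bu by blast+
    next
      fix u x y assume u: "u \<in> {0..v}" and "x \<in> Y u" "y \<in> Y u"
      then show "dist x y \<le> v powr (1 / s)" using bspec[OF conjunct1[OF b] u] by blast
    next
      fix u u' assume "u \<in> {0..v}" "u' \<in> {0..v}"
      then show "(Y u, w u, l u) = (Y u', w u', l u') \<or> (\<forall>x\<in>Y u. \<forall>y\<in>Y u'. v powr (1 / k) \<le> dist x y)"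
        using conjunct2[OF b] by blast
    qed
    then show ?thesis by blast
  qed
  have "\<forall>n X v. \<exists>F. Node n X v \<longrightarrow> Br n X v (\<lambda>u. fst (F u)) (\<lambda>u. fst (snd (F u))) (\<lambda>u. snd (snd (F u)))"
  proof (intro allI)
    fix n X v
    show "\<exists>F. Node n X v \<longrightarrow> Br n X v (\<lambda>u. fst (F u)) (\<lambda>u. fst (snd (F u))) (\<lambda>u. snd (snd (F u)))"
    proof (cases "Node n X v")
      case True
      then obtain Y w l where "Br n X v Y w l" using ex by blast
      then show ?thesis by (intro exI[of _ "\<lambda>u. (Y u, w u, l u)"]) simp
    qed simp
  qed
  then obtain F where F: "\<And>n X v. Node n X v \<Longrightarrow>
      Br n X v (\<lambda>u. fst (F n X v u)) (\<lambda>u. fst (snd (F n X v u))) (\<lambda>u. snd (snd (F n X v u)))" by metis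
  define v0 where "v0 = min \<kappa> (V 0)"
  have v0: "0 < v0" "v0 \<le> V 0" "v0 \<le> \<kappa>" unfolding v0_def using kap by (auto simp: V_def)
  have V01: "V 0 \<le> 1" unfolding V_def using D g(1)[of 0] by simp
  have Node0: "Node 0 A v0"
    unfolding Node_def
  proof (intro conjI v0 subset_refl notI)
    assume "cov (q 0) v0 A"
    then have "cov s v0 A" using cov_exponent_mono[of "q 0" v0 A s] v0 V01 qs[of 0] by auto
    then show False using big cov_mono v0(3) by blast
  qed
  \<comment> \<open>The state of \<open>t\<close> consists of its node, the length of the attached
    interval and its left endpoint; \<open>F\<close> is applied to the offset of \<open>t\<close> in
    that interval. As \<open>F\<close> is fixed once for each node, parameters with equal states are
    compared within the same branching.\<close>
  define st where "st t = rec_nat (A, v0, 0) (\<lambda>n S. (fst (F n (fst S) (fst (snd S)) (t - snd (snd S))),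
      fst (snd (F n (fst S) (fst (snd S)) (t - snd (snd S)))),
      snd (snd S) + snd (snd (F n (fst S) (fst (snd S)) (t - snd (snd S))))))" for t :: real
  define X where "X t n = fst (st t n)" for t n
  define v where "v t n = fst (snd (st t n))" for t n
  define l where "l t n = snd (snd (st t n))" for t n
  define G where "G t n = F n (X t n) (v t n) (t - l t n)" for t n
  have st0: "X t 0 = A" "v t 0 = v0" "l t 0 = 0" for t unfolding X_def v_def l_def st_def by simp_all
  have stS: "X t (Suc n) = fst (G t n)" "v t (Suc n) = fst (snd (G t n))" "l t (Suc n) = l t n + snd (snd (G t n))" for t n
    unfolding G_def unfolding X_def v_def l_def st_def by simp_all
  have inv: "Node n (X t n) (v t n) \<and> l t n \<le> t \<and> t \<le> l t n + v t n" if t: "t \<in> {0..v0}" for t n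
  proof (induction n)
    case 0 then show ?case using st0 Node0 t by simp
  next
    case (Suc n)
    then have "Br n (X t n) (v t n) (\<lambda>u. fst (F n (X t n) (v t n) u)) (\<lambda>u. fst (snd (F n (X t n) (v t n) u)))
       (\<lambda>u. snd (snd (F n (X t n) (v t n) u)))" and u: "t - l t n \<in> {0..v t n}" using F by auto
    then have "Node (Suc n) (fst (G t n)) (fst (snd (G t n))) \<and> snd (snd (G t n)) \<le> t - l t n \<and>
        t - l t n \<le> snd (snd (G t n)) + fst (snd (G t n))"
      unfolding Br_def G_def by blast
    then show ?case unfolding stS by simp
  qed
  have Nd: "Node n (X t n) (v t n)" and lt: "l t n \<le> t" "t \<le> l t n + v t n" and u: "t - l t n \<in> {0..v t n}"
    if "t \<in> {0..v0}" for t n using inv[OF that, of n] by auto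
  have BrX: "X t (Suc n) \<subseteq> X t n" "\<exists>b. \<forall>x\<in>X t (Suc n). sx x n \<le> b"
    "\<And>x y. x \<in> X t (Suc n) \<Longrightarrow> y \<in> X t (Suc n) \<Longrightarrow> dist x y \<le> v t n powr (1 / s)" if t: "t \<in> {0..v0}" for t n
    using bspec[OF conjunct1[OF F[OF Nd[OF t, of n], unfolded Br_def]] u[OF t, of n]]
    unfolding stS G_def by blast+
  have anti: "X t n \<subseteq> X t m" if "t \<in> {0..v0}" "m \<le> n" for t m n
    using lift_Suc_antimono_le[of "X t" m n] BrX(1)[OF that(1)] that(2) by blast
  have vr: "0 < v t n" "v t n \<le> r ^ n" if "t \<in> {0..v0}" for t n
    using Nd[OF that, of n] Vr[of n] unfolding Node_def by auto
  have ne: "X t n \<noteq> {}" if "t \<in> {0..v0}" for t n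
    using Nd[OF that, of n] cov_empty[of "v t n" "q n"] unfolding Node_def by auto
  define z where "z t n = (SOME x. x \<in> X t n)" for t n
  have z: "z t n \<in> X t n" if "t \<in> {0..v0}" for t n
    unfolding z_def using ne[OF that] by (simp add: some_in_eq)
  have zA: "z t n \<in> A" if "t \<in> {0..v0}" for t n using z[OF that] anti[OF that, of 0 n] st0 by auto
  define \<rho> where "\<rho> = r powr (1 / s)"
  have rho: "0 \<le> \<rho>" "\<rho> < 1" unfolding \<rho>_def using r s0 powr_less_mono2[of "1 / s" r 1] by auto
  have dz: "dist (z t m) (z t n) \<le> \<rho> ^ N" if t: "t \<in> {0..v0}" and mn: "N < m" "N < n" for t m n N
  proof -
    have "z t m \<in> X t (Suc N)" "z t n \<in> X t (Suc N)" using z[OF t] anti[OF t] mn by (meson Suc_leI subsetD)+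
    then have "dist (z t m) (z t n) \<le> v t N powr (1 / s)" using BrX(3)[OF t] by blast
    also have "\<dots> \<le> (r ^ N) powr (1 / s)" using vr[OF t, of N] s0 by (intro powr_mono2) auto
    also have "\<dots> = \<rho> ^ N" unfolding \<rho>_def using r by (simp add: powr_realpow[symmetric] powr_powr mult.commute)
    finally show ?thesis .
  qed
  have Cau: "Cauchy (z t)" if t: "t \<in> {0..v0}" for t
  proof (rule metric_CauchyI)
    fix e :: real assume "0 < e"
    then obtain N where N: "\<rho> ^ N < e" using real_arch_pow_inv[of e \<rho>] rho by auto
    show "\<exists>M. \<forall>m\<ge>M. \<forall>n\<ge>M. dist (z t m) (z t n) < e"
      using dz[OF t, of N] N by (intro exI[of _ "Suc N"]) (auto simp: Suc_le_eq intro: le_less_trans)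
  qed
  define x where "x t = lim (z t)" for t
  have zx: "z t \<longlonglongrightarrow> x t" if "t \<in> {0..v0}" for t
    unfolding x_def using Cauchy_convergent[OF Cau[OF that]] by (simp add: convergent_LIMSEQ_iff)
  have xA: "x t \<in> A" if t: "t \<in> {0..v0}" for t
  proof -
    have "\<forall>n. \<exists>b. \<forall>x\<in>X t (Suc n). sx x n \<le> b" using BrX(2)[OF t] by blast
    then obtain b where b: "\<And>n x. x \<in> X t (Suc n) \<Longrightarrow> sx x n \<le> b n" by metis
    have "x t \<in> range f"
    proof (rule limit_in_range[OF f(1)])
      show "sx (z t m) i \<le> b i" if "i < m" for m i
        using b[of "z t m" i] z[OF t, of m] anti[OF t, of "Suc i" m] that by auto
      show "(\<lambda>m. f (sx (z t m))) \<longlonglongrightarrow> x t" using zx[OF t] sx[OF zA[OF t]] by simp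
    qed
    then show ?thesis using f(2) by simp
  qed
  have expand: "\<bar>t - t'\<bar> \<le> dist (x t) (x t') powr k" if t: "t \<in> {0..v0}" and t': "t' \<in> {0..v0}" for t t'
  proof (cases "\<forall>n. st t n = st t' n")
    case True
    \<comment> \<open>Equal states at all levels put both parameters into common intervals of length
      tending to 0, so they coincide.\<close>
    have le: "\<bar>t - t'\<bar> \<le> r ^ n" for n
    proof -
      have "l t n = l t' n" "v t n = v t' n" using True unfolding l_def v_def by auto
      then have "\<bar>t - t'\<bar> \<le> v t n" using lt[OF t, of n] lt[OF t', of n] by linarith
      then show ?thesis using vr[OF t, of n] by linarith
    qed
    have "(\<lambda>n. r ^ n) \<longlonglongrightarrow> 0" using r by (intro LIMSEQ_realpow_zero) auto
    then have "\<bar>t - t'\<bar> \<le> 0" using le by (intro LIMSEQ_le_const) auto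
    then show ?thesis using powr_ge_zero[of "dist (x t) (x t')" k] by linarith
  next
    case False
    \<comment> \<open>At the first level where the states differ, two different branches leave a
      common node. The pieces are separated by \<open>v powr (1 / k)\<close>, while both parameters
      lie in the node's interval of length \<open>v\<close>.\<close>
    define m where "m = (LEAST n. st t n \<noteq> st t' n)"
    have m: "st t m \<noteq> st t' m" unfolding m_def using False by (metis (mono_tags, lifting) LeastI)
    have "m \<noteq> 0" using m unfolding st_def by (intro notI) simp
    then obtain n where n: "m = Suc n" using not0_implies_Suc by blast
    have eq: "st t n = st t' n" using not_less_Least[of n "\<lambda>n. st t n \<noteq> st t' n"] n unfolding m_def by auto
    then have eqs: "X t' n = X t n" "v t' n = v t n" "l t' n = l t n" unfolding X_def v_def l_def by auto
    have Gne: "G t n \<noteq> G t' n"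
    proof
      assume "G t n = G t' n"
      then have "X t m = X t' m" "v t m = v t' m" "l t m = l t' m" unfolding n stS eqs by auto
      then have "st t m = st t' m" unfolding X_def v_def l_def by (simp add: prod_eq_iff)
      then show False using m by simp
    qed
    have u': "t' - l t n \<in> {0..v t n}" using u[OF t', of n] unfolding eqs .
    have "\<forall>y\<in>fst (G t n). \<forall>y'\<in>fst (G t' n). v t n powr (1 / k) \<le> dist y y'"
      using bspec[OF bspec[OF conjunct2[OF F[OF Nd[OF t, of n], unfolded Br_def]] u[OF t, of n]] u'] Gne
      unfolding G_def eqs by (auto simp: prod_eq_iff)
    then have sep: "v t n powr (1 / k) \<le> dist y y'" if "y \<in> X t m" "y' \<in> X t' m" for y y'
      using that unfolding n stS by blast
    have "v t n powr (1 / k) \<le> dist (x t) (x t')"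
    proof (rule LIMSEQ_le_const)
      show "(\<lambda>i. dist (z t i) (z t' i)) \<longlonglongrightarrow> dist (x t) (x t')" using zx[OF t] zx[OF t'] by (rule tendsto_dist)
      show "\<exists>N. \<forall>i\<ge>N. v t n powr (1 / k) \<le> dist (z t i) (z t' i)"
        using sep z[OF t] z[OF t'] anti[OF t] anti[OF t'] by (meson subsetD)
    qed
    then have "(v t n powr (1 / k)) powr k \<le> dist (x t) (x t') powr k" using k by (intro powr_mono2) auto
    then have "v t n \<le> dist (x t) (x t') powr k" using vr[OF t, of n] k by (simp add: powr_powr)
    moreover have "\<bar>t - t'\<bar> \<le> v t n" using lt[OF t, of n] lt[OF t', of n] unfolding eqs by linarith
    ultimately show ?thesis by linarith
  qed
  show ?thesis
  proof (intro exI[of _ v0] exI[of _ "\<lambda>t. x (v0 * t)"] conjI ballI)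
    show "0 < v0" by (rule v0)
    have mem: "v0 * t \<in> {0..v0}" if "t \<in> {0..1}" for t using that v0 by (auto simp: mult_le_cancel_left1)
    show "x (v0 * t) \<in> A" if "t \<in> {0..1}" for t using xA mem that by blast
    show "v0 * \<bar>t - t'\<bar> \<le> dist (x (v0 * t)) (x (v0 * t')) powr k" if "t \<in> {0..1}" "t' \<in> {0..1}" for t t'
      using expand[OF mem[OF that(1)] mem[OF that(2)]] v0
      by (simp add: abs_mult[of v0, symmetric] right_diff_distrib[symmetric] flip: abs_of_pos)
  qed
qed

subsection \<open>From the interval to the cube\<close>

text \<open>Digits stop at \<open>B - 2\<close> instead of \<open>B - 1\<close>: the tails after the
  first difference, at position \<open>j\<close>, then differ by at most
  \<open>1 / B ^ Suc j\<close>, whereas digits that are 2 apart contribute at least twice that. So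
  no carrying can bring the sums together.\<close>

lemma gap_digit_series:
  fixes B :: real and d d' :: "nat \<Rightarrow> real"
  assumes B: "2 \<le> B" and d: "\<And>m. 0 \<le> d m \<and> d m \<le> B - 2" and d': "\<And>m. 0 \<le> d' m \<and> d' m \<le> B - 2"
  shows "summable (\<lambda>m. d m / B ^ Suc m)" "0 \<le> (\<Sum>m. d m / B ^ Suc m)" "(\<Sum>m. d m / B ^ Suc m) \<le> 1"
    and "\<And>j. (\<And>m. m < j \<Longrightarrow> d m = d' m) \<Longrightarrow> 2 \<le> \<bar>d j - d' j\<bar> \<Longrightarrow>
      1 / B ^ Suc j \<le> \<bar>(\<Sum>m. d m / B ^ Suc m) - (\<Sum>m. d' m / B ^ Suc m)\<bar>"
proof -
  have geo: "(\<lambda>m. (B - 2) / B ^ (m + j)) sums ((B - 2) / B ^ j * (B / (B - 1)))" for j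
  proof -
    have "(\<lambda>m. (1 / B) ^ m) sums (1 / (1 - 1 / B))" using B by (intro geometric_sums) auto
    moreover have "1 / (1 - 1 / B) = B / (B - 1)" using B by (simp add: field_simps)
    ultimately have "(\<lambda>m. (B - 2) / B ^ j * (1 / B) ^ m) sums ((B - 2) / B ^ j * (B / (B - 1)))"
      using sums_mult[of "\<lambda>m. (1 / B) ^ m" "B / (B - 1)" "(B - 2) / B ^ j"] by simp
    then show ?thesis by (simp add: power_add power_one_over mult.commute divide_inverse power_inverse mult.left_commute)
  qed
  have geo_le: "(B - 2) / B ^ Suc j * (B / (B - 1)) \<le> 1 / B ^ j" for j
    using B by (simp add: field_simps)
  have sm: "summable (\<lambda>m. e m / B ^ Suc m)" if e: "\<And>m. 0 \<le> e m \<and> e m \<le> B - 2" for e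
  proof (rule summable_comparison_test')
    show "summable (\<lambda>m. (B - 2) / B ^ (m + 1))" using geo[of 1] sums_summable by blast
    show "norm (e m / B ^ Suc m) \<le> (B - 2) / B ^ (m + 1)" if "m \<ge> 0" for m
      using e[of m] B by (simp add: divide_right_mono)
  qed
  show s: "summable (\<lambda>m. d m / B ^ Suc m)" by (rule sm[OF d])
  have s': "summable (\<lambda>m. d' m / B ^ Suc m)" by (rule sm[OF d'])
  show "0 \<le> (\<Sum>m. d m / B ^ Suc m)" using d B by (intro suminf_nonneg s) auto
  have "(\<Sum>m. d m / B ^ Suc m) \<le> (\<Sum>m. (B - 2) / B ^ (m + 1))"
    using d B by (intro suminf_le s sums_summable[OF geo]) (auto intro: divide_right_mono)
  also have "\<dots> = (B - 2) / B ^ 1 * (B / (B - 1))" using geo[of 1] by (rule sums_unique[symmetric])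
  also have "\<dots> \<le> 1" using geo_le[of 0] by simp
  finally show "(\<Sum>m. d m / B ^ Suc m) \<le> 1" .
  fix j assume eq: "\<And>m. m < j \<Longrightarrow> d m = d' m" and ne: "2 \<le> \<bar>d j - d' j\<bar>"
  define e where "e m = d m / B ^ Suc m - d' m / B ^ Suc m" for m
  have se: "summable e" unfolding e_def by (rule summable_diff[OF s s'])
  have "(\<Sum>m. d m / B ^ Suc m) - (\<Sum>m. d' m / B ^ Suc m) = suminf e"
    unfolding e_def by (rule suminf_diff[OF s s'])
  also have "\<dots> = (\<Sum>m. e (m + Suc j)) + sum e {..<Suc j}" by (rule suminf_split_initial_segment[OF se])
  also have "sum e {..<Suc j} = e j" using eq by (simp add: e_def)
  finally have split: "(\<Sum>m. d m / B ^ Suc m) - (\<Sum>m. d' m / B ^ Suc m) = (\<Sum>m. e (m + Suc j)) + e j" .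
  have ebd: "norm (e (m + Suc j)) \<le> (B - 2) / B ^ (m + Suc (Suc j))" for m
  proof -
    have "\<bar>d (m + Suc j) - d' (m + Suc j)\<bar> \<le> B - 2" using d[of "m + Suc j"] d'[of "m + Suc j"] by linarith
    moreover have "norm (e (m + Suc j)) = \<bar>d (m + Suc j) - d' (m + Suc j)\<bar> / B ^ (m + Suc (Suc j))"
      unfolding e_def using B by (simp add: diff_divide_distrib[symmetric])
    ultimately show ?thesis using B by (simp add: divide_right_mono)
  qed
  have "norm (\<Sum>m. e (m + Suc j)) \<le> (\<Sum>m. (B - 2) / B ^ (m + Suc (Suc j)))"
    by (rule norm_suminf_le[OF ebd sums_summable[OF geo]])
  also have "\<dots> = (B - 2) / B ^ Suc (Suc j) * (B / (B - 1))" using geo by (rule sums_unique[symmetric])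
  also have "\<dots> \<le> 1 / B ^ Suc j" by (rule geo_le)
  finally have tail: "\<bar>\<Sum>m. e (m + Suc j)\<bar> \<le> 1 / B ^ Suc j" by simp
  have "\<bar>e j\<bar> = \<bar>d j - d' j\<bar> / B ^ Suc j" unfolding e_def using B by (simp add: diff_divide_distrib[symmetric])
  moreover have "2 / B ^ Suc j \<le> \<bar>d j - d' j\<bar> / B ^ Suc j" using ne B by (intro divide_right_mono) auto
  ultimately have "2 * (1 / B ^ Suc j) \<le> \<bar>e j\<bar>" by simp
  then show "1 / B ^ Suc j \<le> \<bar>(\<Sum>m. d m / B ^ Suc m) - (\<Sum>m. d' m / B ^ Suc m)\<bar>"
    unfolding split using tail by linarith
qed

lemma cube_to_interval:
  assumes k: "real CARD('n::finite) < k"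
  shows "\<exists>(\<tau> :: real ^ 'n \<Rightarrow> real) C. 0 < C \<and> (\<forall>z\<in>{x. \<forall>i. 0 \<le> x $ i \<and> x $ i \<le> 1}. \<tau> z \<in> {0..1}) \<and>
    (\<forall>z\<in>{x. \<forall>i. 0 \<le> x $ i \<and> x $ i \<le> 1}. \<forall>z'\<in>{x. \<forall>i. 0 \<le> x $ i \<and> x $ i \<le> 1}.
      \<forall>i. \<bar>z $ i - z' $ i\<bar> powr k \<le> C * \<bar>\<tau> z - \<tau> z'\<bar>)"
proof -
  define Q where "Q = {x :: real ^ 'n. \<forall>i. 0 \<le> x $ i \<and> x $ i \<le> 1}"
  define n where "n = CARD('n)"
  have n: "real n < k" unfolding n_def by (rule k)
  have k0: "0 < k" using n of_nat_0_le_iff[of n] by linarith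
  \<comment> \<open>The first \<open>j\<close> base-\<open>N\<close> digits of all \<open>n\<close> coordinates are coded by \<open>j\<close> even digits in base \<open>2 N\<^sup>n\<close>, and \<open>N\<close> is so large that
    this base is at most \<open>N powr k\<close>.\<close>
  define N where "N = nat \<lceil>2 powr (1 / (k - real n))\<rceil> + 2"
  have N2: "2 \<le> N" unfolding N_def by simp
  have Npow: "2 * real N ^ n \<le> real N powr k"
  proof -
    have "2 powr (1 / (k - real n)) \<le> real N" 
      using real_nat_ceiling_ge[of "2 powr (1 / (k - real n))"] unfolding N_def of_nat_add by linarith
    then have "(2 powr (1 / (k - real n))) powr (k - real n) \<le> real N powr (k - real n)"
      using n by (intro powr_mono2) auto
    then have "2 \<le> real N powr (k - real n)" using n by (simp add: powr_powr)
    then have "2 * real N powr real n \<le> real N powr (k - real n) * real N powr real n" by (intro mult_right_mono) auto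
    also have "\<dots> = real N powr k" by (simp only: powr_add[symmetric]) simp
    finally show ?thesis using N2 by (simp add: powr_realpow)
  qed
  define B where "B = 2 * real N ^ n"
  have B2: "2 \<le> B" unfolding B_def using N2 by (simp add: one_le_power)
  \<comment> \<open>Halving the coordinates makes the integer part vanish also for the coordinate 1.\<close>
  define fl where "fl m z i = \<lfloor>real N ^ m * (z $ i / 2)\<rfloor>" for m :: nat and z :: "real ^ 'n" and i
  define dg where "dg m z i = nat (fl (Suc m) z i mod int N)" for m and z :: "real ^ 'n" and i
  have flS: "fl (Suc m) z i = int N * fl m z i + int (dg m z i)" for m z i
  proof -
    have "fl m z i = \<lfloor>(real N ^ Suc m * (z $ i / 2)) / real_of_int (int N)\<rfloor>" unfolding fl_def using N2 by simp
    also have "\<dots> = fl (Suc m) z i div int N" unfolding fl_def by (rule floor_divide_real_eq_div) simp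
    finally have "fl m z i = fl (Suc m) z i div int N" .
    then show ?thesis unfolding dg_def using N2 by simp
  qed
  have fl0: "fl 0 z i = 0" if "z \<in> Q" for z i
    using that unfolding Q_def fl_def by (auto simp: floor_eq_iff intro: order_le_less_trans[of _ 1])
  define S where "S = (UNIV :: 'n set) \<rightarrow>\<^sub>E {..<N}"
  have S: "finite S" "card S = N ^ n" unfolding S_def n_def by (auto simp: finite_PiE card_funcsetE)
  obtain enc where enc: "bij_betw enc S {0..<N ^ n}" using ex_bij_betw_finite_nat[OF S(1)] S(2) by auto
  have dgS: "dg m z \<in> S" for m z
    unfolding S_def dg_def using N2 by (auto simp: nat_less_iff)
  define d where "d z m = 2 * real (enc (dg m z))" for z m
  have d: "0 \<le> d z m \<and> d z m \<le> B - 2" for z m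
  proof -
    have "enc (dg m z) \<in> {0..<N ^ n}" using bij_betwE[OF enc] dgS by blast
    then have "real (enc (dg m z) + 1) \<le> real (N ^ n)" by (intro of_nat_mono) simp
    then show ?thesis unfolding d_def B_def by simp
  qed
  define \<tau> where "\<tau> z = (\<Sum>m. d z m / B ^ Suc m)" for z
  have close: "\<bar>z $ i - z' $ i\<bar> \<le> 2 / real N ^ j"
    if z: "z \<in> Q" "z' \<in> Q" and eq: "\<And>m. m < j \<Longrightarrow> d z m = d z' m" for z z' j i
  proof -
    have dgeq: "dg m z = dg m z'" if "m < j" for m
    proof -
      have "enc (dg m z) = enc (dg m z')" using eq[OF that] unfolding d_def by simp
      then show ?thesis using enc dgS unfolding bij_betw_def inj_on_def by blast
    qed
    have "fl m z i = fl m z' i" if "m \<le> j" for m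
      using that
    proof (induction m)
      case 0 then show ?case using fl0 z by simp
    next
      case (Suc m) then show ?case unfolding flS using dgeq[of m] by simp
    qed
    then have "\<lfloor>real N ^ j * (z $ i / 2)\<rfloor> = \<lfloor>real N ^ j * (z' $ i / 2)\<rfloor>" unfolding fl_def by simp
    then have "\<bar>real N ^ j * (z $ i / 2) - real N ^ j * (z' $ i / 2)\<bar> \<le> 1" by linarith
    then have "real N ^ j * \<bar>z $ i - z' $ i\<bar> \<le> 2"
      using N2 by (simp add: right_diff_distrib[symmetric] abs_mult diff_divide_distrib[symmetric])
    then show ?thesis using N2 by (simp add: field_simps)
  qed
  \<comment> \<open>\<open>2 powr k\<close> undoes the halving of the coordinates, and
    \<open>B\<close> accounts for the step from \<open>j\<close> to \<open>Suc j\<close>.\<close>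
  define C where "C = 2 powr k * B"
  have C: "0 < C" unfolding C_def using B2 by simp
  have main: "\<bar>z $ i - z' $ i\<bar> powr k \<le> C * \<bar>\<tau> z - \<tau> z'\<bar>" if z: "z \<in> Q" "z' \<in> Q" for z z' i
  proof (cases "\<forall>m. d z m = d z' m")
    case True
    have le: "\<bar>z $ i - z' $ i\<bar> \<le> 2 * (1 / real N) ^ j" for j
      using close[OF z, of j i] True by (simp add: power_one_over)
    have "(\<lambda>j. 2 * (1 / real N) ^ j) \<longlonglongrightarrow> 2 * 0"
      using N2 by (intro tendsto_mult tendsto_const LIMSEQ_realpow_zero) auto
    then have "\<bar>z $ i - z' $ i\<bar> \<le> 2 * 0" by (rule LIMSEQ_le_const) (use le in blast)
    then show ?thesis using C by simp
  next
    case False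
    define j where "j = (LEAST m. d z m \<noteq> d z' m)"
    have j: "d z j \<noteq> d z' j" unfolding j_def using False by (metis (mono_tags, lifting) LeastI)
    have eq: "d z m = d z' m" if "m < j" for m using not_less_Least that unfolding j_def by blast
    have "enc (dg j z) \<noteq> enc (dg j z')" using j unfolding d_def by auto
    then have ge2: "2 \<le> \<bar>d z j - d z' j\<bar>" unfolding d_def by linarith
    have gap: "1 / B ^ Suc j \<le> \<bar>\<tau> z - \<tau> z'\<bar>"
      unfolding \<tau>_def by (rule gap_digit_series(4)[where d = "d z" and d' = "d z'", OF B2 d d eq ge2])
    have "\<bar>z $ i - z' $ i\<bar> powr k \<le> (2 / real N ^ j) powr k"
      using close[OF z eq] k0 by (intro powr_mono2) auto
    also have "\<dots> = 2 powr k / (real N powr k) ^ j"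
      using N2 by (simp add: powr_divide powr_realpow[symmetric] powr_powr mult.commute)
    also have "\<dots> \<le> 2 powr k / B ^ j"
      using Npow B2 N2 unfolding B_def[symmetric] by (intro divide_left_mono power_mono mult_pos_pos) auto
    also have "\<dots> = C * (1 / B ^ Suc j)" unfolding C_def using B2 by simp
    also have "\<dots> \<le> C * \<bar>\<tau> z - \<tau> z'\<bar>" using gap C by (intro mult_left_mono) auto
    finally show ?thesis .
  qed
  have "\<tau> z \<in> {0..1}" for z
    unfolding \<tau>_def using gap_digit_series(2,3)[where d = "d z" and d' = "d z", OF B2 d d] by simp
  then show ?thesis using C main unfolding Q_def by blast
qed

text \<open>The intermediate exponent \<open>k\<close> cancels: the \<open>k\<close>-th power of a
  coordinate difference is at most a multiple of the parameter difference, which is at most a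
  multiple of the \<open>k\<close>-th power of the distance in \<open>A\<close>. A
  \<open>k\<close>-th root leaves a linear bound.\<close>

lemma expanding_map_from_cube:
  fixes A :: "'a::polish_space set" and f :: "(nat \<Rightarrow> nat) \<Rightarrow> 'a"
  assumes f: "continuous_on UNIV f" "range f = A" and s: "real CARD('n::finite) < s"
    and big: "\<not> cov s \<kappa> A" and kap: "0 < \<kappa>"
  shows "\<exists>c>0. \<exists>y::real ^ 'n \<Rightarrow> 'a. (\<forall>z\<in>{x. \<forall>i. 0 \<le> x $ i \<and> x $ i \<le> 1}. y z \<in> A) \<and>
    (\<forall>z\<in>{x. \<forall>i. 0 \<le> x $ i \<and> x $ i \<le> 1}. \<forall>z'\<in>{x. \<forall>i. 0 \<le> x $ i \<and> x $ i \<le> 1}.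
      \<forall>i. c * \<bar>z $ i - z' $ i\<bar> \<le> dist (y z) (y z'))"
proof -
  define Q where "Q = {x :: real ^ 'n. \<forall>i. 0 \<le> x $ i \<and> x $ i \<le> 1}"
  define k where "k = (real CARD('n) + s) / 2"
  have k: "real CARD('n) < k" "k < s" "0 < k" unfolding k_def using s by auto
  obtain a x where a: "0 < a" and x: "\<And>t. t \<in> {0..1} \<Longrightarrow> x t \<in> A"
    "\<And>t t'. t \<in> {0..1} \<Longrightarrow> t' \<in> {0..1} \<Longrightarrow> a * \<bar>t - t'\<bar> \<le> dist (x t) (x t') powr k"
    using expanding_map_from_interval[OF f k(3,2) big kap] by blast
  obtain \<tau> :: "real ^ 'n \<Rightarrow> real" and C where C: "0 < C" and \<tau>: "\<And>z. z \<in> Q \<Longrightarrow> \<tau> z \<in> {0..1}"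
    "\<And>z z' i. z \<in> Q \<Longrightarrow> z' \<in> Q \<Longrightarrow> \<bar>z $ i - z' $ i\<bar> powr k \<le> C * \<bar>\<tau> z - \<tau> z'\<bar>"
    using cube_to_interval[OF k(1)] unfolding Q_def by blast
  have "(a / C) powr (1 / k) * \<bar>z $ i - z' $ i\<bar> \<le> dist (x (\<tau> z)) (x (\<tau> z'))" if z: "z \<in> Q" "z' \<in> Q" for z z' i
  proof -
    have "a * \<bar>z $ i - z' $ i\<bar> powr k \<le> a * (C * \<bar>\<tau> z - \<tau> z'\<bar>)" using \<tau>(2)[OF z] a by (intro mult_left_mono) auto
    also have "\<dots> = C * (a * \<bar>\<tau> z - \<tau> z'\<bar>)" by simp
    also have "\<dots> \<le> C * dist (x (\<tau> z)) (x (\<tau> z')) powr k"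
      using x(2)[OF \<tau>(1)[OF z(1)] \<tau>(1)[OF z(2)]] C by (intro mult_left_mono) auto
    finally have "a / C * \<bar>z $ i - z' $ i\<bar> powr k \<le> dist (x (\<tau> z)) (x (\<tau> z')) powr k" using C by (simp add: field_simps)
    then have "(a / C * \<bar>z $ i - z' $ i\<bar> powr k) powr (1 / k) \<le> (dist (x (\<tau> z)) (x (\<tau> z')) powr k) powr (1 / k)"
      using a C k by (intro powr_mono2) auto
    moreover have "(a / C * \<bar>z $ i - z' $ i\<bar> powr k) powr (1 / k) = (a / C) powr (1 / k) * \<bar>z $ i - z' $ i\<bar>"
      using a C k by (subst powr_mult) (auto simp: powr_powr)
    moreover have "(dist (x (\<tau> z)) (x (\<tau> z')) powr k) powr (1 / k) = dist (x (\<tau> z)) (x (\<tau> z'))"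
      using k by (simp add: powr_powr)
    ultimately show ?thesis by simp
  qed
  moreover have "x (\<tau> z) \<in> A" if "z \<in> Q" for z using x(1) \<tau>(1)[OF that] by blast
  ultimately show ?thesis
    unfolding Q_def[symmetric] using a C
    by (intro exI[of _ "(a / C) powr (1 / k)"] conjI exI[of _ "\<lambda>z. x (\<tau> z)"]) auto
qed

lemma lipschitz_onto_cube:
  fixes A :: "'a::metric_space set" and y :: "real ^ 'n \<Rightarrow> 'a"
  defines "Q \<equiv> {x :: real ^ 'n. \<forall>i. 0 \<le> x $ i \<and> x $ i \<le> 1}"
  assumes c: "0 < c" and yA: "\<And>z. z \<in> Q \<Longrightarrow> y z \<in> A"
    and y: "\<And>z z' i. z \<in> Q \<Longrightarrow> z' \<in> Q \<Longrightarrow> c * \<bar>z $ i - z' $ i\<bar> \<le> dist (y z) (y z')"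
  shows "\<exists>f :: 'a \<Rightarrow> real ^ 'n. (\<exists>L. L-lipschitz_on A f) \<and> f ` A = Q"
proof -
  \<comment> \<open>McShane extension of the function taking \<open>y z\<close> to
    \<open>z $ i\<close>; by the expansion hypothesis it is well defined and
    \<open>1 / c\<close>-Lipschitz on the range of \<open>y\<close>.\<close>
  define h where "h i a = (INF z\<in>Q. z $ i + dist a (y z) / c)" for i a
  have Q0: "0 \<in> Q" unfolding Q_def by simp
  have bdd: "bdd_below ((\<lambda>z. z $ i + dist a (y z) / c) ` Q)" for i a
    using c by (intro bdd_belowI2[of _ 0]) (auto simp: Q_def)
  have h_le: "h i a \<le> h i b + dist a b / c" for i a b
  proof -
    have "h i a - dist a b / c \<le> h i b"
      unfolding h_def[of i b]
    proof (rule cINF_greatest)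
      show "Q \<noteq> {}" using Q0 by blast
      fix z assume "z \<in> Q"
      then have "h i a \<le> z $ i + dist a (y z) / c" unfolding h_def by (rule cINF_lower[OF bdd])
      also have "\<dots> \<le> z $ i + (dist a b + dist b (y z)) / c"
        using c by (intro add_left_mono divide_right_mono dist_triangle) auto
      finally show "h i a - dist a b / c \<le> z $ i + dist b (y z) / c" by (simp add: add_divide_distrib)
    qed
    then show ?thesis by simp
  qed
  have hy: "h i (y z) = z $ i" if z: "z \<in> Q" for i z
  proof (rule antisym)
    show "h i (y z) \<le> z $ i" using cINF_lower[OF bdd z, of i "y z"] unfolding h_def by simp
    show "z $ i \<le> h i (y z)"
      unfolding h_def
    proof (rule cINF_greatest)
      show "Q \<noteq> {}" using Q0 by blast
      fix z' assume z': "z' \<in> Q"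
      have "\<bar>z $ i - z' $ i\<bar> \<le> dist (y z) (y z') / c" using y[OF z z', of i] c by (simp add: field_simps)
      then show "z $ i \<le> z' $ i + dist (y z) (y z') / c" by linarith
    qed
  qed
  define f where "f a = (\<chi> i. max 0 (min 1 (h i a)))" for a
  have fQ: "f a \<in> Q" for a unfolding f_def Q_def by simp
  have fy: "f (y z) = z" if "z \<in> Q" for z
    using that unfolding f_def hy[OF that] by (simp add: Q_def vec_eq_iff)
  \<comment> \<open>The constant is crude: each coordinate is \<open>1 / c\<close>-Lipschitz, and
    the norm is bounded by the sum of the absolute coordinates.\<close>
  have "(real CARD('n) / c)-lipschitz_on A f"
  proof (rule lipschitz_onI)
    fix a b
    have "\<bar>f a $ i - f b $ i\<bar> \<le> dist a b / c" for i
      using h_le[of i a b] h_le[of i b a] unfolding f_def by (simp add: dist_commute)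
    then have "(\<Sum>i\<in>UNIV. \<bar>(f a - f b) $ i\<bar>) \<le> (\<Sum>i\<in>(UNIV::'n set). dist a b / c)" by (intro sum_mono) simp
    then have "norm (f a - f b) \<le> real CARD('n) * (dist a b / c)"
      using norm_le_l1_cart[of "f a - f b"] by simp
    then show "dist (f a) (f b) \<le> real CARD('n) / c * dist a b" by (simp add: dist_norm)
  qed (use c in simp)
  moreover have "f ` A = Q" using fQ fy yA by (auto simp: image_iff) (metis)
  ultimately show ?thesis by blast
qed

subsection \<open>Hausdorff measure\<close>

text \<open>Small cost already controls the scale: cost at most \<open>\<delta> powr s\<close>
  bounds every size by \<open>\<delta>\<close>. Hence arbitrarily cheap covers without any
  restriction on sizes suffice for measure zero.\<close>

lemma hausdorff_measure_zero_if_cov: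
  fixes A :: "'a::metric_space set"
  assumes s: "0 < s" and c: "\<And>\<kappa>. 0 < \<kappa> \<Longrightarrow> cov s \<kappa> A"
  shows "hausdorff_measure s A = 0"
proof -
  have pre: "hausdorff_pre s \<delta> A \<le> ennreal \<kappa>" if \<delta>: "0 < \<delta>" and kap: "0 < \<kappa>" for \<delta> \<kappa>
  proof -
    define \<mu> where "\<mu> = min \<kappa> (\<delta> powr s)"
    have \<mu>: "0 < \<mu>" "\<mu> \<le> \<kappa>" "\<mu> \<le> \<delta> powr s" unfolding \<mu>_def using \<delta> kap by auto
    obtain I C e where cv: "covering s \<mu> A I C e" using c[OF \<mu>(1)] unfolding cov_def by blast
    \<comment> \<open>Indices outside \<open>I\<close> receive the empty set, of diameter 0 and cost
      \<open>0 powr s = 0\<close>, which adds nothing to the sum.\<close>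
    define D where "D i = (if i \<in> I then C i else {})" for i
    have bD: "bounded (D i)" for i
    proof (cases "D i = {}")
      case False
      then obtain x where x: "x \<in> C i" "i \<in> I" unfolding D_def by (auto split: if_splits)
      then have "\<forall>y\<in>D i. dist x y \<le> e i" using coveringD(3)[OF cv] unfolding D_def by simp
      then show ?thesis unfolding bounded_def by blast
    qed simp
    have dD: "diameter (D i) \<le> e i" if "i \<in> I" for i
    proof (cases "D i = {}")
      case False
      have "(SUP (x, y)\<in>D i \<times> D i. dist x y) \<le> e i"
      proof (rule cSUP_least)
        show "D i \<times> D i \<noteq> {}" using False by simp
        show "(case p of (x, y) \<Rightarrow> dist x y) \<le> e i" if "p \<in> D i \<times> D i" for p
        proof -
          have "fst p \<in> C i" "snd p \<in> C i" using that \<open>i \<in> I\<close> unfolding D_def by auto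
          then show ?thesis using coveringD(3)[OF cv \<open>i \<in> I\<close>] by (simp add: case_prod_beta)
        qed
      qed
      then show ?thesis unfolding diameter_def using False by simp
    next
      case True
      then show ?thesis using coveringD(2)[OF cv that] by simp
    qed
    have e\<delta>: "e i \<le> \<delta>" if "i \<in> I" for i
    proof (rule ccontr)
      assume "\<not> e i \<le> \<delta>"
      then have "\<delta> powr s < e i powr s" using \<delta> s by (intro powr_less_mono2) auto
      moreover have "e i powr s \<le> \<mu>" using coveringD(4)[OF cv, of "{i}"] that by simp
      ultimately show False using \<mu>(3) by linarith
    qed
    have D0: "diameter (D i) = 0" if "i \<notin> I" for i using that unfolding D_def by simp
    have mem: "D \<in> {C. A \<subseteq> (\<Union>i. C i) \<and> (\<forall>i. bounded (C i) \<and> diameter (C i) \<le> \<delta>)}"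
    proof -
      have "A \<subseteq> (\<Union>i. D i)" using coveringD(1)[OF cv] unfolding D_def by fastforce
      moreover have "diameter (D i) \<le> \<delta>" for i
        using dD[of i] e\<delta>[of i] D0[of i] \<delta> by (cases "i \<in> I") auto
      ultimately show ?thesis using bD by blast
    qed
    have "(\<Sum>i<n. diameter (D i) powr s) \<le> \<kappa>" for n
    proof -
      have "(\<Sum>i<n. diameter (D i) powr s) = (\<Sum>i\<in>{..<n} \<inter> I. diameter (D i) powr s)"
        by (rule sum.mono_neutral_right) (use D0 in auto)
      also have "\<dots> \<le> (\<Sum>i\<in>{..<n} \<inter> I. e i powr s)"
        using dD s bD by (intro sum_mono powr_mono2) (auto simp: diameter_ge_0)
      also have "\<dots> \<le> \<mu>" by (rule coveringD(4)[OF cv]) auto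
      finally show ?thesis using \<mu>(2) by linarith
    qed
    then have "(\<Sum>i<n. ennreal (diameter (D i) powr s)) \<le> ennreal \<kappa>" for n
      by (simp add: sum_ennreal ennreal_leI)
    then have "(\<Sum>i. ennreal (diameter (D i) powr s)) \<le> ennreal \<kappa>"
      by (intro suminf_le_const summableI) simp
    then show ?thesis unfolding hausdorff_pre_def by (rule INF_lower2[OF mem])
  qed
  have "hausdorff_pre s \<delta> A \<le> 0" if \<delta>: "0 < \<delta>" for \<delta>
  proof (rule ennreal_le_epsilon)
    fix \<epsilon> :: real assume "0 < \<epsilon>"
    then show "hausdorff_pre s \<delta> A \<le> 0 + ennreal \<epsilon>" using pre[OF \<delta>] by simp
  qed
  then have "hausdorff_measure s A \<le> 0" unfolding hausdorff_measure_def by (intro SUP_least) auto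
  then show ?thesis by simp
qed

theorem theorem2p6:
  fixes A :: "'a::polish_space set"
  assumes "analytic A"
    and "hausdorff_dim A > ereal (real CARD('n::finite))"
  shows "\<exists>f :: 'a \<Rightarrow> real ^ 'n. (\<exists>L. L-lipschitz_on A f) \<and>
           f ` A = {x. \<forall>i. 0 \<le> x $ i \<and> x $ i \<le> 1}"
proof -
  obtain s where s: "real CARD('n) < s" "ereal s < hausdorff_dim A"
    using ereal_dense2[OF assms(2)] by auto
  have s0: "0 < s" using s(1) of_nat_0_le_iff[of "CARD('n)"] by linarith
  have "hausdorff_measure s A \<noteq> 0"
  proof
    assume "hausdorff_measure s A = 0"
    then have "hausdorff_dim A \<le> ereal s" unfolding hausdorff_dim_def using s0 by (intro Inf_lower) blast
    then show False using s(2) by simp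
  qed
  then obtain \<kappa> where \<kappa>: "0 < \<kappa>" "\<not> cov s \<kappa> A" using hausdorff_measure_zero_if_cov[OF s0] by blast
  then have "A \<noteq> {}" using cov_empty[of \<kappa> s] by auto
  then obtain g :: "(nat \<Rightarrow> nat) \<Rightarrow> 'a" where g: "continuous_on UNIV g" "range g = A"
    using assms(1) unfolding analytic_def by blast
  obtain c y where "0 < c" "\<And>z. z \<in> {x :: real ^ 'n. \<forall>i. 0 \<le> x $ i \<and> x $ i \<le> 1} \<Longrightarrow> y z \<in> A"
    "\<And>z z' i. z \<in> {x :: real ^ 'n. \<forall>i. 0 \<le> x $ i \<and> x $ i \<le> 1} \<Longrightarrow>
      z' \<in> {x. \<forall>i. 0 \<le> x $ i \<and> x $ i \<le> 1} \<Longrightarrow> c * \<bar>z $ i - z' $ i\<bar> \<le> dist (y z) (y z')"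
    using expanding_map_from_cube[OF g s(1) \<kappa>(2,1)] by blast
  then show ?thesis by (rule lipschitz_onto_cube)
qed

end
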